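(* Let $-1<\rho<1$, let $F$ be the limiting expected spectral distribution function of $W=\frac{1}{N^2}X^2X^{*2}$ for real Gaussian elliptic random matrices $X$ of size $N\times N$ with parameter $\rho$ (as $N\to\infty$), and let $G$ be its symmetrization. The distribution $G(x)$ is uniquely determined by its free cumulants $c_n(\rho)$, $n\ge1$. The odd free cumulants are equal to zero, and the even free cumulants are Narayana polynomials of type B: $$c_{2n}(\rho)=\sum_{k=0}^{n}\binom{n}{k}^2\rho^{2k}.$$ The $\mathcal{R}$-transform of the distribution $G(x)$ is $$\mathcal{R}_G(z)=\frac1z\left(\frac{1}{\sqrt{\left((\rho^2-1)z^2-1\right)^2-4z^2}}-1\right).$$
   Context: A real Gaussian elliptic random matrix with parameter $\rho\in(-1,1)$ of size $N\times N$ is the matrix $X=(X_{ij})_{1\le i,j\le N}$ built from a family of mutually independent real Gaussian vectors $(X_{ij},X_{ji})$, $1\le i\le j$, such that $\mathbb{E}X_{ij}=\mathbb{E}X_{ji}=0$, $\mathbb{E}X_{ij}^2=\mathbb{E}X_{ji}^2=1$, and $\mathbb{E}X_{ij}X_{ji}=\rho$ for any $i\ne j$. $X^*$ is the (conjugate) transpose of $X$, and $X^{*2}=(X^* )^2$. If $\lambda_1\le\dots\le\lambda_N$ are the eigenvalues of $W$, set $\mathcal{F}_N(x)=\frac1N\#\{i:\lambda_i\le x\}$, $F_N(x)=\mathbb{E}\mathcal{F}_N(x)$, and $F(x)=\lim_{N\to\infty}F_N(x)$; this limit exists and is the distribution function of a compactly supported probability measure on $[0,\infty)$. The symmetrization $G$: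 if $\xi\ge0$ has distribution $F$ and $\epsilon$ is a random variable independent of $\xi$ with $\Pr\{\epsilon=\pm1\}=\frac12$, then $G$ is the distribution function of $\eta=\epsilon\sqrt{\xi}$, that is, $G(x)=\frac12(1+\mathrm{sgn}(x)F(x^2))$. Its $2k$-th moments are $M_k(\rho)=\int x^k\,dF(x)$ and its odd moments are $0$. Free cumulants of a compactly supported probability distribution $\mu$ with moments $M_m$: the Cauchy transform is $s_\mu(z)=\sum_{m=0}^\infty M_m z^{-m-1}$; the $\mathcal{R}$-transform $\mathcal{R}_\mu$ is the solution of $\mathcal{R}_\mu(s_\mu(z))+\frac{1}{s_\mu(z)}=z$; the free cumulants $\{c_n\}_{n\ge1}$ of $\mu$ are the coefficients of the power series expansion $\mathcal{R}_\mu(z)=\sum_{n=0}^\infty c_{n+1}z^n$. The formula for $\mathcal{R}_G$ is understood as an identity of power series at $z=0$, with the branch of the square root equal to $1$ at $z=0$. *)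

theory Defs
  imports
    "HOL-Probability.Probability"
    "HOL-Computational_Algebra.Formal_Laurent_Series"
    "Jordan_Normal_Form.Char_Poly"
begin

text \<open>Constants count as (degenerate) Gaussian variables: this is needed for the
  diagonal vectors \<open>(X\<^sub>i\<^sub>i, X\<^sub>i\<^sub>i)\<close> below.\<close>

definition gaussian_rv :: "'a measure \<Rightarrow> ('a \<Rightarrow> real) \<Rightarrow> bool" where
  "gaussian_rv M Z \<longleftrightarrow> Z \<in> borel_measurable M \<and>
     ((\<exists>m \<sigma>. \<sigma> > 0 \<and> distributed M lborel Z (normal_density m \<sigma>)) \<or>
      (\<exists>m. AE \<omega> in M. Z \<omega> = m))"

definition gaussian_vector2 :: "'a measure \<Rightarrow> ('a \<Rightarrow> real \<times> real) \<Rightarrow> bool" where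
  "gaussian_vector2 M Z \<longleftrightarrow>
     (\<forall>a b. gaussian_rv M (\<lambda>\<omega>. a * fst (Z \<omega>) + b * snd (Z \<omega>)))"

text \<open>Rows and columns are numbered \<open>0, \<dots>, N - 1\<close>.\<close>

definition elliptic_matrix :: "'a measure \<Rightarrow> real \<Rightarrow> nat \<Rightarrow> ('a \<Rightarrow> real mat) \<Rightarrow> bool" where
  "elliptic_matrix M \<rho> N X \<longleftrightarrow>
     prob_space M \<and>
     (\<forall>\<omega>\<in>space M. X \<omega> \<in> carrier_mat N N) \<and>
     prob_space.indep_vars M (\<lambda>_. borel \<Otimes>\<^sub>M borel)
       (\<lambda>(i, j) \<omega>. (X \<omega> $$ (i, j), X \<omega> $$ (j, i))) {(i, j). i \<le> j \<and> j < N} \<and>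
     (\<forall>i<N. \<forall>j<N. gaussian_vector2 M (\<lambda>\<omega>. (X \<omega> $$ (i, j), X \<omega> $$ (j, i)))) \<and>
     (\<forall>i<N. \<forall>j<N. prob_space.expectation M (\<lambda>\<omega>. X \<omega> $$ (i, j)) = 0) \<and>
     (\<forall>i<N. \<forall>j<N. prob_space.expectation M (\<lambda>\<omega>. (X \<omega> $$ (i, j))\<^sup>2) = 1) \<and>
     (\<forall>i<N. \<forall>j<N. i \<noteq> j \<longrightarrow>
        prob_space.expectation M (\<lambda>\<omega>. X \<omega> $$ (i, j) * X \<omega> $$ (j, i)) = \<rho>)"

text \<open>The eigenvalues are counted with their multiplicity as roots of the characteristic
  polynomial; for a symmetric real matrix of size \<open>N\<close> there are \<open>N\<close> of them.\<close>

definition spectral_df :: "nat \<Rightarrow> real mat \<Rightarrow> real \<Rightarrow> real" where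
  "spectral_df N W x = 1 / real N * real (size {# l \<in># proots (char_poly W). l \<le> x #})"

definition square_covariance :: "nat \<Rightarrow> real mat \<Rightarrow> real mat" where
  "square_covariance N A = (1 / (real N)\<^sup>2) \<cdot>\<^sub>m ((A ^\<^sub>m 2) * (transpose_mat A ^\<^sub>m 2))"

definition expected_spectral_df :: "'a measure \<Rightarrow> nat \<Rightarrow> ('a \<Rightarrow> real mat) \<Rightarrow> real \<Rightarrow> real" where
  "expected_spectral_df M N X x =
     prob_space.expectation M (\<lambda>\<omega>. spectral_df N (square_covariance N (X \<omega>)) x)"

definition limiting_spectral_df ::
  "(nat \<Rightarrow> 'a measure) \<Rightarrow> (nat \<Rightarrow> 'a \<Rightarrow> real mat) \<Rightarrow> real \<Rightarrow> real" where
  "limiting_spectral_df M X x = lim (\<lambda>N. expected_spectral_df (M N) N (X N) x)"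

text \<open>The law of \<open>\<epsilon> * sqrt \<xi>\<close>, where \<open>\<epsilon>\<close> is a uniform random sign independent of a
  variable \<open>\<xi>\<close> with law \<open>\<mu>\<close>. It is meant for \<open>\<mu>\<close> concentrated on \<open>[0, \<infinity>)\<close>.\<close>

definition symmetrization :: "real measure \<Rightarrow> real measure" where
  "symmetrization \<mu> =
     distr (measure_pmf (pmf_of_set {-1, 1}) \<Otimes>\<^sub>M \<mu>) borel (\<lambda>(\<epsilon>, \<xi>). \<epsilon> * sqrt \<xi>)"

definition compactly_supported :: "real measure \<Rightarrow> bool" where
  "compactly_supported \<mu> \<longleftrightarrow> real_distribution \<mu> \<and> (\<exists>K. compact K \<and> (AE x in \<mu>. x \<in> K))"

definition moment :: "real measure \<Rightarrow> nat \<Rightarrow> real" where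
  "moment \<mu> m = (\<integral>x. x ^ m \<partial>\<mu>)"

text \<open>The Cauchy transform \<open>s\<^sub>\<mu>(z) = (\<Sum>m. M\<^sub>m z\<^sup>-\<^sup>m\<^sup>-\<^sup>1)\<close> is a power series without constant
  term in the variable \<open>w = 1 / z\<close>. In the equation \<open>R(s\<^sub>\<mu>(z)) + 1 / s\<^sub>\<mu>(z) = z\<close>, an identity
  of formal Laurent series in \<open>w\<close>, the right-hand side is therefore \<open>w\<^sup>-\<^sup>1\<close>.\<close>

definition cauchy_transform :: "real measure \<Rightarrow> real fps" where
  "cauchy_transform \<mu> = Abs_fps (\<lambda>n. case n of 0 \<Rightarrow> 0 | Suc m \<Rightarrow> moment \<mu> m)"

definition is_R_transform :: "real measure \<Rightarrow> real fps \<Rightarrow> bool" where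
  "is_R_transform \<mu> R \<longleftrightarrow>
     fps_to_fls (fps_compose R (cauchy_transform \<mu>)) + inverse (fps_to_fls (cauchy_transform \<mu>))
       = fls_X_inv"

definition R_transform :: "real measure \<Rightarrow> real fps" where
  "R_transform \<mu> = (THE R. is_R_transform \<mu> R)"

text \<open>Meaningful for \<open>n \<ge> 1\<close> only.\<close>

definition free_cumulant :: "real measure \<Rightarrow> nat \<Rightarrow> real" where
  "free_cumulant \<mu> n = fps_nth (R_transform \<mu>) (n - 1)"

lemma R_transform_exists_unique:
  assumes "real_distribution \<mu>"
  shows "\<exists>!R. is_R_transform \<mu> R"
proof -
  interpret real_distribution \<mu> by fact
  define S where "S = cauchy_transform \<mu>"
  define U where "U = fps_shift 1 S"
  have S0: "fps_nth S 0 = 0" and S1: "fps_nth S 1 = 1"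
    by (simp_all add: S_def cauchy_transform_def moment_def prob_space[simplified])
  have SU: "S = fps_X * U"
    by (rule fps_ext) (simp add: U_def S0)
  have U0: "fps_nth U 0 = 1"
    using S1 by (simp add: U_def)
  define T where "T = fps_shift 1 (1 - inverse U)"
  have TX: "fps_X * T = 1 - inverse U"
    by (rule fps_ext) (simp add: T_def U0)
  have iff: "is_R_transform \<mu> R \<longleftrightarrow> fps_compose R S = T" for R
  proof -
    have Xn: "fps_to_fls (fps_X :: real fps) \<noteq> 0" and Un: "fps_to_fls U \<noteq> 0"
      using U0 by auto
    have "U * inverse U = 1"
      using U0 by (simp add: inverse_mult_eq_1')
    hence "fps_to_fls U * fps_to_fls (inverse U) = 1"
      by (metis fls_times_fps_to_fls fps_one_to_fls)
    hence UI: "fps_to_fls (inverse U) = inverse (fps_to_fls U)"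
      using inverse_unique by metis
    have "fps_to_fls fps_X * fps_to_fls T = fps_to_fls (1 - inverse U)"
      by (simp flip: TX add: fls_times_fps_to_fls)
    also have "\<dots> = 1 - inverse (fps_to_fls U)"
      by (simp add: UI)
    finally have XT: "fps_to_fls fps_X * fps_to_fls T = 1 - inverse (fps_to_fls U)" .
    have "t = inverse x - inverse (x * u)" if "x \<noteq> 0" "u \<noteq> 0" "x * t = 1 - inverse u"
      for x t u :: "real fls"
      using that by (simp add: field_simps)
    from this[OF Xn Un XT]
    have "fps_to_fls T = inverse (fps_to_fls fps_X) - inverse (fps_to_fls S)"
      by (simp only: SU fls_times_fps_to_fls)
    moreover have "inverse (fps_to_fls (fps_X :: real fps)) = fls_X_inv"
      by (simp add: fls_inverse_X)
    ultimately have T: "fps_to_fls T = fls_X_inv - inverse (fps_to_fls S)"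
      by simp
    have "is_R_transform \<mu> R \<longleftrightarrow> fps_to_fls (fps_compose R S) = fps_to_fls T"
      unfolding is_R_transform_def T S_def[symmetric] by (simp add: eq_diff_eq)
    thus ?thesis by simp
  qed
  have S1': "fps_nth S 1 \<noteq> 0" using S1 by simp
  have inv0: "fps_nth (fps_inv S) 0 = 0" by (simp add: fps_inv_def)
  show ?thesis
  proof (rule ex1I)
    show "is_R_transform \<mu> (fps_compose T (fps_inv S))"
      unfolding iff using fps_inv[OF S0 S1'] fps_compose_assoc[OF S0 inv0, of T] by simp
  next
    fix R assume "is_R_transform \<mu> R"
    hence "fps_compose R S = T" by (simp add: iff)
    thus "R = fps_compose T (fps_inv S)"
      using fps_inv_right[OF S0 S1'] fps_compose_assoc[OF inv0 S0, of R] by simp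
  qed
qed

end

theory Submission
  imports
    Defs
    "HOL-Library.Landau_Symbols"
    "HOL-Complex_Analysis.Complex_Analysis"
    "Jordan_Normal_Form.Schur_Decomposition"
begin

text \<open>
  Gaussian integration by parts expresses the expected trace of a word in \<open>X\<close> and \<open>X\<^sup>T\<close> by products of two
  traces of shorter words. Up to an error of relative order \<open>1 / N\<close> the expectations of products of traces
  factor, so that the normalized expected traces converge to weighted numbers of non-crossing pairings. For
  the words \<open>(X X X\<^sup>T X\<^sup>T)\<^sup>k\<close> the resulting recursion mixes two sequences, according to the phase at which a
  factor of the periodic word starts; eliminating one of them gives, for \<open>S = w m(w\<^sup>2)\<close> where \<open>m\<close> is the
  generating function of the limit moments, \<open>m\<^sup>2 (((\<rho>\<^sup>2 - 1) S\<^sup>2 - 1)\<^sup>2 - 4 S\<^sup>2) = 1\<close>. As \<open>S\<close> is the Cauchy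
  transform of \<open>G\<close>, this is the formula for its \<open>\<R>\<close>-transform, and the Narayana polynomials enter through
  \<open>(1 - 2 (1 + u) x + (1 - u)\<^sup>2 x\<^sup>2)\<^sup>-\<^sup>1\<^sup>/\<^sup>2\<close>, their generating function.

  The method of moments turns this into weak convergence. Convergence of the distribution functions at every
  point needs that the limit has no atoms: the algebraic equation continues analytically to the slit plane,
  where it bounds the growth of the generating function near the cut more strongly than an atom would allow.
\<close>

section \<open>Walk sums and their Schwinger--Dyson equations\<close>

text \<open>Expectations of products of traces factor without any variance estimate: integration by
  parts is done for a whole list of traces at once, and such lists are closed under it. The main
  terms split the word at the partner of its first letter, which gains one trace and loses two
  letters; every other term has at least one trace less than these and is therefore smaller by a
  factor \<open>N\<close>. As \<rho> may be negative, the error terms are controlled by the absolute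
  values of the mixed moments, for which the same recursion holds as an inequality.

  A second obstacle is measurability. The expected distribution function integrates an eigenvalue
  count, but only traces of powers are polynomials in the entries. Counts are recovered from power
  sums as limits of entire functions, and the ordered eigenvalues from the counts.

  The limit law is obtained by tightness, without a density. All later statements rest on its
  moments: their growth bounds the support, and the algebraic equation for their generating function
  excludes atoms.\<close>

lemma sum_rotate3:
  "(\<Sum>x\<in>A. \<Sum>c\<in>C. \<Sum>d\<in>D. f x c d) = (\<Sum>c\<in>C. \<Sum>d\<in>D. \<Sum>x\<in>A. f x c d)"
  by (simp only: sum.swap[where A = A])

lemma sum_rotate3':
  "(\<Sum>a\<in>A. \<Sum>b\<in>B. \<Sum>k\<in>C. f a b k) = (\<Sum>k\<in>C. \<Sum>a\<in>A. \<Sum>b\<in>B. f a b k)"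
  by (simp only: sum.swap[where B = C])

lemma sum_rotate4:
  "(\<Sum>x\<in>A. \<Sum>b\<in>B. \<Sum>c\<in>C. \<Sum>d\<in>D. f x b c d)
     = (\<Sum>b\<in>B. \<Sum>c\<in>C. \<Sum>d\<in>D. \<Sum>x\<in>A. f x b c d)"
  by (simp only: sum.swap[where A = A])

text \<open>Words in \<open>X\<close> and \<open>X\<^sup>T\<close> are boolean lists, with \<open>True\<close> for \<open>X\<close>. If \<open>F A\<close> is the product of the
  entries of \<open>X\<close> at the positions in \<open>A\<close>, then \<open>walk_sum N w a b F\<close> is the \<open>(a, b)\<close> entry of the word \<open>w\<close>, and
  \<open>trace_sum N ws F\<close> is the product of the traces of the words \<open>ws\<close>. Keeping \<open>F\<close> general allows for mixed moments.\<close>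

definition edge :: "bool \<Rightarrow> nat \<Rightarrow> nat \<Rightarrow> nat \<times> nat" where
  "edge l a b = (if l then (a, b) else (b, a))"

primrec walk_sum ::
  "nat \<Rightarrow> bool list \<Rightarrow> nat \<Rightarrow> nat \<Rightarrow> ((nat \<times> nat) multiset \<Rightarrow> real) \<Rightarrow> real" where
  "walk_sum N [] a b F = (if a = b then F {#} else 0)"
| "walk_sum N (l # w) a b F = (\<Sum>c<N. walk_sum N w c b (\<lambda>A. F (add_mset (edge l a c) A)))"

primrec trace_sum :: "nat \<Rightarrow> bool list list \<Rightarrow> ((nat \<times> nat) multiset \<Rightarrow> real) \<Rightarrow> real" where
  "trace_sum N [] F = F {#}"
| "trace_sum N (w # ws) F = (\<Sum>a<N. walk_sum N w a a (\<lambda>A. trace_sum N ws (\<lambda>B. F (A + B))))"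

text \<open>Walk sums evaluate \<open>F\<close> only at multisets of positions inside the matrix,
  and only there is a recursion for the moments available; congruence and monotonicity are therefore
  stated relative to this set.\<close>

definition entries :: "nat \<Rightarrow> (nat \<times> nat) multiset set" where
  "entries N = {A. set_mset A \<subseteq> {..<N} \<times> {..<N}}"

lemma entries_empty [simp]: "{#} \<in> entries N"
  by (simp add: entries_def)

lemma entries_union [simp]: "A + B \<in> entries N \<longleftrightarrow> A \<in> entries N \<and> B \<in> entries N"
  by (auto simp: entries_def)

lemma entries_add_edge [simp]:
  "a < N \<Longrightarrow> b < N \<Longrightarrow> add_mset (edge l a b) A \<in> entries N \<longleftrightarrow> A \<in> entries N"
  by (auto simp: entries_def edge_def)

lemma entries_diff: "A \<in> entries N \<Longrightarrow> A - B \<in> entries N"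
  by (auto simp: entries_def dest: in_diffD)

lemma walk_sum_mono:
  "(\<And>A. A \<in> entries N \<Longrightarrow> F A \<le> G A) \<Longrightarrow> a < N \<Longrightarrow> walk_sum N w a b F \<le> walk_sum N w a b G"
  by (induction w arbitrary: a F G) (auto intro!: sum_mono)

lemma walk_sum_cong:
  "(\<And>A. A \<in> entries N \<Longrightarrow> F A = G A) \<Longrightarrow> a < N \<Longrightarrow> walk_sum N w a b F = walk_sum N w a b G"
  by (intro antisym walk_sum_mono) auto

lemma walk_sum_mult: "walk_sum N w a b (\<lambda>A. k * F A) = k * walk_sum N w a b F"
  by (induction w arbitrary: a F) (auto simp: sum_distrib_left)

lemma walk_sum_zero [simp]: "walk_sum N w a b (\<lambda>A. 0) = 0"
  by (induction w arbitrary: a) auto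

lemma walk_sum_add: "walk_sum N w a b (\<lambda>A. F A + G A) = walk_sum N w a b F + walk_sum N w a b G"
  by (induction w arbitrary: a F G) (auto simp: sum.distrib)

lemma walk_sum_sum: "walk_sum N w a b (\<lambda>A. \<Sum>i\<in>I. F i A) = (\<Sum>i\<in>I. walk_sum N w a b (F i))"
  by (induction I rule: infinite_finite_induct) (auto simp: walk_sum_add)

lemma walk_sum_sum_list:
  "walk_sum N w a b (\<lambda>A. \<Sum>i\<leftarrow>xs. F i A) = (\<Sum>i\<leftarrow>xs. walk_sum N w a b (F i))"
  by (induction xs) (auto simp: walk_sum_add)

lemma walk_sum_abs: "a < N \<Longrightarrow> \<bar>walk_sum N w a b F\<bar> \<le> walk_sum N w a b (\<lambda>A. \<bar>F A\<bar>)"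
proof (induction w arbitrary: a F)
  case (Cons l w)
  show ?case
    by (auto intro!: order.trans[OF sum_abs] sum_mono Cons)
qed auto

lemma walk_sum_abs_le:
  "(\<And>A. A \<in> entries N \<Longrightarrow> \<bar>F A\<bar> \<le> G A) \<Longrightarrow> a < N \<Longrightarrow> \<bar>walk_sum N w a b F\<bar> \<le> walk_sum N w a b G"
  by (rule order.trans[OF walk_sum_abs walk_sum_mono])

lemma walk_sum_nonneg: "(\<And>A. 0 \<le> F A) \<Longrightarrow> 0 \<le> walk_sum N w a b F"
  by (induction w arbitrary: a F) (auto intro!: sum_nonneg)

lemma walk_sum_append:
  "a < N \<Longrightarrow> walk_sum N (u @ v) a b F
     = (\<Sum>c<N. walk_sum N u a c (\<lambda>A. walk_sum N v c b (\<lambda>B. F (A + B))))"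
proof (induction u arbitrary: a F)
  case Nil
  have "(\<Sum>c<N. walk_sum N [] a c (\<lambda>A. walk_sum N v c b (\<lambda>B. F (A + B))))
      = (\<Sum>c<N. if a = c then walk_sum N v c b F else 0)"
    by (intro sum.cong) auto
  then show ?case using Nil by simp
next
  case (Cons l u)
  then show ?case
    by (subst append_Cons, subst walk_sum.simps) (simp, rule sum.swap)
qed

lemma walk_sum_commute:
  "walk_sum N u a b (\<lambda>A. walk_sum N v c d (\<lambda>B. F A B))
     = walk_sum N v c d (\<lambda>B. walk_sum N u a b (\<lambda>A. F A B))"
  by (induction u arbitrary: a F) (auto simp: walk_sum_sum)

section \<open>Transposed words and the removal of a letter\<close>

definition transp_word :: "bool list \<Rightarrow> bool list" where
  "transp_word w = map Not (rev w)"

lemma length_transp_word [simp]: "length (transp_word w) = length w"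
  by (simp add: transp_word_def)

lemma edge_Not: "edge (\<not> l) a b = edge l b a"
  by (simp add: edge_def)

text \<open>A walk traversed backwards with all letters exchanged uses the same positions
  (\<open>edge_Not\<close>), and \<open>F\<close> sees nothing but the multiset of
  positions.\<close>

lemma walk_sum_transp:
  "a < N \<Longrightarrow> b < N \<Longrightarrow> walk_sum N (transp_word w) a b F = walk_sum N w b a F"
proof (induction w arbitrary: a b F)
  case (Cons l w)
  have last: "walk_sum N [\<not> l] c b G = G {#edge l b c#}" for c G
  proof -
    have "walk_sum N [\<not> l] c b G = (\<Sum>d<N. if d = b then G {#edge l b c#} else 0)"
      by (auto intro!: sum.cong simp: edge_Not)
    then show ?thesis using Cons.prems by simp
  qed
  have "walk_sum N (transp_word (l # w)) a b F
     = (\<Sum>c<N. walk_sum N (transp_word w) a c (\<lambda>A. F (add_mset (edge l b c) A)))"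
    using Cons.prems by (simp add: transp_word_def walk_sum_append last del: walk_sum.simps)
  also have "\<dots> = (\<Sum>c<N. walk_sum N w c a (\<lambda>A. F (add_mset (edge l b c) A)))"
    using Cons by (intro sum.cong) auto
  finally show ?case by simp
qed (auto simp: transp_word_def)

text \<open>The product rule: for \<open>g e B\<close> a direction at \<open>e\<close> times the
  monomial of \<open>B\<close>, the inner sum is a derivative of the monomial of \<open>A\<close>.
  Differentiating the letter at position \<open>k\<close> cuts the walk into the parts before and
  after that letter, with free endpoints \<open>c\<close> and \<open>d\<close>.\<close>

lemma walk_sum_deriv:
  "a < N \<Longrightarrow> walk_sum N w a b (\<lambda>A. \<Sum>e\<in>#A. g e (A - {#e#}))
     = (\<Sum>k<length w. \<Sum>c<N. \<Sum>d<N. walk_sum N (take k w) a c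
          (\<lambda>U. walk_sum N (drop (Suc k) w) d b (\<lambda>V. g (edge (w ! k) c d) (U + V))))"
proof (induction w arbitrary: a g)
  case (Cons l w)
  have diff: "(\<Sum>e\<in>#A. g e (add_mset x A - {#e#})) = (\<Sum>e\<in>#A. g e (add_mset x (A - {#e#})))" for A x
    by (intro arg_cong[where f = sum_mset] image_mset_cong) auto
  have "walk_sum N (l # w) a b (\<lambda>A. \<Sum>e\<in>#A. g e (A - {#e#}))
    = (\<Sum>c<N. walk_sum N w c b (\<lambda>A. g (edge l a c) A))
        + (\<Sum>x<N. walk_sum N w x b (\<lambda>A. \<Sum>e\<in>#A. g e (add_mset (edge l a x) (A - {#e#}))))"
    by (simp add: walk_sum_add diff sum.distrib)
  also have "(\<Sum>x<N. walk_sum N w x b (\<lambda>A. \<Sum>e\<in>#A. g e (add_mset (edge l a x) (A - {#e#}))))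
    = (\<Sum>x<N. \<Sum>k<length w. \<Sum>c<N. \<Sum>d<N. walk_sum N (take k w) x c
          (\<lambda>U. walk_sum N (drop (Suc k) w) d b
            (\<lambda>V. g (edge (w ! k) c d) (add_mset (edge l a x) (U + V)))))"
    by (intro sum.cong refl Cons.IH[where g = "\<lambda>e B. g e (add_mset _ B)"]) auto
  also have "\<dots> = (\<Sum>k<length w. \<Sum>c<N. \<Sum>d<N. \<Sum>x<N. walk_sum N (take k w) x c
          (\<lambda>U. walk_sum N (drop (Suc k) w) d b
            (\<lambda>V. g (edge (w ! k) c d) (add_mset (edge l a x) (U + V)))))"
    by (rule sum_rotate4)
  also have "(\<Sum>c<N. walk_sum N w c b (\<lambda>A. g (edge l a c) A))
    = (\<Sum>c<N. \<Sum>d<N. if a = c then walk_sum N w d b (\<lambda>A. g (edge l c d) A) else 0)"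
    using Cons.prems by (subst sum.swap) simp
  also have "\<dots> = (\<Sum>c<N. \<Sum>d<N. walk_sum N [] a c (\<lambda>U. walk_sum N w d b (\<lambda>A. g (edge l c d) (U + A))))"
    by (intro sum.cong) auto
  finally show ?case
    by (simp add: sum.distrib sum.lessThan_Suc_shift del: sum.lessThan_Suc)
qed simp

lemma trace_sum_mono:
  "(\<And>A. A \<in> entries N \<Longrightarrow> F A \<le> G A) \<Longrightarrow> trace_sum N ws F \<le> trace_sum N ws G"
  by (induction ws arbitrary: F G) (auto intro!: sum_mono walk_sum_mono)

lemma trace_sum_cong:
  "(\<And>A. A \<in> entries N \<Longrightarrow> F A = G A) \<Longrightarrow> trace_sum N ws F = trace_sum N ws G"
  by (intro antisym trace_sum_mono) auto

lemma trace_sum_mult: "trace_sum N ws (\<lambda>A. k * F A) = k * trace_sum N ws F"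
  by (induction ws arbitrary: F) (auto simp: sum_distrib_left walk_sum_mult)

lemma trace_sum_add: "trace_sum N ws (\<lambda>A. F A + G A) = trace_sum N ws F + trace_sum N ws G"
  by (induction ws arbitrary: F G) (auto simp: sum.distrib walk_sum_add)

lemma trace_sum_zero [simp]: "trace_sum N ws (\<lambda>A. 0) = 0"
  by (induction ws) auto

lemma trace_sum_sum_mset:
  "trace_sum N ws (\<lambda>A. \<Sum>i\<in>#C. F i A) = (\<Sum>i\<in>#C. trace_sum N ws (F i))"
  by (induction C) (auto simp: trace_sum_add)

lemma trace_sum_abs: "\<bar>trace_sum N ws F\<bar> \<le> trace_sum N ws (\<lambda>A. \<bar>F A\<bar>)"
proof (induction ws arbitrary: F)
  case (Cons w ws)
  show ?case
    by (auto intro!: order.trans[OF sum_abs] sum_mono order.trans[OF walk_sum_abs] walk_sum_mono Cons)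
qed auto

lemma trace_sum_nonneg: "(\<And>A. 0 \<le> F A) \<Longrightarrow> 0 \<le> trace_sum N ws F"
  by (induction ws arbitrary: F) (auto intro!: sum_nonneg walk_sum_nonneg)

lemma sum_sum_list_swap: "(\<Sum>a\<in>I. \<Sum>x\<leftarrow>xs. f a x) = (\<Sum>x\<leftarrow>xs. \<Sum>a\<in>I. f a x)"
  by (induction xs) (auto simp: sum.distrib)

text \<open>The ways to cut one letter out of one of the cyclic words, leaving an open word.\<close>

primrec cuts :: "bool list list \<Rightarrow> (bool \<times> bool list \<times> bool list list) list" where
  "cuts [] = []"
| "cuts (w # ws) = map (\<lambda>k. (w ! k, drop (Suc k) w @ take k w, ws)) [0..<length w]
     @ map (\<lambda>(l, p, r). (l, p, w # r)) (cuts ws)"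

lemma cuts_length:
  "(l, p, r) \<in> set (cuts ws) \<Longrightarrow>
     length ws = Suc (length r) \<and> sum_list (map length ws) = Suc (length p + sum_list (map length r))"
  by (induction ws arbitrary: l p r) fastforce+

text \<open>The product rule for a product of traces. Cyclic invariance lets the piece after the
  removed letter be followed by the piece before it, so that a cut trace leaves one open word and
  not two.\<close>

lemma trace_sum_deriv:
  "trace_sum N ws (\<lambda>A. \<Sum>e\<in>#A. g e (A - {#e#}))
     = (\<Sum>(l, p, r)\<leftarrow>cuts ws. \<Sum>c<N. \<Sum>d<N. walk_sum N p d c
          (\<lambda>P. trace_sum N r (\<lambda>B. g (edge l c d) (P + B))))"
proof (induction ws arbitrary: g)
  case (Cons w ws)
  have split: "(\<Sum>e\<in>#A + B. g e (A + B - {#e#}))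
      = (\<Sum>e\<in>#A. g e (A - {#e#} + B)) + (\<Sum>e\<in>#B. g e (A + (B - {#e#})))" for A B
  proof -
    have "(\<Sum>e\<in>#A. g e (A + B - {#e#})) = (\<Sum>e\<in>#A. g e (A - {#e#} + B))"
      by (intro arg_cong[where f = sum_mset] image_mset_cong) auto
    moreover have "(\<Sum>e\<in>#B. g e (A + B - {#e#})) = (\<Sum>e\<in>#B. g e (A + (B - {#e#})))"
      by (intro arg_cong[where f = sum_mset] image_mset_cong) auto
    ultimately show ?thesis by simp
  qed
  have "trace_sum N (w # ws) (\<lambda>A. \<Sum>e\<in>#A. g e (A - {#e#}))
    = (\<Sum>a<N. walk_sum N w a a (\<lambda>A. trace_sum N ws (\<lambda>B. \<Sum>e\<in>#A. g e (A - {#e#} + B))))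
    + (\<Sum>a<N. walk_sum N w a a (\<lambda>A. trace_sum N ws (\<lambda>B. \<Sum>e\<in>#B. g e (A + (B - {#e#})))))"
    by (simp only: trace_sum.simps split walk_sum_add trace_sum_add sum.distrib)
  also have "(\<Sum>a<N. walk_sum N w a a (\<lambda>A. trace_sum N ws (\<lambda>B. \<Sum>e\<in>#A. g e (A - {#e#} + B))))
     = (\<Sum>a<N. walk_sum N w a a (\<lambda>A. \<Sum>e\<in>#A. trace_sum N ws (\<lambda>B. g e (A - {#e#} + B))))"
    by (simp only: trace_sum_sum_mset)
  also have "\<dots> = (\<Sum>a<N. \<Sum>k<length w. \<Sum>c<N. \<Sum>d<N. walk_sum N (take k w) a c
          (\<lambda>U. walk_sum N (drop (Suc k) w) d a (\<lambda>V. trace_sum N ws (\<lambda>B. g (edge (w ! k) c d) (U + V + B)))))"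
    by (intro sum.cong refl walk_sum_deriv[where g = "\<lambda>e A. trace_sum N ws (\<lambda>B. g e (A + B))"]) auto
  also have "\<dots> = (\<Sum>k<length w. \<Sum>c<N. \<Sum>d<N. \<Sum>a<N. walk_sum N (drop (Suc k) w) d a
          (\<lambda>V. walk_sum N (take k w) a c (\<lambda>U. trace_sum N ws (\<lambda>B. g (edge (w ! k) c d) (V + U + B)))))"
    by (subst sum_rotate4) (simp add: walk_sum_commute[of N "take _ _"] add.commute)
  also have "\<dots> = (\<Sum>k<length w. \<Sum>c<N. \<Sum>d<N. walk_sum N (drop (Suc k) w @ take k w) d c
          (\<lambda>P. trace_sum N ws (\<lambda>B. g (edge (w ! k) c d) (P + B))))"
    by (intro sum.cong refl) (simp add: walk_sum_append)
  also have "\<dots> = (\<Sum>(l, p, r)\<leftarrow>map (\<lambda>k. (w ! k, drop (Suc k) w @ take k w, ws)) [0..<length w].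
      \<Sum>c<N. \<Sum>d<N. walk_sum N p d c (\<lambda>P. trace_sum N r (\<lambda>B. g (edge l c d) (P + B))))"
    by (simp add: comp_def interv_sum_list_conv_sum_set_nat atLeast0LessThan)
  also have "(\<Sum>a<N. walk_sum N w a a (\<lambda>A. trace_sum N ws (\<lambda>B. \<Sum>e\<in>#B. g e (A + (B - {#e#})))))
     = (\<Sum>(l, p, r)\<leftarrow>map (\<lambda>(l, p, r). (l, p, w # r)) (cuts ws).
      \<Sum>c<N. \<Sum>d<N. walk_sum N p d c (\<lambda>P. trace_sum N r (\<lambda>B. g (edge l c d) (P + B))))"
  proof -
    have "(\<Sum>a<N. walk_sum N w a a (\<lambda>A. trace_sum N ws (\<lambda>B. \<Sum>e\<in>#B. g e (A + (B - {#e#})))))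
      = (\<Sum>a<N. \<Sum>x\<leftarrow>cuts ws. walk_sum N w a a (\<lambda>A. case x of (l, p, r) \<Rightarrow> \<Sum>c<N. \<Sum>d<N. walk_sum N p d c
          (\<lambda>P. trace_sum N r (\<lambda>B. g (edge l c d) (A + (P + B))))))"
    proof -
      have "trace_sum N ws (\<lambda>B. \<Sum>e\<in>#B. g e (A + (B - {#e#})))
        = (\<Sum>x\<leftarrow>cuts ws. case x of (l, p, r) \<Rightarrow> \<Sum>c<N. \<Sum>d<N. walk_sum N p d c
            (\<lambda>P. trace_sum N r (\<lambda>B. g (edge l c d) (A + (P + B)))))" for A
        by (rule Cons.IH[where g = "\<lambda>e B. g e (A + B)"])
      then show ?thesis by (simp only: walk_sum_sum_list)
    qed
    also have "\<dots> = (\<Sum>x\<leftarrow>cuts ws. \<Sum>a<N. walk_sum N w a a (\<lambda>A. case x of (l, p, r) \<Rightarrow> \<Sum>c<N. \<Sum>d<N. walk_sum N p d c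
          (\<lambda>P. trace_sum N r (\<lambda>B. g (edge l c d) (A + (P + B))))))"
      by (rule sum_sum_list_swap)
    also have "\<dots> = (\<Sum>(l, p, r)\<leftarrow>cuts ws.
      \<Sum>c<N. \<Sum>d<N. walk_sum N p d c (\<lambda>P. trace_sum N (w # r) (\<lambda>B. g (edge l c d) (P + B))))"
    proof -
      have "(\<Sum>a<N. walk_sum N w a a (\<lambda>A. \<Sum>c<N. \<Sum>d<N. walk_sum N p d c
          (\<lambda>P. trace_sum N r (\<lambda>B. g (edge l c d) (A + (P + B))))))
        = (\<Sum>c<N. \<Sum>d<N. walk_sum N p d c (\<lambda>P. trace_sum N (w # r) (\<lambda>B. g (edge l c d) (P + B))))"
        for l p r
        unfolding walk_sum_sum
        by (subst sum_rotate3) (simp add: walk_sum_sum walk_sum_commute[of N w] add_ac)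
      then show ?thesis
        by (intro arg_cong[where f = sum_list] map_cong) auto
    qed
    finally show ?thesis by (simp add: comp_def case_prod_unfold)
  qed
  finally show ?case by (simp add: add.commute)
qed simp

text \<open>The three coefficients are kept free because two instances are used:
  \<open>cov 1 \<rho> (-\<rho>)\<close> is the true covariance, and \<open>cov 1 1 0\<close>
  dominates its absolute value.\<close>

definition cov :: "real \<Rightarrow> real \<Rightarrow> real \<Rightarrow> nat \<times> nat \<Rightarrow> nat \<times> nat \<Rightarrow> real" where
  "cov \<alpha> \<beta> \<gamma> e e' = (if e = e' then \<alpha> else 0) + (if prod.swap e = e' then \<beta> else 0)
     + (if e = e' \<and> fst e = snd e then \<gamma> else 0)"

text \<open>The weight of a pairing of \<open>l\<close> and \<open>l'\<close> whose two steps run in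
  opposite directions, as in a non-crossing pairing of an oriented word. Exchanging \<alpha> and
  \<beta> gives the weight for parallel steps.\<close>

definition letter_cov :: "real \<Rightarrow> real \<Rightarrow> bool \<Rightarrow> bool \<Rightarrow> real" where
  "letter_cov \<alpha> \<beta> l l' = (if l = l' then \<beta> else \<alpha>)"

lemma cov_edge:
  "cov \<alpha> \<beta> \<gamma> (edge l a b) (edge l' c d)
     = (if a = d \<and> b = c then letter_cov \<alpha> \<beta> l l' else 0)
     + (if a = c \<and> b = d then letter_cov \<beta> \<alpha> l l' else 0)
     + (if a = b \<and> b = c \<and> c = d then \<gamma> else 0)"
proof -
  have eq: "edge l a b = edge l' c d \<longleftrightarrow> (if l = l' then a = c \<and> b = d else a = d \<and> b = c)"
    "prod.swap (edge l a b) = edge l' c d \<longleftrightarrow> (if l = l' then a = d \<and> b = c else a = c \<and> b = d)"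
    "fst (edge l a b) = snd (edge l a b) \<longleftrightarrow> a = b"
    unfolding edge_def by (cases l; cases l'; auto)+
  have diag: "(if l = l' then a = c \<and> b = d else a = d \<and> b = c) \<and> a = b \<longleftrightarrow> a = b \<and> b = c \<and> c = d"
    by (cases "l = l'"; simp only: if_True if_False simp_thms; blast)
  show ?thesis
    unfolding cov_def eq diag letter_cov_def
    by (cases "l = l'") (simp_all only: if_True if_False simp_thms add_ac)
qed

text \<open>By \<open>cov_edge\<close> each summand of the covariance determines the second step:
  the first step reversed, the first step repeated, or, for the correction, both steps equal to one
  loop.\<close>

lemma sum_cov:
  "(\<Sum>a<N. \<Sum>b<N. \<Sum>c<N. \<Sum>d<N. cov \<alpha> \<beta> \<gamma> (edge l a b) (edge l' c d) * Q a b c d)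
     = letter_cov \<alpha> \<beta> l l' * (\<Sum>a<N. \<Sum>b<N. Q a b b a)
     + letter_cov \<beta> \<alpha> l l' * (\<Sum>a<N. \<Sum>b<N. Q a b a b) + \<gamma> * (\<Sum>a<N. Q a a a a)"
proof -
  have "(\<Sum>c<N. \<Sum>d<N. cov \<alpha> \<beta> \<gamma> (edge l a b) (edge l' c d) * Q a b c d)
     = letter_cov \<alpha> \<beta> l l' * Q a b b a + letter_cov \<beta> \<alpha> l l' * Q a b a b
       + (if a = b then \<gamma> * Q a a a a else 0)" if "a < N" "b < N" for a b
  proof -
    have "(\<Sum>c<N. \<Sum>d<N. cov \<alpha> \<beta> \<gamma> (edge l a b) (edge l' c d) * Q a b c d)
      = (\<Sum>c<N. \<Sum>d<N. (if d = a then if c = b then letter_cov \<alpha> \<beta> l l' * Q a b b a else 0 else 0))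
      + (\<Sum>c<N. \<Sum>d<N. (if d = b then if c = a then letter_cov \<beta> \<alpha> l l' * Q a b a b else 0 else 0))
      + (\<Sum>c<N. \<Sum>d<N. (if d = a then if c = a then if a = b then \<gamma> * Q a a a a else 0 else 0 else 0))"
    proof -
      have "(if a = d \<and> b = c then k else 0) * Q a b c d
          = (if d = a then if c = b then k * Q a b b a else 0 else 0)"
        "(if a = c \<and> b = d then k else 0) * Q a b c d
          = (if d = b then if c = a then k * Q a b a b else 0 else 0)"
        "(if a = b \<and> b = c \<and> c = d then k else 0) * Q a b c d
          = (if d = a then if c = a then if a = b then k * Q a a a a else 0 else 0 else 0)" for c d k
        by auto
      then show ?thesis
        by (simp only: cov_edge distrib_right sum.distrib)
    qed
    then show ?thesis using that by simp
  qed
  from this have "(\<Sum>a<N. \<Sum>b<N. \<Sum>c<N. \<Sum>d<N. cov \<alpha> \<beta> \<gamma> (edge l a b) (edge l' c d) * Q a b c d)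
    = (\<Sum>a<N. \<Sum>b<N. letter_cov \<alpha> \<beta> l l' * Q a b b a + letter_cov \<beta> \<alpha> l l' * Q a b a b
       + (if a = b then \<gamma> * Q a a a a else 0))"
    by (intro sum.cong refl) auto
  also have "\<dots> = (\<Sum>a<N. \<Sum>b<N. letter_cov \<alpha> \<beta> l l' * Q a b b a)
      + (\<Sum>a<N. \<Sum>b<N. letter_cov \<beta> \<alpha> l l' * Q a b a b) + (\<Sum>a<N. \<gamma> * Q a a a a)"
    unfolding sum.distrib by simp
  finally show ?thesis
    unfolding sum_distrib_left .
qed

text \<open>What the diagonal correction \<gamma> produces: two closed walks forced to share their
  base point, which costs one of the two free summation indices.\<close>

definition pinched_sum ::
  "nat \<Rightarrow> bool list \<Rightarrow> bool list \<Rightarrow> bool list list \<Rightarrow> ((nat \<times> nat) multiset \<Rightarrow> real) \<Rightarrow> real" where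
  "pinched_sum N u v ws F = (\<Sum>a<N. walk_sum N u a a (\<lambda>U. walk_sum N v a a
     (\<lambda>V. trace_sum N ws (\<lambda>B. F (U + V + B)))))"

lemma sum_lessThan_cong2:
  "(\<And>a b. a < N \<Longrightarrow> b < N \<Longrightarrow> f a b = g a b) \<Longrightarrow>
     (\<Sum>a<N::nat. \<Sum>b<N. f a b) = (\<Sum>a<N. \<Sum>b<N. g a b)"
  by (intro sum.cong) auto

lemma trace_sum_two:
  "(\<Sum>a<N. \<Sum>b<N. walk_sum N u b b (\<lambda>U. walk_sum N v a a (\<lambda>V. trace_sum N ws (\<lambda>B. F (U + V + B)))))
     = trace_sum N (u # v # ws) F"
  unfolding trace_sum.simps walk_sum_sum add.assoc by (rule sum.swap)

lemma trace_sum_join: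
  "(\<Sum>a<N. \<Sum>b<N. walk_sum N u b a (\<lambda>U. walk_sum N v a b (\<lambda>V. trace_sum N ws (\<lambda>B. F (U + V + B)))))
     = trace_sum N ((u @ v) # ws) F" (is "(\<Sum>a<N. \<Sum>b<N. ?g a b) = _")
proof -
  have "trace_sum N ((u @ v) # ws) F = (\<Sum>b<N. \<Sum>a<N. ?g a b)"
    unfolding trace_sum.simps by (rule sum.cong[OF refl], rule walk_sum_append) simp
  also have "\<dots> = (\<Sum>a<N. \<Sum>b<N. ?g a b)"
    by (rule sum.swap)
  finally show ?thesis ..
qed

lemma trace_sum_join_transp:
  "(\<Sum>a<N. \<Sum>b<N. walk_sum N u b a (\<lambda>U. walk_sum N v b a (\<lambda>V. trace_sum N ws (\<lambda>B. F (U + V + B)))))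
     = trace_sum N ((u @ transp_word v) # ws) F"
proof -
  have "walk_sum N u b a (\<lambda>U. walk_sum N v b a (\<lambda>V. trace_sum N ws (\<lambda>B. F (U + V + B))))
    = walk_sum N u b a (\<lambda>U. walk_sum N (transp_word v) a b (\<lambda>V. trace_sum N ws (\<lambda>B. F (U + V + B))))"
    if "a < N" "b < N" for a b
    by (simp only: walk_sum_transp[OF that])
  then have "(\<Sum>a<N. \<Sum>b<N. walk_sum N u b a (\<lambda>U. walk_sum N v b a (\<lambda>V. trace_sum N ws (\<lambda>B. F (U + V + B)))))
    = (\<Sum>a<N. \<Sum>b<N. walk_sum N u b a (\<lambda>U. walk_sum N (transp_word v) a b (\<lambda>V. trace_sum N ws (\<lambda>B. F (U + V + B)))))"
    by (rule sum_lessThan_cong2)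
  also have "\<dots> = trace_sum N ((u @ transp_word v) # ws) F"
    by (rule trace_sum_join)
  finally show ?thesis .
qed

text \<open>The pinched sum consists of the terms with \<open>a = b\<close> in the double sum of
  \<open>trace_sum_join\<close> for the concatenated word; after passing to absolute values the
  remaining terms are nonnegative.\<close>

lemma pinched_sum_le: "\<bar>pinched_sum N u v ws F\<bar> \<le> trace_sum N ((u @ v) # ws) (\<lambda>A. \<bar>F A\<bar>)"
proof -
  let ?g = "\<lambda>a b. walk_sum N u b a (\<lambda>U. walk_sum N v a b
      (\<lambda>V. trace_sum N ws (\<lambda>B. \<bar>F (U + V + B)\<bar>)))"
  have "\<bar>pinched_sum N u v ws F\<bar> \<le> (\<Sum>a<N. ?g a a)"
    unfolding pinched_sum_def
    by (rule order.trans[OF sum_abs], rule sum_mono, rule walk_sum_abs_le, rule walk_sum_abs_le,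
        rule trace_sum_abs) simp_all
  also have "\<dots> \<le> (\<Sum>a<N. \<Sum>b<N. ?g a b)"
    by (rule sum_mono, rule member_le_sum[of _ _ "?g _"]) (simp_all add: walk_sum_nonneg trace_sum_nonneg)
  also have "\<dots> = trace_sum N ((u @ v) # ws) (\<lambda>A. \<bar>F A\<bar>)"
    by (rule trace_sum_join)
  finally show ?thesis .
qed

text \<open>The covariance pairs the first letter with another one. If the partner lies in the same
  word, opposite steps split the trace in two and parallel ones reverse a piece of it; if it lies in
  another trace, the two traces merge. The identity is combinatorial and holds for every
  \<open>F\<close>, so it applies to the mixed moments and to their absolute values alike.\<close>

lemma walk_trace_sum_cov:
  "(\<Sum>a<N. \<Sum>b<N. walk_sum N w b a (\<lambda>A. trace_sum N ws (\<lambda>B.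
       \<Sum>e\<in>#A + B. cov \<alpha> \<beta> \<gamma> (edge l a b) e * F (A + B - {#e#}))))
   = (\<Sum>k<length w. letter_cov \<alpha> \<beta> l (w ! k) * trace_sum N (take k w # drop (Suc k) w # ws) F
        + letter_cov \<beta> \<alpha> l (w ! k) * trace_sum N ((take k w @ transp_word (drop (Suc k) w)) # ws) F
        + \<gamma> * pinched_sum N (take k w) (drop (Suc k) w) ws F)
   + (\<Sum>(l', p, r)\<leftarrow>cuts ws. letter_cov \<alpha> \<beta> l l' * trace_sum N ((w @ p) # r) F
        + letter_cov \<beta> \<alpha> l l' * trace_sum N ((w @ transp_word p) # r) F + \<gamma> * pinched_sum N w p r F)"
proof -
  let ?c = "\<lambda>a b e. cov \<alpha> \<beta> \<gamma> (edge l a b) e"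
  have split: "(\<Sum>e\<in>#A + B. g e * F (A + B - {#e#}))
      = (\<Sum>e\<in>#A. g e * F (A - {#e#} + B)) + (\<Sum>e\<in>#B. g e * F (A + (B - {#e#})))" for A B g
  proof -
    have "(\<Sum>e\<in>#A. g e * F (A + B - {#e#})) = (\<Sum>e\<in>#A. g e * F (A - {#e#} + B))"
      by (intro arg_cong[where f = sum_mset] image_mset_cong) auto
    moreover have "(\<Sum>e\<in>#B. g e * F (A + B - {#e#})) = (\<Sum>e\<in>#B. g e * F (A + (B - {#e#})))"
      by (intro arg_cong[where f = sum_mset] image_mset_cong) auto
    ultimately show ?thesis by (simp only: image_mset_union sum_mset.union)
  qed
  have 1: "(\<Sum>a<N. \<Sum>b<N. walk_sum N w b a (\<lambda>A. trace_sum N ws (\<lambda>B. \<Sum>e\<in>#A. ?c a b e * F (A - {#e#} + B))))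
    = (\<Sum>k<length w. \<Sum>a<N. \<Sum>b<N. \<Sum>c<N. \<Sum>d<N. ?c a b (edge (w ! k) c d) *
         walk_sum N (take k w) b c (\<lambda>U. walk_sum N (drop (Suc k) w) d a
           (\<lambda>V. trace_sum N ws (\<lambda>B. F (U + V + B)))))"
  proof -
    have "walk_sum N w b a (\<lambda>A. trace_sum N ws (\<lambda>B. \<Sum>e\<in>#A. ?c a b e * F (A - {#e#} + B)))
      = (\<Sum>k<length w. \<Sum>c<N. \<Sum>d<N. ?c a b (edge (w ! k) c d) *
         walk_sum N (take k w) b c (\<lambda>U. walk_sum N (drop (Suc k) w) d a
           (\<lambda>V. trace_sum N ws (\<lambda>B. F (U + V + B)))))" if "b < N" for a b
      unfolding trace_sum_sum_mset trace_sum_mult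
      by (subst walk_sum_deriv[where g = "\<lambda>e A. ?c a b e * trace_sum N ws (\<lambda>B. F (A + B))", OF that])
         (simp only: walk_sum_mult)
    then show ?thesis
      unfolding sum_rotate3'[where C = "{..<length w}", symmetric]
      by (intro sum.cong[OF refl]) (simp only: lessThan_iff)
  qed
  have 2: "(\<Sum>a<N. \<Sum>b<N. walk_sum N w b a (\<lambda>A. trace_sum N ws (\<lambda>B. \<Sum>e\<in>#B. ?c a b e * F (A + (B - {#e#})))))
    = (\<Sum>(l', p, r)\<leftarrow>cuts ws. \<Sum>a<N. \<Sum>b<N. \<Sum>c<N. \<Sum>d<N. ?c a b (edge l' c d) *
         walk_sum N w b a (\<lambda>U. walk_sum N p d c (\<lambda>V. trace_sum N r (\<lambda>B. F (U + V + B)))))"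
  proof -
    have "walk_sum N w b a (\<lambda>A. trace_sum N ws (\<lambda>B. \<Sum>e\<in>#B. ?c a b e * F (A + (B - {#e#}))))
      = (\<Sum>x\<leftarrow>cuts ws. case x of (l', p, r) \<Rightarrow> \<Sum>c<N. \<Sum>d<N. ?c a b (edge l' c d) *
         walk_sum N w b a (\<lambda>U. walk_sum N p d c (\<lambda>V. trace_sum N r (\<lambda>B. F (U + V + B)))))" for a b
    proof -
      have "trace_sum N ws (\<lambda>B. \<Sum>e\<in>#B. ?c a b e * F (A + (B - {#e#})))
        = (\<Sum>x\<leftarrow>cuts ws. case x of (l', p, r) \<Rightarrow> \<Sum>c<N. \<Sum>d<N. ?c a b (edge l' c d) *
             walk_sum N p d c (\<lambda>V. trace_sum N r (\<lambda>B. F (A + V + B))))" for A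
        by (subst trace_sum_deriv[where g = "\<lambda>e B. ?c a b e * F (A + B)"])
           (simp only: walk_sum_mult trace_sum_mult add.assoc)
      then show ?thesis
        by (simp only: walk_sum_sum_list case_prod_unfold walk_sum_sum walk_sum_mult)
    qed
    then show ?thesis
      by (simp only: sum_sum_list_swap case_prod_unfold)
  qed
  have "(\<Sum>a<N. \<Sum>b<N. walk_sum N w b a (\<lambda>A. trace_sum N ws (\<lambda>B.
       \<Sum>e\<in>#A + B. ?c a b e * F (A + B - {#e#}))))
    = (\<Sum>a<N. \<Sum>b<N. walk_sum N w b a (\<lambda>A. trace_sum N ws (\<lambda>B. \<Sum>e\<in>#A. ?c a b e * F (A - {#e#} + B))))
    + (\<Sum>a<N. \<Sum>b<N. walk_sum N w b a (\<lambda>A. trace_sum N ws (\<lambda>B. \<Sum>e\<in>#B. ?c a b e * F (A + (B - {#e#})))))"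
    by (simp only: split walk_sum_add trace_sum_add sum.distrib)
  then show ?thesis
    by (simp only: 1 2 sum_cov trace_sum_two[of N _ _ _ F] trace_sum_join[of N _ _ _ F]
          trace_sum_join_transp[of N _ _ _ F] pinched_sum_def[symmetric])
qed

section \<open>Schwinger--Dyson equations: exact, with absolute values, and approximate\<close>

definition total_length :: "bool list list \<Rightarrow> nat" where
  "total_length ws = sum_list (map length ws)"

lemma total_simps [simp]: "total_length [] = 0" "total_length (w # ws) = length w + total_length ws"
  by (simp_all add: total_length_def)

text \<open>Majorants of everything except the splitting terms. The words
  \<open>take k w @ drop (Suc k) w\<close> and one of the two copies of \<open>w @ p\<close> come
  from \<open>pinched_sum_le\<close>.\<close>

definition sd_error ::
  "nat \<Rightarrow> bool list \<Rightarrow> bool list list \<Rightarrow> ((nat \<times> nat) multiset \<Rightarrow> real) \<Rightarrow> real" where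
  "sd_error N w ws G =
     (\<Sum>k<length w. trace_sum N ((take k w @ transp_word (drop (Suc k) w)) # ws) G
        + trace_sum N ((take k w @ drop (Suc k) w) # ws) G)
     + (\<Sum>(l, p, r)\<leftarrow>cuts ws. 2 * trace_sum N ((w @ p) # r) G + trace_sum N ((w @ transp_word p) # r) G)"

text \<open>Gaussian integration by parts. On the diagonal the two summands \<open>1\<close> and \<open>\<rho>\<close> of the covariance are both
  present, which the summand \<open>-\<rho>\<close> corrects to the variance \<open>1\<close>.\<close>

definition wick :: "real \<Rightarrow> nat \<Rightarrow> ((nat \<times> nat) multiset \<Rightarrow> real) \<Rightarrow> bool" where
  "wick \<rho> N F \<longleftrightarrow> F {#} = 1 \<and>
     (\<forall>e\<in>{..<N} \<times> {..<N}. \<forall>A\<in>entries N.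
        F (add_mset e A) = (\<Sum>e'\<in>#A. cov 1 \<rho> (-\<rho>) e e' * F (A - {#e'#})))"

lemma trace_sum_Cons_Cons:
  "trace_sum N ((l # w) # ws) F = (\<Sum>a<N. \<Sum>b<N. walk_sum N w b a
     (\<lambda>A. trace_sum N ws (\<lambda>B. F (add_mset (edge l a b) (A + B)))))"
  by simp

lemma edge_less: "a < N \<Longrightarrow> b < N \<Longrightarrow> edge l a b \<in> {..<N} \<times> {..<N}"
  by (simp add: edge_def)

lemma wickD:
  assumes "wick \<rho> N F" "a < N" "b < N" "A \<in> entries N" "B \<in> entries N"
  shows "F (add_mset (edge l a b) (A + B))
    = (\<Sum>e\<in>#A + B. cov 1 \<rho> (-\<rho>) (edge l a b) e * F (A + B - {#e#}))"
  by (rule bspec[OF bspec[OF conjunct2[OF assms(1)[unfolded wick_def]] edge_less]])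
     (use assms in simp_all)

lemma schwinger_dyson:
  assumes "wick \<rho> N F"
  shows "trace_sum N ((l # w) # ws) F
   = (\<Sum>k<length w. letter_cov 1 \<rho> l (w ! k) * trace_sum N (take k w # drop (Suc k) w # ws) F
        + letter_cov \<rho> 1 l (w ! k) * trace_sum N ((take k w @ transp_word (drop (Suc k) w)) # ws) F
        + (-\<rho>) * pinched_sum N (take k w) (drop (Suc k) w) ws F)
   + (\<Sum>(l', p, r)\<leftarrow>cuts ws. letter_cov 1 \<rho> l l' * trace_sum N ((w @ p) # r) F
        + letter_cov \<rho> 1 l l' * trace_sum N ((w @ transp_word p) # r) F + (-\<rho>) * pinched_sum N w p r F)"
proof (rule trans[OF _ walk_trace_sum_cov[of N w ws 1 \<rho> "-\<rho>" l F]], rule trans[OF trace_sum_Cons_Cons],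
    rule sum_lessThan_cong2, rule walk_sum_cong, rule trace_sum_cong)
  fix a b A B assume "a < N" "b < N" "A \<in> entries N" "B \<in> entries N"
  then show "F (add_mset (edge l a b) (A + B))
    = (\<Sum>e\<in>#A + B. cov 1 \<rho> (-\<rho>) (edge l a b) e * F (A + B - {#e#}))"
    by (rule wickD[OF assms])
qed

lemma sum_lessThan_mono2:
  "(\<And>a b. a < N \<Longrightarrow> b < N \<Longrightarrow> f a b \<le> g a b) \<Longrightarrow>
     (\<Sum>a<N::nat. \<Sum>b<N. f a b) \<le> (\<Sum>a<N. \<Sum>b<N. g a b :: real)"
  by (intro sum_mono) auto

lemma sum_mset_abs: "\<bar>\<Sum>x\<in>#A. f x\<bar> \<le> (\<Sum>x\<in>#A. \<bar>f x :: real\<bar>)"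
  by (induction A) auto

lemma letter_cov_abs: "\<bar>\<rho>\<bar> \<le> 1 \<Longrightarrow> \<bar>letter_cov 1 \<rho> l l'\<bar> \<le> 1 \<and> \<bar>letter_cov \<rho> 1 l l'\<bar> \<le> 1"
  by (simp add: letter_cov_def)

lemma swap_eq_iff: "e = e' \<Longrightarrow> prod.swap e = e' \<longleftrightarrow> fst e = snd e"
  by (metis fst_swap prod.collapse snd_swap swap_simp)

text \<open>Taking absolute values turns the recursion into an inequality with nonnegative
  coefficients, which is the form that a growth estimate by induction needs.\<close>

lemma schwinger_dyson_abs:
  assumes "wick \<rho> N F" "\<bar>\<rho>\<bar> \<le> 1"
  shows "trace_sum N ((l # w) # ws) (\<lambda>A. \<bar>F A\<bar>)
    \<le> (\<Sum>k<length w. trace_sum N (take k w # drop (Suc k) w # ws) (\<lambda>A. \<bar>F A\<bar>))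
      + sd_error N w ws (\<lambda>A. \<bar>F A\<bar>)"
proof -
  let ?G = "\<lambda>A. \<bar>F A\<bar>"
  \<comment> \<open>On the diagonal the left-hand side is
    \<open>\<bar>1 + \<rho> - \<rho>\<bar> = 1\<close> against 2 on the right; off the diagonal the
    bound is \<open>\<bar>\<rho>\<bar> \<le> 1\<close>.\<close>
  have cov_le: "\<bar>cov 1 \<rho> (-\<rho>) e e'\<bar> \<le> cov 1 1 0 e e'" for e e'
  proof -
    have bool: "\<bar>(if P then 1 else 0) + (if Q then \<rho> else 0) + (if P \<and> R then - \<rho> else 0)\<bar>
        \<le> (if P then 1 else 0) + (if Q then 1 else 0) + (if P \<and> R then 0 else (0::real))"
      if "P \<Longrightarrow> Q \<longleftrightarrow> R" for P Q R
      using assms(2) that by (cases P; cases Q; cases R) simp_all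
    show ?thesis
      unfolding cov_def by (rule bool) (rule swap_eq_iff)
  qed
  let ?A = "\<Sum>k<length w. trace_sum N (take k w # drop (Suc k) w # ws) ?G"
  let ?B = "\<Sum>k<length w. trace_sum N ((take k w @ transp_word (drop (Suc k) w)) # ws) ?G"
  let ?C = "\<Sum>(l', p, r)\<leftarrow>cuts ws. trace_sum N ((w @ p) # r) ?G + trace_sum N ((w @ transp_word p) # r) ?G"
  have step: "?G (add_mset (edge l a b) (A + B))
      \<le> (\<Sum>e\<in>#A + B. cov 1 1 0 (edge l a b) e * ?G (A + B - {#e#}))"
    if ab: "a < N" "b < N" "A \<in> entries N" "B \<in> entries N" for a b A B
  proof -
    have "?G (add_mset (edge l a b) (A + B))
      = \<bar>\<Sum>e\<in>#A + B. cov 1 \<rho> (-\<rho>) (edge l a b) e * F (A + B - {#e#})\<bar>"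
      by (simp only: wickD[OF assms(1) ab])
    also have "\<dots> \<le> (\<Sum>e\<in>#A + B. \<bar>cov 1 \<rho> (-\<rho>) (edge l a b) e * F (A + B - {#e#})\<bar>)"
      by (rule sum_mset_abs)
    also have "\<dots> \<le> (\<Sum>e\<in>#A + B. cov 1 1 0 (edge l a b) e * ?G (A + B - {#e#}))"
      by (rule sum_mset_mono) (simp add: abs_mult mult_right_mono cov_le)
    finally show ?thesis .
  qed
  have "trace_sum N ((l # w) # ws) ?G
    \<le> (\<Sum>a<N. \<Sum>b<N. walk_sum N w b a (\<lambda>A. trace_sum N ws (\<lambda>B.
       \<Sum>e\<in>#A + B. cov 1 1 0 (edge l a b) e * ?G (A + B - {#e#}))))"
    by (rule ord_eq_le_trans[OF trace_sum_Cons_Cons], rule sum_lessThan_mono2, rule walk_sum_mono,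
        rule trace_sum_mono, rule step)
  also have "\<dots> = ?A + ?B + ?C"
    by (rule trans[OF walk_trace_sum_cov[where F = ?G]])
       (simp add: letter_cov_def sum.distrib del: trace_sum.simps)
  also have "\<dots> \<le> ?A + sd_error N w ws ?G"
  proof -
    have "?B \<le> (\<Sum>k<length w. trace_sum N ((take k w @ transp_word (drop (Suc k) w)) # ws) ?G
        + trace_sum N ((take k w @ drop (Suc k) w) # ws) ?G)"
      by (rule sum_mono) (simp add: trace_sum_nonneg del: trace_sum.simps)
    moreover have "?C \<le> (\<Sum>(l', p, r)\<leftarrow>cuts ws. 2 * trace_sum N ((w @ p) # r) ?G
        + trace_sum N ((w @ transp_word p) # r) ?G)"
      by (rule sum_list_mono) (auto simp: trace_sum_nonneg simp del: trace_sum.simps)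
    ultimately have "?B + ?C \<le> sd_error N w ws ?G"
      unfolding sd_error_def by (rule add_mono)
    then show ?thesis by (simp only: add.assoc add_le_cancel_left)
  qed
  finally show ?thesis .
qed

text \<open>The exact equation minus its splitting terms: all remaining coefficients have modulus at
  most 1, so the rest is bounded by \<open>sd_error\<close> of the absolute values.\<close>

lemma schwinger_dyson_approx:
  assumes "wick \<rho> N F" "\<bar>\<rho>\<bar> \<le> 1"
  shows "\<bar>trace_sum N ((l # w) # ws) F
      - (\<Sum>k<length w. letter_cov 1 \<rho> l (w ! k) * trace_sum N (take k w # drop (Suc k) w # ws) F)\<bar>
    \<le> sd_error N w ws (\<lambda>A. \<bar>F A\<bar>)"
proof -
  let ?G = "\<lambda>A. \<bar>F A\<bar>"
  have le: "\<bar>c * trace_sum N vs F\<bar> \<le> trace_sum N vs ?G" if "\<bar>c\<bar> \<le> 1" for c vs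
    using mult_mono[OF that trace_sum_abs[of N vs F]] by (simp add: abs_mult)
  have pinched_le: "\<bar>(-\<rho>) * pinched_sum N u v vs F\<bar> \<le> trace_sum N ((u @ v) # vs) ?G" for u v vs
    using mult_mono[OF assms(2) pinched_sum_le[of N u v vs F]] by (simp add: abs_mult del: trace_sum.simps)
  note lc = letter_cov_abs[OF assms(2), of l]
  have "trace_sum N ((l # w) # ws) F
      - (\<Sum>k<length w. letter_cov 1 \<rho> l (w ! k) * trace_sum N (take k w # drop (Suc k) w # ws) F)
    = (\<Sum>k<length w. letter_cov \<rho> 1 l (w ! k) * trace_sum N ((take k w @ transp_word (drop (Suc k) w)) # ws) F
        + (-\<rho>) * pinched_sum N (take k w) (drop (Suc k) w) ws F)
     + (\<Sum>(l', p, r)\<leftarrow>cuts ws. letter_cov 1 \<rho> l l' * trace_sum N ((w @ p) # r) F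
        + letter_cov \<rho> 1 l l' * trace_sum N ((w @ transp_word p) # r) F + (-\<rho>) * pinched_sum N w p r F)"
    (is "?L = ?A + ?B")
    unfolding schwinger_dyson[OF assms(1)] by (simp only: sum.distrib)
  note eq = this
  have A: "\<bar>?A\<bar> \<le> (\<Sum>k<length w. trace_sum N ((take k w @ transp_word (drop (Suc k) w)) # ws) ?G
        + trace_sum N ((take k w @ drop (Suc k) w) # ws) ?G)"
    by (rule order.trans[OF sum_abs], rule sum_mono, rule order.trans[OF abs_triangle_ineq], rule add_mono,
        rule le, simp add: lc, rule pinched_le)
  have B: "\<bar>?B\<bar> \<le> (\<Sum>(l, p, r)\<leftarrow>cuts ws. 2 * trace_sum N ((w @ p) # r) ?G + trace_sum N ((w @ transp_word p) # r) ?G)"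
  proof -
    have *: "\<bar>letter_cov 1 \<rho> l l' * trace_sum N ((w @ p) # r) F
        + letter_cov \<rho> 1 l l' * trace_sum N ((w @ transp_word p) # r) F + (-\<rho>) * pinched_sum N w p r F\<bar>
      \<le> 2 * trace_sum N ((w @ p) # r) ?G + trace_sum N ((w @ transp_word p) # r) ?G" for l' p r
      using le[of "letter_cov 1 \<rho> l l'" "(w @ p) # r"] le[of "letter_cov \<rho> 1 l l'" "(w @ transp_word p) # r"]
        pinched_le[of w p r] lc[of l'] by linarith
    show ?thesis
      by (rule order.trans[OF sum_list_abs], subst map_map, rule sum_list_mono, clarify,
          simp only: o_apply prod.case, rule *)
  qed
  show ?thesis
    unfolding eq sd_error_def by (rule order.trans[OF abs_triangle_ineq add_mono[OF A B]])
qed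

text \<open>The weighted number of non-crossing pairings of the letters of a word; \<open>k\<close> is the position of the
  partner of the first letter.\<close>

fun free_moment :: "real \<Rightarrow> bool list \<Rightarrow> real" where
  "free_moment \<rho> [] = 1"
| "free_moment \<rho> (l # w) = (\<Sum>k<length w. letter_cov 1 \<rho> l (w ! k)
     * free_moment \<rho> (take k w) * free_moment \<rho> (drop (Suc k) w))"

section \<open>Orders of magnitude and limits of trace products\<close>

lemma sqrt_power_bigo: "i \<le> j \<Longrightarrow> (\<lambda>N. sqrt (real N) ^ i) \<in> O(\<lambda>N. sqrt (real N) ^ j)"
  by (intro bigoI[of _ 1] eventually_mono[OF eventually_ge_at_top[of 1]]) (auto intro: power_increasing)

lemma sum_list_in_bigo:
  "(\<And>x. x \<in> set xs \<Longrightarrow> f x \<in> O[F](g)) \<Longrightarrow> (\<lambda>n. \<Sum>x\<leftarrow>xs. f x n :: real) \<in> O[F](g)"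
  by (induction xs) (auto intro: sum_in_bigo)

text \<open>A product of \<open>n\<close> traces with \<open>m\<close> letters in total has order
  \<open>N ^ (n + m / 2)\<close>; powers of \<open>sqrt N\<close> make this uniform in the parity of
  \<open>m\<close>. The lists in \<open>sd_error N w ws\<close> have at most
  \<open>Suc (length ws)\<close> traces and one letter less than \<open>w # ws\<close>, whence the
  exponent.\<close>

lemma sd_error_bigo:
  assumes "\<And>vs. length vs \<le> Suc (length ws) \<Longrightarrow> total_length vs + 1 = length w + total_length ws \<Longrightarrow>
      (\<lambda>N. trace_sum N vs (G N)) \<in> O(\<lambda>N. sqrt (real N) ^ (2 * length vs + total_length vs))"
  shows "(\<lambda>N. sd_error N w ws (G N)) \<in> O(\<lambda>N. sqrt (real N) ^ (2 * length ws + length w + total_length ws + 1))"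
proof -
  have *: "(\<lambda>N. trace_sum N vs (G N)) \<in> O(\<lambda>N. sqrt (real N) ^ (2 * length ws + length w + total_length ws + 1))"
    if "length vs \<le> Suc (length ws)" "total_length vs + 1 = length w + total_length ws" for vs
    by (rule landau_o.big.trans[OF assms[OF that] sqrt_power_bigo]) (use that in linarith)
  show ?thesis
    unfolding sd_error_def
  proof (rule sum_in_bigo, rule big_sum_in_bigo, rule sum_in_bigo)
    fix k assume "k \<in> {..<length w}"
    then have len: "length ((take k w @ u) # ws) \<le> Suc (length ws)"
      "total_length ((take k w @ u) # ws) + 1 = length w + total_length ws"
      if "length u = length (drop (Suc k) w)" for u
      using that by simp_all
    show "(\<lambda>N. trace_sum N ((take k w @ transp_word (drop (Suc k) w)) # ws) (G N))
        \<in> O(\<lambda>N. sqrt (real N) ^ (2 * length ws + length w + total_length ws + 1))"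
      by (rule *; rule len) simp_all
    show "(\<lambda>N. trace_sum N ((take k w @ drop (Suc k) w) # ws) (G N))
        \<in> O(\<lambda>N. sqrt (real N) ^ (2 * length ws + length w + total_length ws + 1))"
      by (rule *; rule len) simp_all
  next
    show "(\<lambda>N. \<Sum>(l, p, r)\<leftarrow>cuts ws. 2 * trace_sum N ((w @ p) # r) (G N) + trace_sum N ((w @ transp_word p) # r) (G N))
        \<in> O(\<lambda>N. sqrt (real N) ^ (2 * length ws + length w + total_length ws + 1))"
    proof (rule sum_list_in_bigo)
      fix x assume x: "x \<in> set (cuts ws)"
      obtain l p r where [simp]: "x = (l, p, r)" by (cases x) auto
      have len: "length ws = Suc (length r)" "total_length ws = Suc (length p + total_length r)"
        using cuts_length[of l p r ws] x by (simp_all add: total_length_def)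
      have "(\<lambda>N. 2 * trace_sum N ((w @ p) # r) (G N)) \<in> O(\<lambda>N. sqrt (real N) ^ (2 * length ws + length w + total_length ws + 1))"
        "(\<lambda>N. trace_sum N ((w @ transp_word p) # r) (G N)) \<in> O(\<lambda>N. sqrt (real N) ^ (2 * length ws + length w + total_length ws + 1))"
      proof -
        have "length ((w @ p) # r) \<le> Suc (length ws)" "total_length ((w @ p) # r) + 1 = length w + total_length ws"
          "length ((w @ transp_word p) # r) \<le> Suc (length ws)"
          "total_length ((w @ transp_word p) # r) + 1 = length w + total_length ws"
          using len by simp_all
        from *[OF this(1,2)] *[OF this(3,4)]
        show "(\<lambda>N. 2 * trace_sum N ((w @ p) # r) (G N)) \<in> O(\<lambda>N. sqrt (real N) ^ (2 * length ws + length w + total_length ws + 1))"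
          "(\<lambda>N. trace_sum N ((w @ transp_word p) # r) (G N)) \<in> O(\<lambda>N. sqrt (real N) ^ (2 * length ws + length w + total_length ws + 1))"
          by (simp_all del: trace_sum.simps power_add length_append)
      qed
      then show "(\<lambda>N. case x of (l, p, r) \<Rightarrow> 2 * trace_sum N ((w @ p) # r) (G N) + trace_sum N ((w @ transp_word p) # r) (G N))
          \<in> O(\<lambda>N. sqrt (real N) ^ (2 * length ws + length w + total_length ws + 1))"
        by (auto intro: sum_in_bigo simp del: trace_sum.simps)
    qed
  qed
qed

text \<open>A splitting term has one trace more and two letters less than the list it comes from:
  the measure \<open>length ws + total_length ws\<close> decreases while the exponent stays the
  same. An empty word contributes a factor \<open>N\<close>, which is two powers of the square
  root.\<close>

lemma trace_sum_bigo:
  assumes "\<And>N. N \<ge> 1 \<Longrightarrow> wick \<rho> N (F N)" and "\<bar>\<rho>\<bar> \<le> 1"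
  shows "(\<lambda>N. trace_sum N ws (\<lambda>A. \<bar>F N A\<bar>)) \<in> O(\<lambda>N. sqrt (real N) ^ (2 * length ws + total_length ws))"
proof (induction "length ws + total_length ws" arbitrary: ws rule: less_induct)
  case less
  show ?case
  proof (cases ws)
    case Nil
    then show ?thesis
      using assms(1) by (auto intro!: bigoI[of _ 1] eventually_mono[OF eventually_ge_at_top[of 1]] simp: wick_def)
  next
    case (Cons w vs)
    show ?thesis
    proof (cases w)
      case Nil
      have e: "2 * length ws + total_length ws = 2 + (2 * length vs + total_length vs)"
        by (simp add: Cons Nil)
      have "(\<lambda>N. trace_sum N ws (\<lambda>A. \<bar>F N A\<bar>)) = (\<lambda>N. sqrt (real N) ^ 2 * trace_sum N vs (\<lambda>A. \<bar>F N A\<bar>))"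
        by (simp add: Cons Nil)
      also have "\<dots> \<in> O(\<lambda>N. sqrt (real N) ^ 2 * sqrt (real N) ^ (2 * length vs + total_length vs))"
        by (rule landau_o.big.mult_left, rule less) (simp add: Cons Nil)
      finally show ?thesis unfolding e power_add[of _ 2] .
    next
      fix l w' assume w: "w = l # w'"
      have le: "eventually (\<lambda>N. norm (trace_sum N ws (\<lambda>A. \<bar>F N A\<bar>))
        \<le> norm ((\<Sum>k<length w'. trace_sum N (take k w' # drop (Suc k) w' # vs) (\<lambda>A. \<bar>F N A\<bar>))
          + sd_error N w' vs (\<lambda>A. \<bar>F N A\<bar>))) sequentially"
        using eventually_ge_at_top[of 1]
      proof eventually_elim
        case (elim N)
        have nonneg: "0 \<le> trace_sum N ws (\<lambda>A. \<bar>F N A\<bar>)" by (rule trace_sum_nonneg) simp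
        show ?case
          unfolding real_norm_def abs_of_nonneg[OF nonneg] unfolding Cons w
          by (rule order.trans[OF schwinger_dyson_abs[OF assms(1)[OF elim] assms(2)] abs_ge_self])
      qed
      have "(\<lambda>N. (\<Sum>k<length w'. trace_sum N (take k w' # drop (Suc k) w' # vs) (\<lambda>A. \<bar>F N A\<bar>))
          + sd_error N w' vs (\<lambda>A. \<bar>F N A\<bar>)) \<in> O(\<lambda>N. sqrt (real N) ^ (2 * length ws + total_length ws))"
      proof (rule sum_in_bigo, rule big_sum_in_bigo)
        fix k assume k: "k \<in> {..<length w'}"
        have e: "2 * length (take k w' # drop (Suc k) w' # vs) + total_length (take k w' # drop (Suc k) w' # vs)
            = 2 * length ws + total_length ws"
          using k by (simp add: Cons w)
        show "(\<lambda>N. trace_sum N (take k w' # drop (Suc k) w' # vs) (\<lambda>A. \<bar>F N A\<bar>))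
            \<in> O(\<lambda>N. sqrt (real N) ^ (2 * length ws + total_length ws))"
          by (rule less[of "take k w' # drop (Suc k) w' # vs", unfolded e]) (use k in \<open>simp add: Cons w\<close>)
      next
        have "(\<lambda>N. sd_error N w' vs (\<lambda>A. \<bar>F N A\<bar>))
          \<in> O(\<lambda>N. sqrt (real N) ^ (2 * length vs + length w' + total_length vs + 1))"
          by (rule sd_error_bigo, rule less) (simp add: Cons w)
        then show "(\<lambda>N. sd_error N w' vs (\<lambda>A. \<bar>F N A\<bar>)) \<in> O(\<lambda>N. sqrt (real N) ^ (2 * length ws + total_length ws))"
          by (rule landau_o.big.trans[OF _ sqrt_power_bigo]) (simp add: Cons w)
      qed
      moreover have "(\<lambda>N. trace_sum N ws (\<lambda>A. \<bar>F N A\<bar>))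
        \<in> O(\<lambda>N. (\<Sum>k<length w'. trace_sum N (take k w' # drop (Suc k) w' # vs) (\<lambda>A. \<bar>F N A\<bar>))
          + sd_error N w' vs (\<lambda>A. \<bar>F N A\<bar>))"
        by (rule bigoI[of _ 1]) (simp only: mult_1 le)
      ultimately show ?thesis
        by (rule landau_o.big.trans[rotated])
    qed
  qed
qed

text \<open>The recursion for \<open>free_moment\<close> acts on the first word while the other
  words are carried along, so the limit comes out as a product: this is the asymptotic
  factorization.\<close>

lemma trace_sum_tendsto:
  assumes "\<And>N. N \<ge> 1 \<Longrightarrow> wick \<rho> N (F N)" and "\<bar>\<rho>\<bar> \<le> 1"
  shows "(\<lambda>N. trace_sum N ws (F N) / sqrt (real N) ^ (2 * length ws + total_length ws))
    \<longlonglongrightarrow> (\<Prod>w\<leftarrow>ws. free_moment \<rho> w)"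
proof (induction "length ws + total_length ws" arbitrary: ws rule: less_induct)
  case less
  show ?case
  proof (cases ws)
    case Nil
    have "eventually (\<lambda>N. trace_sum N ws (F N) / sqrt (real N) ^ (2 * length ws + total_length ws) = 1) sequentially"
      using eventually_ge_at_top[of 1] by eventually_elim (use assms(1) Nil in \<open>auto simp: wick_def\<close>)
    then show ?thesis by (simp add: Nil tendsto_eventually)
  next
    case (Cons w vs)
    show ?thesis
    proof (cases w)
      case Nil
      have e: "2 * length ws + total_length ws = 2 + (2 * length vs + total_length vs)"
        by (simp add: Cons Nil)
      have "eventually (\<lambda>N. trace_sum N vs (F N) / sqrt (real N) ^ (2 * length vs + total_length vs)
          = trace_sum N ws (F N) / sqrt (real N) ^ (2 * length ws + total_length ws)) sequentially"
        using eventually_ge_at_top[of 1]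
      proof eventually_elim
        case (elim N)
        have "trace_sum N ws (F N) = real N * trace_sum N vs (F N)"
          by (simp add: Cons Nil)
        then show ?case
          unfolding e power_add[of _ 2] using elim by simp
      qed
      moreover have "(\<lambda>N. trace_sum N vs (F N) / sqrt (real N) ^ (2 * length vs + total_length vs))
          \<longlonglongrightarrow> (\<Prod>w\<leftarrow>vs. free_moment \<rho> w)"
        by (rule less) (simp add: Cons Nil)
      ultimately show ?thesis
        by (simp add: Cons Nil tendsto_cong)
    next
      fix l w' assume w: "w = l # w'"
      let ?m = "2 * length ws + total_length ws"
      let ?d = "\<lambda>N. trace_sum N ws (F N)
        - (\<Sum>k<length w'. letter_cov 1 \<rho> l (w' ! k) * trace_sum N (take k w' # drop (Suc k) w' # vs) (F N))"
      have "(\<lambda>N. sd_error N w' vs (\<lambda>A. \<bar>F N A\<bar>)) \<in> O(\<lambda>N. sqrt (real N) ^ (2 * length vs + length w' + total_length vs + 1))"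
        by (rule sd_error_bigo, rule trace_sum_bigo[OF assms])
      moreover have "?d \<in> O(\<lambda>N. sd_error N w' vs (\<lambda>A. \<bar>F N A\<bar>))"
      proof (rule bigoI[of _ 1])
        show "eventually (\<lambda>N. norm (?d N) \<le> 1 * norm (sd_error N w' vs (\<lambda>A. \<bar>F N A\<bar>))) sequentially"
          using eventually_ge_at_top[of 1]
        proof eventually_elim
          case (elim N)
          show ?case
            unfolding Cons w real_norm_def mult_1
            by (rule order.trans[OF schwinger_dyson_approx[OF assms(1)[OF elim] assms(2)] abs_ge_self])
        qed
      qed
      ultimately have "?d \<in> O(\<lambda>N. sqrt (real N) ^ (2 * length vs + length w' + total_length vs + 1))"
        by (rule landau_o.big.trans[rotated])
      \<comment> \<open>The exponent of the error is \<open>?m - 2\<close>, so the ratio is exactly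
        \<open>1 / N\<close> for \<open>N \<ge> 1\<close>.\<close>
      also have "(\<lambda>N. sqrt (real N) ^ (2 * length vs + length w' + total_length vs + 1)) \<in> o(\<lambda>N. sqrt (real N) ^ ?m)"
      proof (rule smalloI_tendsto)
        have "eventually (\<lambda>N. inverse (real N) =
            sqrt (real N) ^ (2 * length vs + length w' + total_length vs + 1) / sqrt (real N) ^ ?m) sequentially"
          using eventually_ge_at_top[of 1]
        proof eventually_elim
          case (elim N)
          have m: "?m = (2 * length vs + length w' + total_length vs + 1) + 2"
            by (simp add: Cons w)
          show ?case unfolding m power_add using elim by (simp add: divide_simps)
        qed
        then show "(\<lambda>N. sqrt (real N) ^ (2 * length vs + length w' + total_length vs + 1) / sqrt (real N) ^ ?m) \<longlonglongrightarrow> 0"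
          using lim_inverse_n by (rule Lim_transform_eventually[rotated])
        show "eventually (\<lambda>N. sqrt (real N) ^ ?m \<noteq> 0) sequentially"
          using eventually_ge_at_top[of 1] by eventually_elim auto
      qed
      finally have d0: "(\<lambda>N. ?d N / sqrt (real N) ^ ?m) \<longlonglongrightarrow> 0"
        by (rule smalloD_tendsto)
      have s: "(\<lambda>N. \<Sum>k<length w'. letter_cov 1 \<rho> l (w' ! k) *
            (trace_sum N (take k w' # drop (Suc k) w' # vs) (F N) / sqrt (real N) ^ ?m))
          \<longlonglongrightarrow> (\<Sum>k<length w'. letter_cov 1 \<rho> l (w' ! k) *
              (\<Prod>w\<leftarrow>take k w' # drop (Suc k) w' # vs. free_moment \<rho> w))"
      proof (intro tendsto_sum tendsto_mult tendsto_const)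
        fix k assume k: "k \<in> {..<length w'}"
        have e: "2 * length (take k w' # drop (Suc k) w' # vs) + total_length (take k w' # drop (Suc k) w' # vs) = ?m"
          using k by (simp add: Cons w)
        show "(\<lambda>N. trace_sum N (take k w' # drop (Suc k) w' # vs) (F N) / sqrt (real N) ^ ?m)
            \<longlonglongrightarrow> (\<Prod>w\<leftarrow>take k w' # drop (Suc k) w' # vs. free_moment \<rho> w)"
          by (rule less[of "take k w' # drop (Suc k) w' # vs", unfolded e]) (use k in \<open>simp add: Cons w\<close>)
      qed
      have "(\<Sum>k<length w'. letter_cov 1 \<rho> l (w' ! k) *
              (\<Prod>w\<leftarrow>take k w' # drop (Suc k) w' # vs. free_moment \<rho> w)) = (\<Prod>w\<leftarrow>ws. free_moment \<rho> w)"
        by (simp add: Cons w sum_distrib_left sum_distrib_right mult_ac)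
      moreover have "?d N / sqrt (real N) ^ ?m + (\<Sum>k<length w'. letter_cov 1 \<rho> l (w' ! k) *
            (trace_sum N (take k w' # drop (Suc k) w' # vs) (F N) / sqrt (real N) ^ ?m))
          = trace_sum N ws (F N) / sqrt (real N) ^ ?m" for N
        unfolding diff_divide_distrib sum_divide_distrib by (simp del: trace_sum.simps)
      ultimately show ?thesis
        using tendsto_add[OF d0 s] by (simp only: add_0)
    qed
  qed
qed

lemma single_trace_tendsto:
  assumes "\<And>N. N \<ge> 1 \<Longrightarrow> wick \<rho> N (F N)" and "\<bar>\<rho>\<bar> \<le> 1" and "length w = 2 * m"
  shows "(\<lambda>N. (\<Sum>a<N. walk_sum N w a a (F N)) / real N ^ (m + 1)) \<longlonglongrightarrow> free_moment \<rho> w"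
proof -
  have "sqrt (real N) ^ (2 * length [w] + total_length [w]) = real N ^ (m + 1)" for N
    by (simp add: assms(3) power_add power_mult)
  with trace_sum_tendsto[OF assms(1,2), of "[w]"] show ?thesis by simp
qed

section \<open>Moments of the limit\<close>

text \<open>The weights depend only on whether two letters agree, not on which letters they
  are.\<close>

lemma free_moment_map_Not: "free_moment \<rho> (map Not w) = free_moment \<rho> w"
proof (induction w rule: length_induct)
  case (1 w)
  show ?case
  proof (cases w)
    case (Cons l w')
    have "free_moment \<rho> (map Not (take k w')) = free_moment \<rho> (take k w')"
      "free_moment \<rho> (map Not (drop (Suc k) w')) = free_moment \<rho> (drop (Suc k) w')" for k
      using 1 Cons by auto
    then show ?thesis
      unfolding Cons by (auto simp: letter_cov_def take_map drop_map intro!: sum.cong)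
  qed simp
qed

lemma free_moment_odd: "odd (length w) \<Longrightarrow> free_moment \<rho> w = 0"
proof (induction w rule: length_induct)
  case (1 w)
  show ?case
  proof (cases w)
    case (Cons l w')
    have "letter_cov 1 \<rho> l (w' ! k) * free_moment \<rho> (take k w') * free_moment \<rho> (drop (Suc k) w') = 0"
      if k: "k < length w'" for k
    proof (cases "odd k")
      case True
      then have "free_moment \<rho> (take k w') = 0" using 1 Cons k by auto
      then show ?thesis by simp
    next
      case False
      then have "odd (length (drop (Suc k) w'))" using 1(2) Cons k by auto
      then have "free_moment \<rho> (drop (Suc k) w') = 0" using 1 Cons by auto
      then show ?thesis by simp
    qed
    then show ?thesis unfolding Cons free_moment.simps by (intro sum.neutral) blast
  qed (use 1 in simp)
qed

text \<open>The factor of length \<open>n\<close>, starting at position \<open>s\<close>, of the periodic word \<open>X X X\<^sup>T X\<^sup>T X X X\<^sup>T X\<^sup>T \<dots>\<close>.\<close>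

definition factor :: "nat \<Rightarrow> nat \<Rightarrow> bool list" where
  "factor s n = map (\<lambda>i. i mod 4 < 2) [s..<s + n]"

lemma length_factor [simp]: "length (factor s n) = n"
  by (simp add: factor_def)

lemma factor_0 [simp]: "factor s 0 = []"
  by (simp add: factor_def)

lemma factor_Suc: "factor s (Suc n) = (s mod 4 < 2) # factor (Suc s) n"
  by (simp add: factor_def upt_rec)

lemma nth_factor: "k < n \<Longrightarrow> factor s n ! k = ((s + k) mod 4 < 2)"
  by (simp add: factor_def)

lemma take_factor: "k \<le> n \<Longrightarrow> take k (factor s n) = factor s k"
  by (rule nth_equalityI) (auto simp: nth_factor)

lemma drop_factor: "k \<le> n \<Longrightarrow> drop k (factor s n) = factor (s + k) (n - k)"
  by (rule nth_equalityI) (auto simp: nth_factor add.assoc)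

lemma factor_add_2: "factor (s + 2) n = map Not (factor s n)"
proof (rule nth_equalityI)
  fix i assume "i < length (factor (s + 2) n)"
  moreover have "((s + 2 + i) mod 4 < 2) = (\<not> (s + i) mod 4 < 2)" by presburger
  ultimately show "factor (s + 2) n ! i = map Not (factor s n) ! i"
    by (simp add: nth_factor del: add_2_eq_Suc')
qed simp

text \<open>A shift by half of the period 4 exchanges the two letters, which
  \<open>free_moment\<close> does not notice. Hence only the parity of the starting position
  matters.\<close>

lemma free_moment_factor_add_even: "free_moment \<rho> (factor (s + 2 * j) n) = free_moment \<rho> (factor s n)"
proof (induction j)
  case (Suc j)
  have "s + 2 * Suc j = (s + 2 * j) + 2" by simp
  then show ?case using Suc by (simp only: factor_add_2 free_moment_map_Not)
qed simp

lemma sum_even_indices: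
  fixes f :: "nat \<Rightarrow> real"
  assumes "\<And>k. odd k \<Longrightarrow> f k = 0"
  shows "(\<Sum>k<Suc (2 * n). f k) = (\<Sum>j\<le>n. f (2 * j))"
  by (induction n) (use assms in \<open>simp_all add: lessThan_Suc_atMost[symmetric]\<close>)

lemma free_moment_factor_rec:
  "free_moment \<rho> (factor s (2 * Suc n)) = (\<Sum>j\<le>n. letter_cov 1 \<rho> (s mod 4 < 2) ((Suc s + 2 * j) mod 4 < 2)
     * free_moment \<rho> (factor (Suc s) (2 * j)) * free_moment \<rho> (factor s (2 * (n - j))))"
proof -
  let ?f = "\<lambda>k. letter_cov 1 \<rho> (s mod 4 < 2) ((Suc s + k) mod 4 < 2)
     * free_moment \<rho> (factor (Suc s) k) * free_moment \<rho> (factor (s + 2 + k) (2 * n - k))"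
  have "free_moment \<rho> (factor s (2 * Suc n)) = (\<Sum>k<Suc (2 * n). ?f k)"
    unfolding mult_Suc_right add_2_eq_Suc factor_Suc[of s] free_moment.simps length_factor
    by (intro sum.cong refl) (simp add: nth_factor take_factor drop_factor)
  also have "\<dots> = (\<Sum>j\<le>n. ?f (2 * j))"
    by (rule sum_even_indices) (simp add: free_moment_odd)
  also have "\<dots> = (\<Sum>j\<le>n. letter_cov 1 \<rho> (s mod 4 < 2) ((Suc s + 2 * j) mod 4 < 2)
     * free_moment \<rho> (factor (Suc s) (2 * j)) * free_moment \<rho> (factor s (2 * (n - j))))"
  proof (rule sum.cong[OF refl])
    fix j
    have "s + 2 + 2 * j = s + 2 * Suc j" "2 * n - 2 * j = 2 * (n - j)" by auto
    then show "?f (2 * j) = letter_cov 1 \<rho> (s mod 4 < 2) ((Suc s + 2 * j) mod 4 < 2)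
     * free_moment \<rho> (factor (Suc s) (2 * j)) * free_moment \<rho> (factor s (2 * (n - j)))"
      by (simp only: free_moment_factor_add_even)
  qed
  finally show ?thesis .
qed

text \<open>\<open>fm0\<close> belongs to words that start with \<open>X X\<close>,
  \<open>fm1\<close> to words that start with \<open>X X\<^sup>T\<close>. The lengths are even but
  need not be multiples of 4: \<open>fm0 \<rho> (2 * k)\<close> is the limit moment of order
  \<open>k\<close>, while the values at odd indices serve to close the recursion.\<close>

definition fm0 :: "real \<Rightarrow> nat \<Rightarrow> real" where "fm0 \<rho> n = free_moment \<rho> (factor 0 (2 * n))"
definition fm1 :: "real \<Rightarrow> nat \<Rightarrow> real" where "fm1 \<rho> n = free_moment \<rho> (factor 1 (2 * n))"

lemma fm0_0 [simp]: "fm0 \<rho> 0 = 1" and fm1_0 [simp]: "fm1 \<rho> 0 = 1"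
  by (simp_all add: fm0_def fm1_def)

lemma fm0_Suc: "fm0 \<rho> (Suc n) = (\<Sum>j\<le>n. (if even j then \<rho> else 1) * fm1 \<rho> j * fm0 \<rho> (n - j))"
proof -
  have "letter_cov 1 \<rho> (0 mod 4 < (2::nat)) ((Suc 0 + 2 * j) mod 4 < 2) = (if even j then \<rho> else 1)" for j
  proof -
    have "(Suc 0 + 2 * j) mod 4 < 2 \<longleftrightarrow> even j" by presburger
    then show ?thesis by (simp add: letter_cov_def)
  qed
  then show ?thesis
    unfolding fm0_def fm1_def free_moment_factor_rec by simp
qed

lemma fm1_Suc: "fm1 \<rho> (Suc n) = (\<Sum>j\<le>n. (if even j then 1 else \<rho>) * fm0 \<rho> j * fm1 \<rho> (n - j))"
proof -
  have "letter_cov 1 \<rho> (1 mod 4 < (2::nat)) ((Suc 1 + 2 * j) mod 4 < 2) = (if even j then 1 else \<rho>)" for j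
  proof -
    have "(Suc 1 + 2 * j) mod 4 < 2 \<longleftrightarrow> odd j" by presburger
    then show ?thesis by (simp add: letter_cov_def)
  qed
  moreover have "free_moment \<rho> (factor (Suc 1) (2 * j)) = free_moment \<rho> (factor 0 (2 * j))" for j
    using free_moment_factor_add_even[of \<rho> 0 1] by simp
  ultimately show ?thesis
    unfolding fm0_def fm1_def free_moment_factor_rec by simp
qed

text \<open>The extremal sequence is that of the Catalan numbers. With \<open>s n\<close> for the
  partial sums of \<open>a k / 4 ^ k\<close>, the recursion gives
  \<open>s (n + 1) \<le> 1 + (s n)\<^sup>2 / 4\<close>, and 2 is the fixed point of this map; no
  closed form is involved.\<close>

lemma quadratic_recursion_bound:
  fixes a :: "nat \<Rightarrow> real"
  assumes nonneg: "\<And>n. a n \<ge> 0" and "a 0 \<le> 1" and rec: "\<And>n. a (Suc n) \<le> (\<Sum>j\<le>n. a j * a (n - j))"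
  shows "a n \<le> 2 * 4 ^ n"
proof -
  let ?b = "\<lambda>n. a n / 4 ^ n"
  have "(\<Sum>k\<le>n. ?b k) \<le> 2" for n
  proof (induction n)
    case (Suc n)
    have "(\<Sum>k\<le>Suc n. ?b k) = a 0 + (\<Sum>k\<le>n. ?b (Suc k))"
      by (simp add: sum.atMost_Suc_shift del: sum.atMost_Suc)
    also have "(\<Sum>k\<le>n. ?b (Suc k)) \<le> (\<Sum>k\<le>n. (\<Sum>j\<le>k. ?b j * ?b (k - j)) / 4)"
    proof (rule sum_mono)
      fix k
      have "?b (Suc k) \<le> (\<Sum>j\<le>k. a j * a (k - j)) / 4 ^ Suc k"
        using rec[of k] by (simp add: divide_right_mono)
      also have "\<dots> = (\<Sum>j\<le>k. ?b j * ?b (k - j)) / 4"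
        unfolding sum_divide_distrib
      proof (rule sum.cong[OF refl])
        fix j assume "j \<in> {..k}"
        then have "(4 :: real) ^ k = 4 ^ j * 4 ^ (k - j)" by (simp flip: power_add)
        then show "a j * a (k - j) / 4 ^ Suc k = ?b j * ?b (k - j) / 4" by simp
      qed
      finally show "?b (Suc k) \<le> (\<Sum>j\<le>k. ?b j * ?b (k - j)) / 4" .
    qed
    also have "\<dots> = (\<Sum>(i, j)\<in>{(i, j). i + j \<le> n}. ?b i * ?b j) / 4"
      unfolding sum_divide_distrib[symmetric] sum.triangle_reindex_eq ..
    also have "(\<Sum>(i, j)\<in>{(i, j). i + j \<le> n}. ?b i * ?b j) \<le> (\<Sum>(i, j)\<in>{..n} \<times> {..n}. ?b i * ?b j)"
      using nonneg by (intro sum_mono2) auto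
    also have "\<dots> = (\<Sum>k\<le>n. ?b k) * (\<Sum>k\<le>n. ?b k)"
      by (simp add: sum_product sum.cartesian_product)
    also have "\<dots> \<le> 2 * 2"
      using Suc nonneg by (intro mult_mono sum_nonneg) auto
    finally show ?case using assms(2) by simp
  qed (use assms(2) in simp)
  moreover have "?b n \<le> (\<Sum>k\<le>n. ?b k)"
    by (rule member_le_sum) (use nonneg in auto)
  ultimately have "?b n \<le> 2" by (rule order.trans[rotated])
  then show ?thesis by (simp add: field_simps)
qed

text \<open>The two sequences are bounded jointly: the maximum of their absolute values satisfies
  the quadratic recursion, as all weights have modulus at most 1.\<close>

lemma fm_bound:
  assumes "\<bar>\<rho>\<bar> \<le> 1"
  shows "\<bar>fm0 \<rho> n\<bar> \<le> 2 * 4 ^ n"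
proof -
  let ?a = "\<lambda>n. max \<bar>fm0 \<rho> n\<bar> \<bar>fm1 \<rho> n\<bar>"
  have "?a n \<le> 2 * 4 ^ n"
  proof (rule quadratic_recursion_bound)
    fix n
    have "\<bar>\<Sum>j\<le>n. c j * f j * g (n - j)\<bar> \<le> (\<Sum>j\<le>n. ?a j * ?a (n - j))"
      if "\<And>j. \<bar>c j\<bar> \<le> 1" "\<And>j. \<bar>f j\<bar> \<le> ?a j" "\<And>j. \<bar>g j\<bar> \<le> ?a j" for c f g :: "nat \<Rightarrow> real"
    proof (rule order.trans[OF sum_abs], rule sum_mono)
      fix j
      have "\<bar>c j\<bar> * \<bar>f j\<bar> * \<bar>g (n - j)\<bar> \<le> 1 * ?a j * ?a (n - j)"
        using that by (intro mult_mono) auto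
      then show "\<bar>c j * f j * g (n - j)\<bar> \<le> ?a j * ?a (n - j)"
        by (simp add: abs_mult)
    qed
    from this[of "\<lambda>j. if even j then \<rho> else 1" "fm1 \<rho>" "fm0 \<rho>"]
      this[of "\<lambda>j. if even j then 1 else \<rho>" "fm0 \<rho>" "fm1 \<rho>"] assms
    show "?a (Suc n) \<le> (\<Sum>j\<le>n. ?a j * ?a (n - j))"
      unfolding fm0_Suc fm1_Suc by simp
  qed (auto simp: le_max_iff_disj)
  then show ?thesis by simp
qed

section \<open>Eigenvalues of the square covariance matrix\<close>

hide_const (open) Finite_Cartesian_Product.row Finite_Cartesian_Product.vec Finite_Cartesian_Product.mat
  Finite_Cartesian_Product.transpose
no_notation Finite_Cartesian_Product.vec_nth (infixl "$" 90)
unbundle no fps_syntax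
no_notation Inner_Product.real_inner_class.inner (infix "\<bullet>" 70)

lemma trace_mat_mult_commute:
  fixes A B :: "'a :: comm_semiring_0 mat"
  assumes "A \<in> carrier_mat n n" "B \<in> carrier_mat n n"
  shows "(\<Sum>i<n. (A * B) $$ (i, i)) = (\<Sum>i<n. (B * A) $$ (i, i))"
proof -
  have "(\<Sum>i<n. (A * B) $$ (i, i)) = (\<Sum>i<n. \<Sum>j<n. A $$ (i, j) * B $$ (j, i))"
    using assms by (intro sum.cong) (auto simp: scalar_prod_def atLeast0LessThan)
  also have "\<dots> = (\<Sum>j<n. \<Sum>i<n. B $$ (j, i) * A $$ (i, j))"
    by (subst sum.swap) (simp add: mult.commute)
  also have "\<dots> = (\<Sum>i<n. (B * A) $$ (i, i))"
    using assms by (intro sum.cong) (auto simp: scalar_prod_def atLeast0LessThan)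
  finally show ?thesis .
qed

lemma upper_triangular_pow:
  fixes B :: "'a :: comm_ring_1 mat"
  assumes "B \<in> carrier_mat n n" "upper_triangular B"
  shows "i < n \<Longrightarrow> j < n \<Longrightarrow> j \<le> i \<Longrightarrow> (B ^\<^sub>m k) $$ (i, j) = (if i = j then (B $$ (i, i)) ^ k else 0)"
proof (induction k arbitrary: i j)
  case (Suc k)
  have "(B ^\<^sub>m Suc k) $$ (i, j) = (\<Sum>m<n. (B ^\<^sub>m k) $$ (i, m) * B $$ (m, j))"
    using assms Suc.prems by (auto simp: scalar_prod_def atLeast0LessThan intro!: sum.cong)
  also have "\<dots> = (\<Sum>m<n. if m = i then (if i = j then (B $$ (i, i)) ^ k * B $$ (i, i) else 0) else 0)"
  proof (rule sum.cong[OF refl])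
    fix m assume m: "m \<in> {..<n}"
    consider "m < i" | "m = i" | "i < m" by linarith
    then show "(B ^\<^sub>m k) $$ (i, m) * B $$ (m, j)
        = (if m = i then (if i = j then (B $$ (i, i)) ^ k * B $$ (i, i) else 0) else 0)"
    proof cases
      case 3
      then have "B $$ (m, j) = 0" using assms m Suc.prems by (intro upper_triangularD) auto
      then show ?thesis using 3 by simp
    next
      case 2
      have "B $$ (i, j) = 0" if "i \<noteq> j"
        using assms m Suc.prems that by (intro upper_triangularD) auto
      then show ?thesis using 2 Suc.IH[of i i] Suc.prems by auto
    qed (use Suc.IH[of i m] Suc.prems m in auto)
  qed
  also have "\<dots> = (if i = j then (B $$ (i, i)) ^ Suc k else 0)"
    using Suc.prems by simp
  finally show ?case .
qed (use assms in auto)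

text \<open>As the characteristic polynomial is a product of linear factors, a Schur form exists
  over the reals; the trace is invariant under similarity, and the diagonal of a power of a
  triangular matrix consists of the powers of its diagonal entries.\<close>

lemma trace_pow_eigenvalues:
  fixes A :: "real mat"
  assumes "A \<in> carrier_mat n n" "char_poly A = (\<Prod>e\<leftarrow>es. [:- e, 1:])"
  shows "(\<Sum>i<n. (A ^\<^sub>m k) $$ (i, i)) = (\<Sum>e\<leftarrow>es. e ^ k)"
proof -
  obtain B P Q where s: "schur_decomposition A es = (B, P, Q)"
    by (cases "schur_decomposition A es")
  from schur_decomposition[OF assms s] have wit: "similar_mat_wit A B P Q"
    and ut: "upper_triangular B" and diag: "diag_mat B = es" by auto
  from similar_mat_witD2[OF assms(1) wit] have
    PQ: "Q * P = 1\<^sub>m n" and B: "B \<in> carrier_mat n n" and P: "P \<in> carrier_mat n n" and Q: "Q \<in> carrier_mat n n"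
    by auto
  have Bk: "B ^\<^sub>m k \<in> carrier_mat n n" using B by simp
  have "(\<Sum>i<n. (A ^\<^sub>m k) $$ (i, i)) = (\<Sum>i<n. (P * (B ^\<^sub>m k * Q)) $$ (i, i))"
    unfolding similar_mat_wit_pow_id[OF wit] using P Bk Q by (simp add: assoc_mult_mat)
  also have "\<dots> = (\<Sum>i<n. (B ^\<^sub>m k * Q * P) $$ (i, i))"
    using P Bk Q by (intro trace_mat_mult_commute) auto
  also have "B ^\<^sub>m k * Q * P = B ^\<^sub>m k"
    unfolding assoc_mult_mat[OF Bk Q P] PQ by (rule right_mult_one_mat[OF Bk])
  also have "(\<Sum>i<n. (B ^\<^sub>m k) $$ (i, i)) = (\<Sum>i<n. (B $$ (i, i)) ^ k)"
    using upper_triangular_pow[OF B ut] by simp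
  also have "\<dots> = (\<Sum>e\<leftarrow>es. e ^ k)"
    unfolding diag[symmetric] diag_mat_def using B
    by (simp add: comp_def interv_sum_list_conv_sum_set_nat atLeast0LessThan)
  finally show ?thesis .
qed

text \<open>The Rayleigh quotient: with \<open>u\<close> the vector \<open>Y\<^sup>T v\<close>, one
  has \<open>a * |v|\<^sup>2 = c * |u|\<^sup>2\<close>. The eigenvector is complex because the
  eigenvalue is not known to be real beforehand.\<close>

lemma gram_eigenvalue:
  fixes Y :: "real mat" and v :: "complex Matrix.vec"
  assumes Y: "Y \<in> carrier_mat n n" and v: "v \<in> carrier_vec n" "v \<noteq> 0\<^sub>v n" and c: "c \<ge> 0"
    and eig: "map_mat complex_of_real (c \<cdot>\<^sub>m (Y * transpose_mat Y)) *\<^sub>v v = a \<cdot>\<^sub>v v"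
  shows "a = complex_of_real (Re a) \<and> 0 \<le> Re a"
proof -
  define u where "u = (\<lambda>k. \<Sum>j<n. complex_of_real (Y $$ (j, k)) * v $ j)"
  have cnj_u: "cnj (u k) = (\<Sum>j<n. complex_of_real (Y $$ (j, k)) * cnj (v $ j))" for k
    by (simp add: u_def)
  have row: "a * v $ i = (\<Sum>k<n. of_real c * (of_real (Y $$ (i, k)) * u k))" if i: "i < n" for i
  proof -
    have "a * v $ i = (map_mat complex_of_real (c \<cdot>\<^sub>m (Y * transpose_mat Y)) *\<^sub>v v) $ i"
      using i v by (simp add: eig)
    also have "\<dots> = (\<Sum>j<n. of_real (c * (\<Sum>k<n. Y $$ (i, k) * Y $$ (j, k))) * v $ j)"
      using i v Y by (auto simp: scalar_prod_def atLeast0LessThan intro!: sum.cong)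
    also have "\<dots> = (\<Sum>j<n. \<Sum>k<n. of_real c * (of_real (Y $$ (i, k)) * (of_real (Y $$ (j, k)) * v $ j)))"
      unfolding of_real_mult of_real_sum sum_distrib_left sum_distrib_right by (simp only: mult_ac)
    also have "\<dots> = (\<Sum>k<n. \<Sum>j<n. of_real c * (of_real (Y $$ (i, k)) * (of_real (Y $$ (j, k)) * v $ j)))"
      by (rule sum.swap)
    also have "\<dots> = (\<Sum>k<n. of_real c * (of_real (Y $$ (i, k)) * u k))"
      by (simp only: u_def sum_distrib_left)
    finally show ?thesis .
  qed
  have "a * (\<Sum>i<n. v $ i * cnj (v $ i)) = (\<Sum>i<n. (a * v $ i) * cnj (v $ i))"
    by (simp only: sum_distrib_left mult.assoc)
  also have "\<dots> = (\<Sum>i<n. (\<Sum>k<n. of_real c * (of_real (Y $$ (i, k)) * u k)) * cnj (v $ i))"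
    by (rule sum.cong) (simp_all only: row lessThan_iff)
  also have "\<dots> = (\<Sum>i<n. \<Sum>k<n. of_real c * (u k * (of_real (Y $$ (i, k)) * cnj (v $ i))))"
    unfolding sum_distrib_right by (simp only: mult_ac)
  also have "\<dots> = (\<Sum>k<n. \<Sum>i<n. of_real c * (u k * (of_real (Y $$ (i, k)) * cnj (v $ i))))"
    by (rule sum.swap)
  also have "\<dots> = of_real c * (\<Sum>k<n. u k * cnj (u k))"
    by (simp only: sum_distrib_left cnj_u)
  finally have eq: "a * of_real (\<Sum>i<n. (cmod (v $ i))\<^sup>2) = of_real (c * (\<Sum>k<n. (cmod (u k))\<^sup>2))"
    unfolding of_real_mult of_real_sum complex_norm_square .
  obtain i where i: "i < n" "v $ i \<noteq> 0"
    using v by (metis carrier_vecD eq_vecI index_zero_vec(1,2))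
  have pos: "(\<Sum>i<n. (cmod (v $ i))\<^sup>2) > 0"
    by (rule sum_pos2[of _ i]) (use i in auto)
  have "a = of_real (c * (\<Sum>k<n. (cmod (u k))\<^sup>2) / (\<Sum>i<n. (cmod (v $ i))\<^sup>2))"
  proof -
    have "a = complex_of_real (t / s)" if "a * of_real s = of_real t" "s > 0" for s t
      using that by (simp add: field_simps)
    from this[OF eq pos] show ?thesis .
  qed
  moreover have "c * (\<Sum>k<n. (cmod (u k))\<^sup>2) / (\<Sum>i<n. (cmod (v $ i))\<^sup>2) \<ge> 0"
    using c by (intro divide_nonneg_nonneg mult_nonneg_nonneg sum_nonneg) auto
  ultimately show ?thesis by (metis Re_complex_of_real)
qed

text \<open>The characteristic polynomial splits over the complex numbers, its roots are real and
  nonnegative by \<open>gram_eigenvalue\<close>, and the factorization descends because the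
  embedding of the coefficients is injective.\<close>

lemma gram_char_poly:
  fixes Y :: "real mat"
  assumes Y: "Y \<in> carrier_mat n n" and c: "c \<ge> 0"
  obtains es where "length es = n" "\<And>e. e \<in> set es \<Longrightarrow> e \<ge> 0"
    "char_poly (c \<cdot>\<^sub>m (Y * transpose_mat Y)) = (\<Prod>e\<leftarrow>es. [:- e, 1:])"
proof -
  interpret h: map_poly_inj_idom_hom complex_of_real ..
  let ?W = "c \<cdot>\<^sub>m (Y * transpose_mat Y)"
  let ?C = "map_mat complex_of_real ?W"
  have W: "?W \<in> carrier_mat n n" and C: "?C \<in> carrier_mat n n" using Y by auto
  obtain as where as: "char_poly ?C = (\<Prod>a\<leftarrow>as. [:- a, 1:])" "length as = n"
    using char_poly_factorized[OF C] by blast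
  have a: "a = complex_of_real (Re a) \<and> 0 \<le> Re a" if "a \<in> set as" for a
  proof -
    have "poly (char_poly ?C) a = 0"
      unfolding as(1) poly_prod_list using that by (force simp: prod_list_zero_iff)
    then have "eigenvalue ?C a" using eigenvalue_root_char_poly[OF C] by simp
    then obtain v where "eigenvector ?C v a" unfolding eigenvalue_def by blast
    then show ?thesis
      using gram_eigenvalue[OF Y _ _ c, of v a] C unfolding eigenvector_def by auto
  qed
  have "map_poly complex_of_real (char_poly ?W) = char_poly ?C"
    by (rule of_real_hom.char_poly_hom[OF W, symmetric])
  also have "\<dots> = (\<Prod>a\<leftarrow>map (complex_of_real \<circ> Re) as. [:- a, 1:])"
    unfolding as(1) using a by (intro arg_cong[where f = prod_list]) (simp cong: map_cong)
  also have "\<dots> = map_poly complex_of_real (\<Prod>e\<leftarrow>map Re as. [:- e, 1:])"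
    by (induction as) (simp_all add: h.hom_mult del: mult_pCons_left)
  finally have "char_poly ?W = (\<Prod>e\<leftarrow>map Re as. [:- e, 1:])"
    by (simp add: h.eq_iff)
  with that[of "map Re as"] a as(2) show ?thesis by auto
qed

lemma proots_linear_factors: "proots (\<Prod>e\<leftarrow>es. [:- e, 1:]) = mset (es :: real list)"
proof -
  have "sum_list (map (\<lambda>e. {#e#}) es) = mset es"
    by (induction es) auto
  moreover have "0 \<notin> set (map (\<lambda>e. [:- e, 1:]) es)" by auto
  note proots_prod_list[OF this]
  ultimately show ?thesis by (simp add: comp_def)
qed

text \<open>Sorting turns the multiset of eigenvalues into a canonical enumeration, whose
  measurability can then be derived from that of the counting functions.\<close>

definition gram_eigenvalues :: "nat \<Rightarrow> real mat \<Rightarrow> real list" where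
  "gram_eigenvalues N A = sorted_list_of_multiset (proots (char_poly (square_covariance N A)))"

lemma square_covariance_gram:
  assumes "A \<in> carrier_mat N N"
  shows "square_covariance N A = (1 / (real N)\<^sup>2) \<cdot>\<^sub>m ((A ^\<^sub>m 2) * transpose_mat (A ^\<^sub>m 2))"
proof -
  have "transpose_mat (A ^\<^sub>m 2) = transpose_mat A ^\<^sub>m 2"
    using assms by (simp add: numeral_2_eq_2 transpose_mult[of _ N N _ N])
  then show ?thesis by (simp add: square_covariance_def)
qed

lemma gram_eigenvalues:
  assumes "A \<in> carrier_mat N N"
  shows "length (gram_eigenvalues N A) = N"
    and "sorted (gram_eigenvalues N A)"
    and "e \<in> set (gram_eigenvalues N A) \<Longrightarrow> e \<ge> 0"
    and "(\<Sum>i<N. (square_covariance N A ^\<^sub>m k) $$ (i, i)) = (\<Sum>i<N. (gram_eigenvalues N A ! i) ^ k)"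
    and "spectral_df N (square_covariance N A) x
           = 1 / real N * real (card {i. i < N \<and> gram_eigenvalues N A ! i \<le> x})"
proof -
  have A2: "A ^\<^sub>m 2 \<in> carrier_mat N N" using assms by simp
  obtain es where es: "length es = N" "\<And>e. e \<in> set es \<Longrightarrow> e \<ge> 0"
    "char_poly (square_covariance N A) = (\<Prod>e\<leftarrow>es. [:- e, 1:])"
    using gram_char_poly[OF A2, of "1 / (real N)\<^sup>2"] unfolding square_covariance_gram[OF assms] by auto
  have W: "square_covariance N A \<in> carrier_mat N N"
    unfolding square_covariance_gram[OF assms] using A2 by auto
  have g: "gram_eigenvalues N A = sort es"
    by (simp add: gram_eigenvalues_def es(3) proots_linear_factors)
  show "length (gram_eigenvalues N A) = N" "sorted (gram_eigenvalues N A)"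
    "e \<in> set (gram_eigenvalues N A) \<Longrightarrow> e \<ge> 0"
    using es by (auto simp: g)
  have "(\<Sum>i<N. (square_covariance N A ^\<^sub>m k) $$ (i, i)) = (\<Sum>e\<leftarrow>es. e ^ k)"
    by (rule trace_pow_eigenvalues[OF W es(3)])
  also have "\<dots> = (\<Sum>e\<leftarrow>sort es. e ^ k)"
    by (metis mset_map mset_sort sum_mset_sum_list)
  also have "\<dots> = (\<Sum>i<N. (sort es ! i) ^ k)"
    by (simp add: sum_list_sum_nth es(1) atLeast0LessThan)
  finally show "(\<Sum>i<N. (square_covariance N A ^\<^sub>m k) $$ (i, i)) = (\<Sum>i<N. (gram_eigenvalues N A ! i) ^ k)"
    by (simp add: g)
  have "size {#l \<in># proots (char_poly (square_covariance N A)). l \<le> x#} = size {#l \<in># mset (sort es). l \<le> x#}"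
    by (simp add: es(3) proots_linear_factors)
  also have "\<dots> = length (filter (\<lambda>l. l \<le> x) (sort es))"
    by (metis mset_filter size_mset)
  also have "\<dots> = card {i. i < N \<and> sort es ! i \<le> x}"
    by (simp add: length_filter_conv_card es(1))
  finally show "spectral_df N (square_covariance N A) x
           = 1 / real N * real (card {i. i < N \<and> gram_eigenvalues N A ! i \<le> x})"
    by (simp add: spectral_df_def g)
qed

section \<open>Mixed moments of elliptic matrices\<close>

context prob_space begin

text \<open>Both alternatives of \<open>gaussian_rv\<close> are covered: a constant with mean 0
  vanishes almost surely, so that \<open>s = 0\<close>, and the formula holds with
  \<open>0 ^ 0 = 1\<close>.\<close>

lemma centered_gaussian_moments:
  assumes W: "gaussian_rv M W" and mean: "expectation W = 0" and var: "expectation (\<lambda>\<omega>. (W \<omega>)\<^sup>2) = s"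
  shows "integrable M (\<lambda>\<omega>. W \<omega> ^ n)"
    and "expectation (\<lambda>\<omega>. W \<omega> ^ (2 * k)) = fact (2 * k) / (2 ^ k * fact k) * s ^ k"
    and "expectation (\<lambda>\<omega>. W \<omega> ^ (2 * k + 1)) = 0"
proof -
  have meas [measurable]: "W \<in> borel_measurable M"
    using W by (simp add: gaussian_rv_def)
  consider m \<sigma> where "\<sigma> > 0" "distributed M lborel W (normal_density m \<sigma>)"
    | m where "AE \<omega> in M. W \<omega> = m"
    using W by (auto simp: gaussian_rv_def)
  then have "integrable M (\<lambda>\<omega>. W \<omega> ^ n) \<and>
     expectation (\<lambda>\<omega>. W \<omega> ^ (2 * k)) = fact (2 * k) / (2 ^ k * fact k) * s ^ k \<and>
     expectation (\<lambda>\<omega>. W \<omega> ^ (2 * k + 1)) = 0"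
  proof cases
    case 1
    have nn: "0 \<le> normal_density m \<sigma> x" for x by simp
    have "expectation W = (\<integral>x. normal_density m \<sigma> x * x \<partial>lborel)"
      using distributed_integral[OF 1(2), of "\<lambda>x. x"] by simp
    then have m0: "m = 0"
      using mean integral_normal_moment_nz_1[OF 1(1), of m] by simp
    note d = 1(2)[unfolded m0]
    have int: "(\<integral>x. normal_density 0 \<sigma> x * x ^ j \<partial>lborel) = expectation (\<lambda>\<omega>. W \<omega> ^ j)" for j
      by (rule distributed_integral[OF d]) simp_all
    have integ: "integrable M (\<lambda>\<omega>. W \<omega> ^ j)" for j
      using distributed_integrable[OF d, of "\<lambda>x. x ^ j"] integrable_normal_moment[OF 1(1), of 0 j] by simp
    have even: "expectation (\<lambda>\<omega>. W \<omega> ^ (2 * j)) = fact (2 * j) / ((2 / \<sigma>\<^sup>2) ^ j * fact j)" for j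
      using integral_normal_moment_even[OF 1(1), of 0 j] by (simp only: int diff_0_right)
    have "s = \<sigma>\<^sup>2"
      using even[of 1] var 1(1) by (simp add: fact_numeral)
    then have "expectation (\<lambda>\<omega>. W \<omega> ^ (2 * k)) = fact (2 * k) / (2 ^ k * fact k) * s ^ k"
      using even[of k] 1(1) by (simp add: power_divide field_simps)
    moreover have "expectation (\<lambda>\<omega>. W \<omega> ^ (2 * k + 1)) = 0"
      using integral_normal_moment_odd[OF 1(1), of 0 k] by (simp only: int diff_0_right)
    ultimately show ?thesis using integ by blast
  next
    case 2
    have "expectation W = expectation (\<lambda>\<omega>. m)"
      using 2 by (intro integral_cong_AE) auto
    then have m0: "m = 0" using mean by (simp add: prob_space)
    have pow: "AE \<omega> in M. W \<omega> ^ j = (if j = 0 then 1 else 0)" for j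
      using 2 by eventually_elim (simp add: m0)
    have e: "expectation (\<lambda>\<omega>. W \<omega> ^ j) = (if j = 0 then 1 else 0)" for j
    proof -
      have "expectation (\<lambda>\<omega>. W \<omega> ^ j) = expectation (\<lambda>\<omega>. if j = 0 then 1 else 0)"
        using pow[of j] by (intro integral_cong_AE) auto
      then show ?thesis by (simp add: prob_space)
    qed
    have "integrable M (\<lambda>\<omega>. W \<omega> ^ j)" for j
      using pow[of j] by (subst integrable_cong_AE[where g = "\<lambda>\<omega>. if j = 0 then 1 else 0"]) auto
    moreover have "s = 0" using e[of 2] var by simp
    ultimately show ?thesis unfolding e by (cases k) auto
  qed
  then show "integrable M (\<lambda>\<omega>. W \<omega> ^ n)"
    "expectation (\<lambda>\<omega>. W \<omega> ^ (2 * k)) = fact (2 * k) / (2 ^ k * fact k) * s ^ k"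
    "expectation (\<lambda>\<omega>. W \<omega> ^ (2 * k + 1)) = 0" by auto
qed

text \<open>The quotient is the double factorial of \<open>2 * k - 1\<close>, the number of pairings
  of \<open>2 * k\<close> points.\<close>

lemma square_power_fact_rec:
  "fact (2 * Suc k) / (2 ^ Suc k * fact (Suc k)) = real (2 * k + 1) * (fact (2 * k) / (2 ^ k * fact k))"
proof -
  have "fact (2 * Suc k) = (2 * (real k + 1)) * (real (2 * k + 1) * fact (2 * k))"
    by (simp add: algebra_simps)
  then show ?thesis by (simp add: field_simps del: fact_Suc) (simp add: algebra_simps)
qed

text \<open>Integration by parts for a Gaussian pair, obtained without a joint density from the
  moments of the linear combinations \<open>t * Y + Z\<close>, which are known for all
  \<open>t\<close>: differentiate them with respect to \<open>t\<close> and compare coefficients.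
  Where \<open>p - 1\<close> or \<open>q - 1\<close> is truncated, the factor in front is 0.\<close>

lemma gaussian_pair_moments:
  assumes G: "gaussian_vector2 M (\<lambda>\<omega>. (Y \<omega>, Z \<omega>))"
    and mean: "expectation Y = 0" "expectation Z = 0"
    and var: "expectation (\<lambda>\<omega>. (Y \<omega>)\<^sup>2) = 1" "expectation (\<lambda>\<omega>. (Z \<omega>)\<^sup>2) = 1"
    and cov: "expectation (\<lambda>\<omega>. Y \<omega> * Z \<omega>) = \<rho>"
  shows "integrable M (\<lambda>\<omega>. Y \<omega> ^ p * Z \<omega> ^ q)"
    and "expectation (\<lambda>\<omega>. Y \<omega> ^ Suc p * Z \<omega> ^ q)
      = real p * expectation (\<lambda>\<omega>. Y \<omega> ^ (p - 1) * Z \<omega> ^ q) + \<rho> * real q * expectation (\<lambda>\<omega>. Y \<omega> ^ p * Z \<omega> ^ (q - 1))"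
proof -
  have lin: "gaussian_rv M (\<lambda>\<omega>. a * Y \<omega> + b * Z \<omega>)" for a b
    using G by (simp add: gaussian_vector2_def)
  have gY: "gaussian_rv M Y" and gZ: "gaussian_rv M Z"
    using lin[of 1 0] lin[of 0 1] by simp_all
  have [measurable]: "Y \<in> borel_measurable M" "Z \<in> borel_measurable M"
    using gY gZ by (auto simp: gaussian_rv_def)
  have intY: "integrable M (\<lambda>\<omega>. Y \<omega> ^ n)" and intZ: "integrable M (\<lambda>\<omega>. Z \<omega> ^ n)" for n
    using centered_gaussian_moments(1)[OF gY mean(1) var(1)] centered_gaussian_moments(1)[OF gZ mean(2) var(2)] by auto
  have int: "integrable M (\<lambda>\<omega>. Y \<omega> ^ p * Z \<omega> ^ q)" for p q
  proof (rule Bochner_Integration.integrable_bound)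
    show "integrable M (\<lambda>\<omega>. Y \<omega> ^ (2 * p) + Z \<omega> ^ (2 * q))"
      by (intro Bochner_Integration.integrable_add intY intZ)
    have "\<bar>x * y\<bar> \<le> x\<^sup>2 + y\<^sup>2" for x y :: real
    proof -
      have "2 * \<bar>x\<bar> * \<bar>y\<bar> \<le> x\<^sup>2 + y\<^sup>2" "0 \<le> \<bar>x\<bar> * \<bar>y\<bar>"
        using sum_squares_bound[of "\<bar>x\<bar>" "\<bar>y\<bar>"] by simp_all
      then show ?thesis unfolding abs_mult by linarith
    qed
    from this[of "Y _ ^ p" "Z _ ^ q"]
    show "AE \<omega> in M. norm (Y \<omega> ^ p * Z \<omega> ^ q) \<le> norm (Y \<omega> ^ (2 * p) + Z \<omega> ^ (2 * q))"
      by (intro AE_I2) (simp add: power_mult mult.commute[of 2] order.trans[OF _ abs_ge_self])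
  qed simp
  then show "integrable M (\<lambda>\<omega>. Y \<omega> ^ p * Z \<omega> ^ q)" .
  define m where "m = (\<lambda>p q. expectation (\<lambda>\<omega>. Y \<omega> ^ p * Z \<omega> ^ q))"
  \<comment> \<open>\<open>P n\<close> is the polynomial in \<open>t\<close> whose value is the
    moment of order \<open>n\<close> of \<open>t * Y + Z\<close>; up to binomial coefficients its
    coefficients are the mixed moments of total degree \<open>n\<close>.\<close>
  define P where "P = (\<lambda>n. \<Sum>p\<le>n. monom (real (n choose p) * m p (n - p)) p)"
  have poly_P: "poly (P n) t = expectation (\<lambda>\<omega>. (t * Y \<omega> + Z \<omega>) ^ n)" for n t
  proof -
    have "expectation (\<lambda>\<omega>. (t * Y \<omega> + Z \<omega>) ^ n)
      = expectation (\<lambda>\<omega>. \<Sum>p\<le>n. real (n choose p) * t ^ p * (Y \<omega> ^ p * Z \<omega> ^ (n - p)))"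
      by (simp add: binomial_ring power_mult_distrib mult_ac)
    also have "\<dots> = (\<Sum>p\<le>n. real (n choose p) * t ^ p * m p (n - p))"
      unfolding m_def by (subst Bochner_Integration.integral_sum) (auto intro: int)
    finally show ?thesis by (simp add: P_def poly_sum poly_monom mult_ac)
  qed
  have coeff_P: "coeff (P n) p = (if p \<le> n then real (n choose p) * m p (n - p) else 0)" for n p
  proof -
    have "coeff (P n) p = (\<Sum>i\<le>n. if i = p then real (n choose p) * m p (n - p) else 0)"
      unfolding P_def coeff_sum by (intro sum.cong) auto
    then show ?thesis by simp
  qed
  let ?q = "[:1, 2 * \<rho>, 1:] :: real poly"
  have quad: "expectation (\<lambda>\<omega>. t * Y \<omega> + Z \<omega>) = 0" "expectation (\<lambda>\<omega>. (t * Y \<omega> + Z \<omega>)\<^sup>2) = poly ?q t" for t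
  proof -
    show "expectation (\<lambda>\<omega>. t * Y \<omega> + Z \<omega>) = 0"
      using intY[of 1] intZ[of 1] by (simp add: mean)
    have "expectation (\<lambda>\<omega>. (t * Y \<omega> + Z \<omega>)\<^sup>2)
      = expectation (\<lambda>\<omega>. t\<^sup>2 * (Y \<omega>)\<^sup>2 + (2 * t * (Y \<omega> * Z \<omega>) + (Z \<omega>)\<^sup>2))"
      by (simp add: power2_eq_square algebra_simps)
    also have "\<dots> = t\<^sup>2 * 1 + (2 * t * \<rho> + 1)"
      using intY[of 2] intZ[of 2] int[of 1 1] by (simp add: var cov)
    finally show "expectation (\<lambda>\<omega>. (t * Y \<omega> + Z \<omega>)\<^sup>2) = poly ?q t"
      by (simp add: power2_eq_square algebra_simps)
  qed
  have gt: "gaussian_rv M (\<lambda>\<omega>. t * Y \<omega> + Z \<omega>)" for t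
    using lin[of t 1] by simp
  have P_even: "P (2 * k) = Polynomial.smult (fact (2 * k) / (2 ^ k * fact k)) (?q ^ k)" for k
    by (rule poly_eq_poly_eq_iff[THEN iffD1], rule ext)
       (simp only: poly_P centered_gaussian_moments(2)[OF gt quad] poly_smult poly_power)
  have P_odd: "P (2 * k + 1) = 0" for k
    by (rule poly_eq_poly_eq_iff[THEN iffD1], rule ext)
       (simp only: poly_P centered_gaussian_moments(3)[OF gt quad] poly_0)
  \<comment> \<open>\<open>P (2 * k)\<close> is a multiple of \<open>?q ^ k\<close>, where
    \<open>?q\<close> is the variance of \<open>t * Y + Z\<close>, and the derivative of
    \<open>?q\<close> is \<open>2 * (t + \<rho>)\<close>. The numerical factor is the recursion of
    the double factorials. For odd \<open>n\<close> both sides vanish.\<close>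
  have deriv_P: "pderiv (P (n + 2)) = Polynomial.smult (real (n + 2) * real (n + 1)) ([:\<rho>, 1:] * P n)" for n
  proof (cases "even n")
    case True
    then obtain k where k: "n = 2 * k" by (elim evenE)
    have "n + 2 = 2 * Suc k" by (simp add: k)
    then have "pderiv (P (n + 2)) = Polynomial.smult (fact (2 * Suc k) / (2 ^ Suc k * fact (Suc k)))
        (Polynomial.smult (real (Suc k)) (?q ^ k * pderiv ?q))"
      unfolding P_even by (simp only: P_even pderiv_smult pderiv_power_Suc of_nat_Suc mult_smult_left)
    also have "pderiv ?q = Polynomial.smult 2 [:\<rho>, 1:]"
      by (simp add: pderiv_pCons)
    finally show ?thesis
      unfolding square_power_fact_rec k P_even
      by (simp only: mult_smult_right mult_smult_left smult_smult mult.commute[of "[:\<rho>, 1:]"])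
         (simp add: field_simps)
  next
    case False
    then obtain k where "n = 2 * k + 1" by (elim oddE)
    then show ?thesis using P_odd[of k] P_odd[of "k + 1"] by (simp add: numeral_eq_Suc)
  qed
  have "m (Suc p) q = real p * m (p - 1) q + \<rho> * real q * m p (q - 1)"
  proof (cases "p + q = 0")
    case True
    then show ?thesis by (simp add: m_def mean)
  next
    case False
    then obtain n where n: "p + q = n + 1" by (cases "p + q") auto
    have "coeff (pderiv (P (n + 2))) p = real (Suc p) * (real ((n + 2) choose (Suc p)) * m (Suc p) q)"
    proof -
      have "Suc p \<le> n + 2" "n + 2 - Suc p = q" using n by auto
      then show ?thesis by (simp only: coeff_pderiv coeff_P if_True)
    qed
    also have "real (Suc p) * (real ((n + 2) choose (Suc p)) * m (Suc p) q) = real (n + 2) * (real ((n + 1) choose p) * m (Suc p) q)"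
    proof -
      have "Suc p * ((n + 2) choose (Suc p)) = (n + 2) * ((n + 1) choose p)"
        by (simp only: binomial_absorption) simp
      from arg_cong[OF this, of real] show ?thesis by (simp only: of_nat_mult mult.assoc[symmetric])
    qed
    finally have 1: "real (n + 2) * (real ((n + 1) choose p) * m (Suc p) q)
        = real (n + 2) * real (n + 1) * coeff ([:\<rho>, 1:] * P n) p"
      unfolding deriv_P by simp
    \<comment> \<open>Absorption rewrites the binomials over \<open>n\<close> as binomials over
      \<open>n + 1\<close>, and this is what produces the factors \<open>q\<close> and
      \<open>p\<close>.\<close>
    have c: "real (n + 1) * coeff ([:\<rho>, 1:] * P n) p
        = real ((n + 1) choose p) * (\<rho> * real q * m p (q - 1) + real p * m (p - 1) q)"
    proof -
      have "real (n + 1) * (if p \<le> n then real (n choose p) * m p (n - p) else 0)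
          = real ((n + 1) choose p) * (real q * m p (q - 1))"
      proof (cases "p \<le> n")
        case True
        have "q * ((n + 1) choose p) = (n + 1) * (n choose p)"
        proof -
          have "n + 1 - p = q" using n by simp
          with binomial_absorb_comp[of "n + 1" p] show ?thesis by (simp only: add_diff_cancel_right')
        qed
        from arg_cong[OF this, of real] have "real q * real ((n + 1) choose p) = real (n + 1) * real (n choose p)"
          by (simp only: of_nat_mult)
        moreover have "q - 1 = n - p" using n True by simp
        ultimately show ?thesis using True by (simp add: mult_ac)
      next
        case False
        then have "q = 0" using n by simp
        then show ?thesis using False by simp
      qed
      moreover have "real (n + 1) * (if p = 0 then 0 else coeff (P n) (p - 1))
          = real ((n + 1) choose p) * (real p * m (p - 1) q)"
      proof (cases p)
        case (Suc p')
        have "Suc p' * ((n + 1) choose Suc p') = (n + 1) * (n choose p')"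
          by (simp only: binomial_absorption) simp
        from arg_cong[OF this, of real] have "real p * real ((n + 1) choose p) = real (n + 1) * real (n choose p')"
          by (simp only: of_nat_mult Suc)
        moreover have "p' \<le> n" "n - p' = q" using n Suc by auto
        ultimately show ?thesis by (simp add: Suc coeff_P mult_ac)
      qed simp
      moreover have "coeff ([:\<rho>, 1:] * P n) p = \<rho> * coeff (P n) p + (if p = 0 then 0 else coeff (P n) (p - 1))"
        by (cases p) (simp_all add: mult_pCons_left)
      ultimately show ?thesis
        unfolding coeff_P[of n p] by (simp add: algebra_simps)
    qed
    have "real ((n + 1) choose p) * m (Suc p) q
        = real ((n + 1) choose p) * (\<rho> * real q * m p (q - 1) + real p * m (p - 1) q)"
    proof -
      have nz: "real (n + 2) \<noteq> 0" by simp
      from 1 have "real ((n + 1) choose p) * m (Suc p) q = real (n + 1) * coeff ([:\<rho>, 1:] * P n) p"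
        unfolding mult.assoc by (rule mult_left_cancel[OF nz, THEN iffD1])
      then show ?thesis by (simp only: c)
    qed
    moreover have "real ((n + 1) choose p) \<noteq> 0" using n by simp
    ultimately show ?thesis by (simp add: add.commute)
  qed
  then show "expectation (\<lambda>\<omega>. Y \<omega> ^ Suc p * Z \<omega> ^ q)
      = real p * expectation (\<lambda>\<omega>. Y \<omega> ^ (p - 1) * Z \<omega> ^ q) + \<rho> * real q * expectation (\<lambda>\<omega>. Y \<omega> ^ p * Z \<omega> ^ (q - 1))"
    by (simp only: m_def)
qed

end

text \<open>The version for diagonal entries: such an entry forms a vector with itself, so that only
  one variable is involved and \<rho> does not occur.\<close>

lemma (in prob_space) standard_gaussian_moment_rec:
  assumes W: "gaussian_rv M W" and mean: "expectation W = 0" and var: "expectation (\<lambda>\<omega>. (W \<omega>)\<^sup>2) = 1"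
  shows "expectation (\<lambda>\<omega>. W \<omega> ^ Suc n) = real n * expectation (\<lambda>\<omega>. W \<omega> ^ (n - 1))"
proof (cases "even n")
  case True
  then obtain k where k: "n = 2 * k" by (elim evenE)
  have odd: "expectation (\<lambda>\<omega>. W \<omega> ^ (2 * j + 1)) = 0" for j
    by (rule centered_gaussian_moments(3)[OF W mean var])
  show ?thesis
  proof (cases k)
    case 0
    then show ?thesis using odd[of 0] by (simp add: k)
  next
    case (Suc j)
    then have "n - 1 = 2 * j + 1" "Suc n = 2 * k + 1" by (auto simp: k)
    then show ?thesis by (simp only: odd mult_zero_right)
  qed
next
  case False
  then obtain k where k: "n = 2 * k + 1" by (elim oddE)
  have "Suc n = 2 * Suc k" "n - 1 = 2 * k" by (auto simp: k)
  then show ?thesis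
    by (simp only: centered_gaussian_moments(2)[OF W mean var] square_power_fact_rec power_one k mult_1_right)
qed

text \<open>Only copies of \<open>e\<close> and of its transpose contribute. On the diagonal these
  coincide, and the correction \<open>-\<rho>\<close> cancels the second contribution.\<close>

lemma sum_mset_cov:
  "(\<Sum>e'\<in>#B. cov 1 \<rho> (-\<rho>) e e' * f e')
     = real (count B e) * f e + (if fst e = snd e then 0 else \<rho> * real (count B (prod.swap e)) * f (prod.swap e))"
proof (induction B)
  case (add x B)
  have "cov 1 \<rho> (-\<rho>) e x * f x = (if x = e then f e else 0)
      + (if fst e = snd e then 0 else if x = prod.swap e then \<rho> * f (prod.swap e) else 0)"
  proof (cases "x = e")
    case True
    then show ?thesis using swap_eq_iff[of e e] by (simp add: cov_def eq_commute[of "prod.swap e"])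
  next
    case False
    then show ?thesis using swap_eq_iff[of e e] by (auto simp: cov_def)
  qed
  then show ?case
    using add by (simp add: algebra_simps)
qed simp

section \<open>Factorization of mixed moments over the independent pairs\<close>

definition entry_moment :: "'a measure \<Rightarrow> ('a \<Rightarrow> real mat) \<Rightarrow> (nat \<times> nat) multiset \<Rightarrow> real" where
  "entry_moment M X A = (\<integral>\<omega>. (\<Prod>e\<in>#A. X \<omega> $$ e) \<partial>M)"

context
  fixes M :: "'a measure" and \<rho> :: real and N :: nat and X :: "'a \<Rightarrow> real mat"
  assumes elliptic: "elliptic_matrix M \<rho> N X"
begin

interpretation prob_space M
  using elliptic by (simp add: elliptic_matrix_def)

lemma elliptic_gaussian:
  "i < N \<Longrightarrow> j < N \<Longrightarrow> gaussian_vector2 M (\<lambda>\<omega>. (X \<omega> $$ (i, j), X \<omega> $$ (j, i)))"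
  "i < N \<Longrightarrow> j < N \<Longrightarrow> expectation (\<lambda>\<omega>. X \<omega> $$ (i, j)) = 0"
  "i < N \<Longrightarrow> j < N \<Longrightarrow> expectation (\<lambda>\<omega>. (X \<omega> $$ (i, j))\<^sup>2) = 1"
  "i < N \<Longrightarrow> j < N \<Longrightarrow> i \<noteq> j \<Longrightarrow> expectation (\<lambda>\<omega>. X \<omega> $$ (i, j) * X \<omega> $$ (j, i)) = \<rho>"
  using elliptic unfolding elliptic_matrix_def by blast+

lemma elliptic_entry_gaussian:
  assumes "i < N" "j < N"
  shows "gaussian_rv M (\<lambda>\<omega>. X \<omega> $$ (i, j))"
proof -
  have "gaussian_rv M (\<lambda>\<omega>. 1 * fst (X \<omega> $$ (i, j), X \<omega> $$ (j, i)) + 0 * snd (X \<omega> $$ (i, j), X \<omega> $$ (j, i)))"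
    using elliptic_gaussian(1)[OF assms] unfolding gaussian_vector2_def by blast
  then show ?thesis by simp
qed

text \<open>The part of the monomial that depends on the vector at \<open>e\<close>. On the diagonal
  both components are the same entry, which must be counted once.\<close>

definition pair_factor :: "nat \<times> nat \<Rightarrow> (nat \<times> nat) multiset \<Rightarrow> 'a \<Rightarrow> real" where
  "pair_factor e A \<omega> = X \<omega> $$ e ^ count A e
     * (if fst e = snd e then 1 else X \<omega> $$ prod.swap e ^ count A (prod.swap e))"

lemma pair_factor_swap: "pair_factor (prod.swap e) A = pair_factor e A"
proof (rule ext)
  fix \<omega>
  show "pair_factor (prod.swap e) A \<omega> = pair_factor e A \<omega>"
    using swap_eq_iff[of e e] by (cases "fst e = snd e") (auto simp: pair_factor_def)
qed

lemma pair_factor_integrable: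
  assumes "i < N" "j < N"
  shows "integrable M (pair_factor (i, j) A)"
proof (cases "i = j")
  case True
  then show ?thesis
    using centered_gaussian_moments(1)[OF elliptic_entry_gaussian elliptic_gaussian(2,3), of i j] assms
    by (simp add: pair_factor_def[abs_def])
next
  case False
  from gaussian_pair_moments(1)[OF elliptic_gaussian(1,2) elliptic_gaussian(2,3,3) elliptic_gaussian(4)[OF _ _ False]] assms
  show ?thesis
    using False by (simp add: pair_factor_def[abs_def])
qed

lemma pair_factor_rec:
  assumes "i < N" "j < N"
  defines "e \<equiv> (i, j)"
  shows "expectation (pair_factor e (add_mset e A))
    = real (count A e) * expectation (pair_factor e (A - {#e#}))
      + (if i = j then 0 else \<rho> * real (count A (prod.swap e)) * expectation (pair_factor e (A - {#prod.swap e#})))"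
proof (cases "i = j")
  case True
  then show ?thesis
    using standard_gaussian_moment_rec[OF elliptic_entry_gaussian elliptic_gaussian(2,3), of i j] assms
    by (simp add: pair_factor_def[abs_def])
next
  case False
  from gaussian_pair_moments(2)[OF elliptic_gaussian(1,2) elliptic_gaussian(2,3,3) elliptic_gaussian(4)[OF _ _ False]] assms
  show ?thesis
    using False by (simp add: pair_factor_def[abs_def])
qed

definition pairs :: "(nat \<times> nat) set" where
  "pairs = {(i, j). i \<le> j \<and> j < N}"

lemma finite_pairs: "finite pairs"
  by (rule finite_subset[of _ "{..<N} \<times> {..<N}"]) (auto simp: pairs_def)

text \<open>Singles out, among the independent vectors, the one that contains the entry at
  \<open>e\<close>; the factors of all others are unaffected when \<open>e\<close> or its transpose
  is added to a multiset or removed from it.\<close>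

lemma pairs_representative:
  assumes "e \<in> {..<N} \<times> {..<N}"
  shows "\<exists>p\<in>pairs. (\<forall>A. pair_factor p A = pair_factor e A) \<and>
    (\<forall>q\<in>pairs. q \<noteq> p \<longrightarrow> q \<noteq> e \<and> prod.swap q \<noteq> e \<and> q \<noteq> prod.swap e \<and> prod.swap q \<noteq> prod.swap e)"
proof -
  obtain a b where e: "e = (a, b)" "a < N" "b < N" using assms by auto
  show ?thesis
  proof (cases "a \<le> b")
    case True
    then show ?thesis
      by (intro bexI[of _ e]) (use e in \<open>auto simp: pairs_def\<close>)
  next
    case False
    then show ?thesis
      by (intro bexI[of _ "prod.swap e"]) (use e pair_factor_swap[of e] in \<open>auto simp: pairs_def\<close>)
  qed
qed

lemma pair_factor_cong:
  "count A e = count B e \<Longrightarrow> count A (prod.swap e) = count B (prod.swap e) \<Longrightarrow> pair_factor e A = pair_factor e B"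
  by (simp add: pair_factor_def fun_eq_iff)

lemma prod_entries_eq:
  "A \<in> entries N \<Longrightarrow> (\<Prod>e\<in>#A. X \<omega> $$ e) = (\<Prod>p\<in>pairs. pair_factor p A \<omega>)"
proof (induction A)
  case empty
  show ?case by (auto simp: pair_factor_def intro!: prod.neutral)
next
  case (add e A)
  then have e: "e \<in> {..<N} \<times> {..<N}" and A: "A \<in> entries N" by (auto simp: entries_def)
  from e obtain p where p: "p \<in> pairs" "\<And>A. pair_factor p A = pair_factor e A"
    "\<And>q. q \<in> pairs \<Longrightarrow> q \<noteq> p \<Longrightarrow> q \<noteq> e \<and> prod.swap q \<noteq> e \<and> q \<noteq> prod.swap e \<and> prod.swap q \<noteq> prod.swap e"
    using pairs_representative by blast
  have "(\<Prod>q\<in>pairs. pair_factor q (add_mset e A) \<omega>)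
    = pair_factor e (add_mset e A) \<omega> * (\<Prod>q\<in>pairs - {p}. pair_factor q (add_mset e A) \<omega>)"
    by (simp add: prod.remove[OF finite_pairs p(1)] p(2))
  also have "(\<Prod>q\<in>pairs - {p}. pair_factor q (add_mset e A) \<omega>) = (\<Prod>q\<in>pairs - {p}. pair_factor q A \<omega>)"
    by (rule prod.cong[OF refl], rule fun_cong[OF pair_factor_cong]) (use p(3) in auto)
  also have "pair_factor e (add_mset e A) \<omega> = X \<omega> $$ e * pair_factor e A \<omega>"
  proof (cases "fst e = snd e")
    case False
    then have "e \<noteq> prod.swap e" using swap_eq_iff[of e e] by metis
    with False show ?thesis by (simp add: pair_factor_def)
  qed (simp add: pair_factor_def)
  finally show ?case
    using add.IH[OF A] by (simp add: prod.remove[OF finite_pairs p(1), of "\<lambda>q. pair_factor q A \<omega>"] p(2) mult.assoc)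
qed

lemma pair_factor_indep: "indep_vars (\<lambda>_. borel) (\<lambda>p. pair_factor p A) pairs"
proof -
  have ind: "indep_vars (\<lambda>_. borel \<Otimes>\<^sub>M borel) (\<lambda>(i, j) \<omega>. (X \<omega> $$ (i, j), X \<omega> $$ (j, i))) pairs"
    using elliptic unfolding elliptic_matrix_def pairs_def by blast
  have "indep_vars (\<lambda>_. borel) (\<lambda>p \<omega>. (\<lambda>(x, y). x ^ count A p * (if fst p = snd p then 1 else y ^ count A (prod.swap p)))
      ((case p of (i, j) \<Rightarrow> \<lambda>\<omega>. (X \<omega> $$ (i, j), X \<omega> $$ (j, i))) \<omega>)) pairs"
    by (rule indep_vars_compose2[OF ind]) measurable
  then show ?thesis
    by (rule indep_vars_cong[THEN iffD1, rotated -1]) (auto simp: pair_factor_def fun_eq_iff)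
qed

lemma entry_moment_prod:
  assumes "A \<in> entries N"
  shows "integrable M (\<lambda>\<omega>. \<Prod>e\<in>#A. X \<omega> $$ e)"
    and "entry_moment M X A = (\<Prod>p\<in>pairs. expectation (pair_factor p A))"
proof -
  have int: "p \<in> pairs \<Longrightarrow> integrable M (pair_factor p A)" for p
    using pair_factor_integrable by (auto simp: pairs_def)
  show "integrable M (\<lambda>\<omega>. \<Prod>e\<in>#A. X \<omega> $$ e)"
    unfolding prod_entries_eq[OF assms] by (rule indep_vars_integrable[OF finite_pairs pair_factor_indep int])
  show "entry_moment M X A = (\<Prod>p\<in>pairs. expectation (pair_factor p A))"
    unfolding entry_moment_def prod_entries_eq[OF assms]
    by (rule indep_vars_lebesgue_integral[OF finite_pairs pair_factor_indep int])
qed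

text \<open>By independence the moment is a product over pairs, of which only the factor containing
  \<open>e\<close> changes on either side of the recursion. What remains is the recursion for a
  single Gaussian vector.\<close>

lemma wick_entry_moment: "wick \<rho> N (entry_moment M X)"
  unfolding wick_def
proof (intro conjI ballI)
  show "entry_moment M X {#} = 1" by (simp add: entry_moment_def prob_space)
  fix e A assume e: "e \<in> {..<N} \<times> {..<N}" and A: "A \<in> entries N"
  from e obtain p where p: "p \<in> pairs" "\<And>A. pair_factor p A = pair_factor e A"
    "\<And>q. q \<in> pairs \<Longrightarrow> q \<noteq> p \<Longrightarrow> q \<noteq> e \<and> prod.swap q \<noteq> e \<and> q \<noteq> prod.swap e \<and> prod.swap q \<noteq> prod.swap e"
    using pairs_representative by blast
  define R where "R = (\<Prod>q\<in>pairs - {p}. expectation (pair_factor q A))"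
  have split: "entry_moment M X B = expectation (pair_factor e B) * R"
    if "B \<in> entries N" "\<And>q. q \<noteq> e \<Longrightarrow> q \<noteq> prod.swap e \<Longrightarrow> count B q = count A q" for B
  proof -
    have "pair_factor q B = pair_factor q A" if "q \<in> pairs - {p}" for q
      using p(3)[of q] that \<open>\<And>q. q \<noteq> e \<Longrightarrow> q \<noteq> prod.swap e \<Longrightarrow> count B q = count A q\<close>
      by (intro pair_factor_cong) auto
    then show ?thesis
      unfolding entry_moment_prod(2)[OF that(1)] R_def
      by (subst prod.remove[OF finite_pairs p(1)]) (simp add: p(2))
  qed
  have sp1: "entry_moment M X (add_mset e A) = expectation (pair_factor e (add_mset e A)) * R"
    using e A by (intro split) (auto simp: entries_def)
  have sp2: "entry_moment M X (A - {#e#}) = expectation (pair_factor e (A - {#e#})) * R"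
    using A by (intro split) (auto simp: entries_diff)
  have sp3: "entry_moment M X (A - {#prod.swap e#}) = expectation (pair_factor e (A - {#prod.swap e#})) * R"
    using A by (intro split) (auto simp: entries_diff)
  obtain i j where ij: "e = (i, j)" "i < N" "j < N" using e by auto
  show "entry_moment M X (add_mset e A)
      = (\<Sum>e'\<in>#A. cov 1 \<rho> (-\<rho>) e e' * entry_moment M X (A - {#e'#}))"
    unfolding sum_mset_cov[where f = "\<lambda>e'. entry_moment M X (A - {#e'#})"] sp1 sp2 sp3
    using pair_factor_rec[OF ij(2,3), of A] unfolding ij(1)[symmetric]
    by (cases "i = j") (simp_all add: ij(1) distrib_right mult.assoc)
qed

end

section \<open>Traces of matrix powers as walk sums\<close>

lemma integral_sum_lessThan:
  fixes f :: "nat \<Rightarrow> 'a \<Rightarrow> real"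
  assumes "\<And>c. c < N \<Longrightarrow> integrable M (f c) \<and> (\<integral>\<omega>. f c \<omega> \<partial>M) = g c"
  shows "integrable M (\<lambda>\<omega>. \<Sum>c<N. f c \<omega>) \<and> (\<integral>\<omega>. (\<Sum>c<N. f c \<omega>) \<partial>M) = (\<Sum>c<N. g c)"
proof
  have i: "c \<in> {..<N} \<Longrightarrow> integrable M (f c)" for c using assms by simp
  show "integrable M (\<lambda>\<omega>. \<Sum>c<N. f c \<omega>)"
    by (rule Bochner_Integration.integrable_sum[OF i])
  have "(\<integral>\<omega>. (\<Sum>c<N. f c \<omega>) \<partial>M) = (\<Sum>c<N. \<integral>\<omega>. f c \<omega> \<partial>M)"
    by (rule Bochner_Integration.integral_sum[OF i])
  also have "\<dots> = (\<Sum>c<N. g c)"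
    by (rule sum.cong[OF refl]) (use assms in simp)
  finally show "(\<integral>\<omega>. (\<Sum>c<N. f c \<omega>) \<partial>M) = (\<Sum>c<N. g c)" .
qed

lemma walk_sum_integral:
  assumes "\<And>A. A \<in> entries N \<Longrightarrow> integrable M (h A)" "a < N"
  shows "integrable M (\<lambda>\<omega>. walk_sum N w a b (\<lambda>A. h A \<omega>))
    \<and> (\<integral>\<omega>. walk_sum N w a b (\<lambda>A. h A \<omega>) \<partial>M) = walk_sum N w a b (\<lambda>A. \<integral>\<omega>. h A \<omega> \<partial>M)"
  using assms
proof (induction w arbitrary: a h)
  case (Cons l w)
  have "integrable M (\<lambda>\<omega>. walk_sum N w c b (\<lambda>A. h (add_mset (edge l a c) A) \<omega>))
    \<and> (\<integral>\<omega>. walk_sum N w c b (\<lambda>A. h (add_mset (edge l a c) A) \<omega>) \<partial>M)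
      = walk_sum N w c b (\<lambda>A. \<integral>\<omega>. h (add_mset (edge l a c) A) \<omega> \<partial>M)" if "c < N" for c
    by (rule Cons.IH[of "\<lambda>A. h (add_mset (edge l a c) A)"]) (use Cons.prems that in auto)
  then show ?case
    unfolding walk_sum.simps by (rule integral_sum_lessThan)
qed auto

fun word_mat :: "nat \<Rightarrow> real mat \<Rightarrow> bool list \<Rightarrow> real mat" where
  "word_mat N A [] = 1\<^sub>m N"
| "word_mat N A (l # w) = (if l then A else transpose_mat A) * word_mat N A w"

lemma word_mat_carrier: "A \<in> carrier_mat N N \<Longrightarrow> word_mat N A w \<in> carrier_mat N N"
  by (induction w) auto

lemma word_mat_append:
  assumes "A \<in> carrier_mat N N"
  shows "word_mat N A (u @ v) = word_mat N A u * word_mat N A v"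
proof (induction u)
  case Nil
  show ?case
    by (simp only: append_Nil word_mat.simps left_mult_one_mat[OF word_mat_carrier[OF assms]])
next
  case (Cons l u)
  have "(if l then A else transpose_mat A) \<in> carrier_mat N N" using assms by simp
  from assoc_mult_mat[OF this word_mat_carrier[OF assms, of u] word_mat_carrier[OF assms, of v]]
  show ?case by (simp only: append_Cons word_mat.simps Cons)
qed

text \<open>Here \<open>F\<close> is the monomial evaluated at one fixed matrix; taking expectations
  afterwards replaces it by \<open>entry_moment\<close>.\<close>

lemma word_mat_entry:
  assumes A: "A \<in> carrier_mat N N"
  shows "a < N \<Longrightarrow> b < N \<Longrightarrow> word_mat N A w $$ (a, b) = walk_sum N w a b (\<lambda>S. \<Prod>e\<in>#S. A $$ e)"
proof (induction w arbitrary: a)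
  case (Cons l w)
  have "word_mat N A (l # w) $$ (a, b) = (\<Sum>c<N. (if l then A else transpose_mat A) $$ (a, c) * word_mat N A w $$ (c, b))"
    using A word_mat_carrier[OF A, of w] Cons.prems
    by (auto simp: scalar_prod_def atLeast0LessThan intro!: sum.cong)
  also have "\<dots> = (\<Sum>c<N. A $$ edge l a c * walk_sum N w c b (\<lambda>S. \<Prod>e\<in>#S. A $$ e))"
    using A Cons by (intro sum.cong) (auto simp: edge_def)
  also have "\<dots> = walk_sum N (l # w) a b (\<lambda>S. \<Prod>e\<in>#S. A $$ e)"
    by (simp add: walk_sum_mult[symmetric])
  finally show ?case .
qed (use A in auto)

lemma factor_period: "factor 0 (4 * Suc k) = factor 0 (4 * k) @ [True, True, False, False]"
proof -
  have "factor 0 (4 * Suc k) = factor 0 (4 * k) @ factor (4 * k) 4"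
    using append_take_drop_id[of "4 * k" "factor 0 (4 * Suc k)"]
    by (simp add: take_factor drop_factor)
  moreover have "factor (4 * k) 4 = [True, True, False, False]"
  proof (rule nth_equalityI)
    fix i assume "i < length (factor (4 * k) 4)"
    then have i: "i < 4" by simp
    then have "(4 * k + i) mod 4 = i" by simp
    moreover have "i = 0 \<or> i = 1 \<or> i = 2 \<or> i = 3" using i by linarith
    ultimately show "factor (4 * k) 4 ! i = [True, True, False, False] ! i"
      unfolding nth_factor[OF i] by (elim disjE) simp_all
  qed simp
  ultimately show ?thesis by simp
qed

lemma smult_mat_pow:
  fixes B :: "real mat"
  assumes "B \<in> carrier_mat N N"
  shows "(c \<cdot>\<^sub>m B) ^\<^sub>m k = c ^ k \<cdot>\<^sub>m B ^\<^sub>m k"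
proof (induction k)
  case 0
  then show ?case using assms by (auto intro!: eq_matI)
next
  case (Suc k)
  have Bk: "B ^\<^sub>m k \<in> carrier_mat N N" using assms by simp
  have "(c ^ k \<cdot>\<^sub>m B ^\<^sub>m k) * (c \<cdot>\<^sub>m B) = (c * c ^ k) \<cdot>\<^sub>m (B ^\<^sub>m k * B)"
  proof -
    have ss: "a \<cdot>\<^sub>m (b \<cdot>\<^sub>m C) = (a * b) \<cdot>\<^sub>m C" for a b and C :: "real mat"
      by (rule eq_matI) auto
    have cB: "c \<cdot>\<^sub>m B \<in> carrier_mat N N" using assms by simp
    show ?thesis
      by (simp only: mult_smult_assoc_mat[OF Bk cB] mult_smult_distrib[OF Bk assms] ss mult.commute)
  qed
  then show ?case by (simp add: Suc)
qed

lemma square_covariance_pow: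
  assumes A: "A \<in> carrier_mat N N"
  shows "square_covariance N A ^\<^sub>m k = (1 / (real N)\<^sup>2) ^ k \<cdot>\<^sub>m word_mat N A (factor 0 (4 * k))"
proof -
  let ?B = "(A ^\<^sub>m 2) * (transpose_mat A ^\<^sub>m 2)"
  have AT: "transpose_mat A \<in> carrier_mat N N" using A by simp
  have B: "?B \<in> carrier_mat N N"
    by (rule mult_carrier_mat[OF pow_carrier_mat[OF A] pow_carrier_mat[OF AT]])
  have "?B = word_mat N A [True, True, False, False]"
  proof -
    have sq: "C ^\<^sub>m 2 = C * C" if "C \<in> carrier_mat N N" for C :: "real mat"
      using that by (simp add: numeral_2_eq_2)
    have "A * (A * (transpose_mat A * (transpose_mat A * 1\<^sub>m N))) = A * (A * (transpose_mat A * transpose_mat A))"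
      by (simp only: right_mult_one_mat[OF AT])
    also have "\<dots> = (A * A) * (transpose_mat A * transpose_mat A)"
      by (rule assoc_mult_mat[OF A A mult_carrier_mat[OF AT AT], symmetric])
    finally show ?thesis by (simp only: sq[OF A] sq[OF AT] word_mat.simps if_True if_False)
  qed
  then have "?B ^\<^sub>m k = word_mat N A (factor 0 (4 * k))"
  proof (induction k)
    case 0
    then show ?case using A by simp
  next
    case (Suc k)
    then show ?case
      unfolding factor_period word_mat_append[OF A] by simp
  qed
  then show ?thesis
    unfolding square_covariance_def by (simp add: smult_mat_pow[OF B])
qed

lemma expected_spectral_moment:
  assumes elliptic: "elliptic_matrix M \<rho> N X"
  shows "integrable M (\<lambda>\<omega>. \<Sum>i<N. (square_covariance N (X \<omega>) ^\<^sub>m k) $$ (i, i))"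
    and "(\<integral>\<omega>. (\<Sum>i<N. (square_covariance N (X \<omega>) ^\<^sub>m k) $$ (i, i)) \<partial>M)
      = (\<Sum>a<N. walk_sum N (factor 0 (4 * k)) a a (entry_moment M X)) / real N ^ (2 * k)"
proof -
  have eq: "(\<Sum>i<N. (square_covariance N (X \<omega>) ^\<^sub>m k) $$ (i, i))
      = (\<Sum>a<N. walk_sum N (factor 0 (4 * k)) a a (\<lambda>S. \<Prod>e\<in>#S. X \<omega> $$ e)) / real N ^ (2 * k)"
    if "\<omega> \<in> space M" for \<omega>
  proof -
    have A: "X \<omega> \<in> carrier_mat N N" using elliptic that by (simp add: elliptic_matrix_def)
    have "(square_covariance N (X \<omega>) ^\<^sub>m k) $$ (i, i)
        = walk_sum N (factor 0 (4 * k)) i i (\<lambda>S. \<Prod>e\<in>#S. X \<omega> $$ e) / real N ^ (2 * k)" if "i < N" for i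
      unfolding square_covariance_pow[OF A]
      using that word_mat_carrier[OF A, of "factor 0 (4 * k)"]
      by (simp add: word_mat_entry[OF A] power_divide power_mult)
    then show ?thesis by (simp add: sum_divide_distrib)
  qed
  let ?f = "\<lambda>a \<omega>. walk_sum N (factor 0 (4 * k)) a a (\<lambda>S. \<Prod>e\<in>#S. X \<omega> $$ e)"
  have "integrable M (?f a) \<and> (\<integral>\<omega>. ?f a \<omega> \<partial>M) = walk_sum N (factor 0 (4 * k)) a a (entry_moment M X)" if "a < N" for a
    unfolding entry_moment_def[abs_def]
    by (rule walk_sum_integral[of N M "\<lambda>S \<omega>. \<Prod>e\<in>#S. X \<omega> $$ e", OF entry_moment_prod(1)[OF elliptic] that])
  note w = integral_sum_lessThan[of N M ?f, OF this]
  show "integrable M (\<lambda>\<omega>. \<Sum>i<N. (square_covariance N (X \<omega>) ^\<^sub>m k) $$ (i, i))"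
    by (subst Bochner_Integration.integrable_cong[OF refl eq], assumption)
       (rule integrable_divide[OF conjunct1[OF w]])
  have "(\<integral>\<omega>. (\<Sum>i<N. (square_covariance N (X \<omega>) ^\<^sub>m k) $$ (i, i)) \<partial>M)
    = (\<integral>\<omega>. (\<Sum>a<N. ?f a \<omega>) / real N ^ (2 * k) \<partial>M)"
    by (rule Bochner_Integration.integral_cong[OF refl eq])
  also have "\<dots> = (\<Sum>a<N. walk_sum N (factor 0 (4 * k)) a a (entry_moment M X)) / real N ^ (2 * k)"
    using w by simp
  finally show "(\<integral>\<omega>. (\<Sum>i<N. (square_covariance N (X \<omega>) ^\<^sub>m k) $$ (i, i)) \<partial>M)
      = (\<Sum>a<N. walk_sum N (factor 0 (4 * k)) a a (entry_moment M X)) / real N ^ (2 * k)" .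
qed

text \<open>The prefactor of the matrix contributes \<open>N ^ (2 * k)\<close> to the denominator
  and the normalized trace one more \<open>N\<close>: this is the exponent \<open>m + 1\<close> for
  a word of length \<open>2 * m = 4 * k\<close>.\<close>

lemma expected_spectral_moment_tendsto:
  assumes "\<And>N. N \<ge> 1 \<Longrightarrow> elliptic_matrix (M N) \<rho> N (X N)" and "\<bar>\<rho>\<bar> \<le> 1"
  shows "(\<lambda>N. (\<integral>\<omega>. (\<Sum>i<N. (square_covariance N (X N \<omega>) ^\<^sub>m k) $$ (i, i)) \<partial>M N) / real N) \<longlonglongrightarrow> fm0 \<rho> (2 * k)"
proof -
  have "(\<lambda>N. (\<Sum>a<N. walk_sum N (factor 0 (4 * k)) a a (entry_moment (M N) (X N))) / real N ^ (2 * k + 1))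
    \<longlonglongrightarrow> free_moment \<rho> (factor 0 (4 * k))"
    by (rule single_trace_tendsto[OF wick_entry_moment[OF assms(1)] assms(2)]) simp_all
  moreover have "eventually (\<lambda>N. (\<Sum>a<N. walk_sum N (factor 0 (4 * k)) a a (entry_moment (M N) (X N))) / real N ^ (2 * k + 1)
    = (\<integral>\<omega>. (\<Sum>i<N. (square_covariance N (X N \<omega>) ^\<^sub>m k) $$ (i, i)) \<partial>M N) / real N) sequentially"
    using eventually_ge_at_top[of 1]
    by eventually_elim (simp add: expected_spectral_moment(2)[OF assms(1)])
  ultimately show ?thesis
    by (simp add: fm0_def tendsto_cong)
qed

section \<open>Mean spectral distributions\<close>

lemma suminf_power_sum:
  fixes ev :: "nat \<Rightarrow> real"
  assumes "\<And>y. (\<lambda>k. c k * y ^ k) sums f y"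
  shows "(\<Sum>i<N. f (ev i)) = (\<Sum>k. c k * (\<Sum>i<N. ev i ^ k))"
proof -
  have "(\<lambda>k. \<Sum>i<N. c k * ev i ^ k) sums (\<Sum>i<N. f (ev i))"
    by (intro sums_sum assms)
  then show ?thesis
    by (simp add: sums_iff sum_distrib_left)
qed

text \<open>The indicator of \<open>y \<le> x\<close> is the limit of the entire functions \<open>exp (- exp (n * (y - x) - sqrt n))\<close>,
  whose sums over the \<open>ev i\<close> are series in the power sums.\<close>

lemma borel_measurable_count_le:
  fixes ev :: "nat \<Rightarrow> 'a \<Rightarrow> real"
  assumes pow [measurable]: "\<And>k. (\<lambda>\<omega>. \<Sum>i<N. ev i \<omega> ^ k) \<in> borel_measurable M"
  shows "(\<lambda>\<omega>. real (card {i. i < N \<and> ev i \<omega> \<le> x})) \<in> borel_measurable M"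
proof (rule borel_measurable_LIMSEQ_real)
  have exp_sums: "(\<lambda>k. (t ^ k / fact k) * y ^ k) sums exp (t * y)" for t y :: real
    using exp_converges[of "t * y"] by (simp add: power_mult_distrib scaleR_conv_of_real field_simps)
  have [measurable]: "(\<lambda>\<omega>. \<Sum>i<N. exp (t * ev i \<omega>)) \<in> borel_measurable M" for t
    unfolding suminf_power_sum[of _ "\<lambda>y. exp (t * y)", OF exp_sums] by measurable
  \<comment> \<open>Expanding the outer exponential leaves sums of
    \<open>exp ((a * real k) * ev i \<omega>)\<close>, which are measurable by the preceding fact;
    two expansions thus reduce everything to power sums.\<close>
  have exp2: "(\<lambda>\<omega>. \<Sum>i<N. exp (- exp (a * ev i \<omega> + b))) \<in> borel_measurable M" for a b
  proof -
    have "(\<lambda>k. (- 1) ^ k / fact k * exp (a * y + b) ^ k) sums exp (- exp (a * y + b))" for y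
      using exp_sums[of "- 1" "exp (a * y + b)"] by simp
    then have "(\<lambda>k. \<Sum>i<N. (- 1) ^ k / fact k * exp (a * ev i \<omega> + b) ^ k) sums (\<Sum>i<N. exp (- exp (a * ev i \<omega> + b)))" for \<omega>
      by (intro sums_sum)
    moreover have "(\<Sum>i<N. c * exp (a * ev i \<omega> + b) ^ k)
        = c * exp (b * real k) * (\<Sum>i<N. exp ((a * real k) * ev i \<omega>))" for c k \<omega>
      by (simp add: sum_distrib_left exp_of_nat_mult[symmetric] mult_exp_exp mult.assoc algebra_simps)
    ultimately have "(\<Sum>i<N. exp (- exp (a * ev i \<omega> + b)))
        = (\<Sum>k. (- 1) ^ k / fact k * exp (b * real k) * (\<Sum>i<N. exp ((a * real k) * ev i \<omega>)))" for \<omega>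
      by (simp only: sums_iff)
    then show ?thesis by simp
  qed
  \<comment> \<open>The summand \<open>- sqrt n\<close> settles the boundary case: at
    \<open>y = x\<close> the inner exponential still tends to 0, so the limit is 1 there, while for
    \<open>y > x\<close> the linear term wins.\<close>
  show "(\<lambda>\<omega>. \<Sum>i<N. exp (- exp (real n * ev i \<omega> + (- real n * x - sqrt n)))) \<in> borel_measurable M" for n
    by (rule exp2)
  have lim: "(\<lambda>n. exp (- exp (real n * y + (- real n * x - sqrt n)))) \<longlonglongrightarrow> (if y \<le> x then 1 else 0)" for y
  proof (cases "y \<le> x")
    case True
    have "(\<lambda>n. exp (real n * y + (- real n * x - sqrt n))) \<longlonglongrightarrow> 0"
    proof (rule tendsto_sandwich[of "\<lambda>_. 0" _ _ "\<lambda>n. exp (- sqrt (real n))"])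
      show "(\<lambda>n. exp (- sqrt (real n))) \<longlonglongrightarrow> 0"
        by (intro filterlim_compose[OF exp_at_bot] filterlim_uminus_at_bot_at_top[THEN filterlim_compose]
            filterlim_compose[OF sqrt_at_top filterlim_real_sequentially])
      show "eventually (\<lambda>n. exp (real n * y + (- real n * x - sqrt n)) \<le> exp (- sqrt (real n))) sequentially"
        using True by (intro always_eventually allI) (simp add: mult_left_mono)
    qed auto
    from tendsto_exp[OF tendsto_minus[OF this]] True show ?thesis by simp
  next
    case False
    have "filterlim (\<lambda>n. sqrt (real n) * (sqrt (real n) * (y - x) - 1)) at_top sequentially"
    proof (rule filterlim_at_top_mult_at_top)
      show "filterlim (\<lambda>n. sqrt (real n)) at_top sequentially"
        by (rule filterlim_compose[OF sqrt_at_top filterlim_real_sequentially])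
      then have "filterlim (\<lambda>n. (y - x) * sqrt (real n)) at_top sequentially"
        using False by (intro filterlim_tendsto_pos_mult_at_top[OF tendsto_const]) auto
      then have "filterlim (\<lambda>n. - 1 + (y - x) * sqrt (real n)) at_top sequentially"
        by (rule filterlim_tendsto_add_at_top[OF tendsto_const])
      then show "filterlim (\<lambda>n. sqrt (real n) * (y - x) - 1) at_top sequentially"
        by (simp add: mult.commute)
    qed
    moreover have "sqrt (real n) * (sqrt (real n) * (y - x) - 1) = real n * y + (- real n * x - sqrt n)" for n
    proof -
      have "sqrt (real n) * sqrt (real n) = real n" by simp
      then have "sqrt (real n) * (sqrt (real n) * (y - x) - 1) = real n * (y - x) - sqrt n"
        by (metis mult.assoc mult_1_right right_diff_distrib)
      then show ?thesis by (simp add: algebra_simps)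
    qed
    ultimately have "filterlim (\<lambda>n. exp (real n * y + (- real n * x - sqrt n))) at_top sequentially"
      by (intro filterlim_compose[OF exp_at_top]) simp
    then have "(\<lambda>n. exp (- exp (real n * y + (- real n * x - sqrt n)))) \<longlonglongrightarrow> 0"
      by (intro filterlim_compose[OF exp_at_bot] filterlim_uminus_at_bot_at_top[THEN filterlim_compose])
    then show ?thesis using False by simp
  qed
  fix \<omega>
  have "real (card {i. i < N \<and> ev i \<omega> \<le> x}) = (\<Sum>i<N. if ev i \<omega> \<le> x then 1 else 0)"
    by (simp add: sum.If_cases Collect_conj_eq lessThan_def)
  then show "(\<lambda>n. \<Sum>i<N. exp (- exp (real n * ev i \<omega> + (- real n * x - sqrt n))))
      \<longlonglongrightarrow> real (card {i. i < N \<and> ev i \<omega> \<le> x})"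
    using tendsto_sum[of "{..<N}" "\<lambda>i n. exp (- exp (real n * ev i \<omega> + (- real n * x - sqrt n)))", OF lim] by simp
qed

text \<open>Expresses the sublevel sets of the ordered eigenvalues by the counting function, so that
  measurability passes from the counts to each eigenvalue.\<close>

lemma sorted_nth_le_iff:
  fixes l :: "real list"
  assumes "sorted l" "i < length l"
  shows "l ! i \<le> x \<longleftrightarrow> i < card {j. j < length l \<and> l ! j \<le> x}"
proof
  assume "l ! i \<le> x"
  then have "{..i} \<subseteq> {j. j < length l \<and> l ! j \<le> x}"
    using assms by (auto intro: order.trans sorted_nth_mono)
  from card_mono[OF _ this] show "i < card {j. j < length l \<and> l ! j \<le> x}" by simp
next
  assume i: "i < card {j. j < length l \<and> l ! j \<le> x}"
  show "l ! i \<le> x"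
  proof (rule ccontr)
    assume "\<not> l ! i \<le> x"
    then have "{j. j < length l \<and> l ! j \<le> x} \<subseteq> {..<i}"
      using assms by (auto simp: not_le intro!: leI dest: sorted_nth_mono[OF assms(1)] order.trans)
        (meson leI order.strict_trans2 order_less_le_trans sorted_nth_mono not_le)
    from card_mono[OF _ this] i show False by simp
  qed
qed

text \<open>The law of \<open>ev i\<close> for a uniformly chosen index \<open>i\<close> independent
  of \<omega>. For the eigenvalues its distribution function is the expected spectral distribution
  function.\<close>

lemma (in prob_space) mixture_distribution:
  fixes ev :: "nat \<Rightarrow> 'a \<Rightarrow> real"
  assumes meas [measurable]: "\<And>i. ev i \<in> borel_measurable M" and N: "N \<ge> 1"
  obtains \<mu> where "real_distribution \<mu>"
    "\<And>g. g \<in> borel_measurable borel \<Longrightarrow> (\<integral>\<^sup>+x. g x \<partial>\<mu>) = (\<Sum>i<N. \<integral>\<^sup>+\<omega>. g (ev i \<omega>) \<partial>M) / N"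
proof -
  let ?P = "measure_pmf (pmf_of_set {..<N})"
  have sets_P: "sets ?P = sets (count_space UNIV)" by simp
  have [measurable]: "(\<lambda>p. ev (fst p) (snd p)) \<in> borel_measurable (?P \<Otimes>\<^sub>M M)"
  proof -
    have "(\<lambda>p. ev (fst p) (snd p)) \<in> borel_measurable (count_space UNIV \<Otimes>\<^sub>M M)"
      by (rule measurable_pair_measure_countable1) simp_all
    then show ?thesis
      by (simp cong: measurable_cong_sets add: sets_pair_measure_cong[OF sets_P refl])
  qed
  interpret P: pair_prob_space ?P M ..
  let ?\<mu> = "distr (?P \<Otimes>\<^sub>M M) borel (\<lambda>p. ev (fst p) (snd p))"
  have "prob_space ?\<mu>" by (rule P.prob_space_distr) measurable
  then have "real_distribution ?\<mu>"
    by (simp add: real_distribution_def real_distribution_axioms_def)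
  moreover have "(\<integral>\<^sup>+x. g x \<partial>?\<mu>) = (\<Sum>i<N. \<integral>\<^sup>+\<omega>. g (ev i \<omega>) \<partial>M) / N"
    if g [measurable]: "g \<in> borel_measurable borel" for g
  proof -
    have "(\<integral>\<^sup>+x. g x \<partial>?\<mu>) = (\<integral>\<^sup>+p. g (ev (fst p) (snd p)) \<partial>(?P \<Otimes>\<^sub>M M))"
      by (rule nn_integral_distr) measurable
    also have "\<dots> = (\<integral>\<^sup>+i. \<integral>\<^sup>+\<omega>. g (ev i \<omega>) \<partial>M \<partial>?P)"
      by (subst nn_integral_fst[symmetric]) simp_all
    also have "\<dots> = (\<Sum>i<N. \<integral>\<^sup>+\<omega>. g (ev i \<omega>) \<partial>M) / N"
      using N by (subst nn_integral_pmf_of_set) (auto simp: lessThan_empty_iff)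
    finally show ?thesis .
  qed
  ultimately show ?thesis by (rule that)
qed

section \<open>The method of moments\<close>

text \<open>On a bounded support the exponential series may be integrated term by term, being
  dominated by the series of \<open>exp (\<bar>t\<bar> * R)\<close>; the characteristic function is
  thus a function of the moments.\<close>

lemma (in real_distribution) char_sums:
  assumes R: "AE x in M. \<bar>x\<bar> \<le> R"
  shows "(\<lambda>k. (\<i> * of_real t) ^ k / fact k * of_real (\<integral>x. x ^ k \<partial>M)) sums char M t"
proof -
  have int: "integrable M (\<lambda>x. x ^ k)" for k
    by (rule integrable_const_bound[where B = "R ^ k"])
       (use R in \<open>auto elim!: eventually_mono intro: power_mono simp: power_abs\<close>)
  let ?f = "\<lambda>k x. (\<i> * of_real t) ^ k / fact k * of_real (x ^ k) :: complex"
  have intf: "integrable M (?f k)" for k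
    using int[of k] by (intro integrable_mult_right integrable_of_real)
  have norm_f: "norm (?f k x) = (\<bar>t\<bar> * \<bar>x\<bar>) ^ k / fact k" for k x
    by (simp add: norm_mult norm_power norm_divide power_mult_distrib power_abs)
  have "(\<lambda>k. \<integral>x. ?f k x \<partial>M) sums (\<integral>x. (\<Sum>k. ?f k x) \<partial>M)"
  proof (rule sums_integral[OF intf])
    show "AE x in M. summable (\<lambda>k. norm (?f k x))"
      unfolding norm_f using summable_exp by (intro AE_I2) (simp add: divide_inverse mult.commute)
    have "(\<integral>x. norm (?f k x) \<partial>M) \<le> inverse (fact k) * (\<bar>t\<bar> * R) ^ k" for k
    proof -
      have "(\<integral>x. norm (?f k x) \<partial>M) \<le> (\<integral>x. inverse (fact k) * (\<bar>t\<bar> * R) ^ k \<partial>M)"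
      proof (rule integral_mono_AE)
        show "integrable M (\<lambda>x. norm (?f k x))" using intf by (rule integrable_norm)
        show "AE x in M. norm (?f k x) \<le> inverse (fact k) * (\<bar>t\<bar> * R) ^ k"
          using R unfolding norm_f
          by eventually_elim (auto simp: divide_inverse mult.commute intro!: mult_left_mono mult_right_mono power_mono)
      qed simp
      then show ?thesis by (simp add: prob_space[simplified])
    qed
    then show "summable (\<lambda>k. \<integral>x. norm (?f k x) \<partial>M)"
      by (intro summable_comparison_test'[OF summable_exp[of "\<bar>t\<bar> * R"], of 0]) simp
  qed
  also have "(\<lambda>k. \<integral>x. ?f k x \<partial>M) = (\<lambda>k. (\<i> * of_real t) ^ k / fact k * of_real (\<integral>x. x ^ k \<partial>M))"
    by (simp only: integral_mult_right_zero integral_complex_of_real)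
  also have "(\<integral>x. (\<Sum>k. ?f k x) \<partial>M) = char M t"
    unfolding char_def
  proof (rule Bochner_Integration.integral_cong[OF refl])
    fix x
    have "(\<lambda>k. ?f k x) sums exp (\<i> * of_real (t * x))"
      using exp_converges[of "\<i> * of_real (t * x) :: complex"]
      by (simp add: power_mult_distrib scaleR_conv_of_real divide_inverse mult_ac)
    then show "(\<Sum>k. ?f k x) = iexp (t * x)" by (simp add: sums_iff)
  qed
  finally show ?thesis .
qed

lemma bounded_moments_determine:
  assumes "real_distribution \<mu>" "real_distribution \<nu>"
    and "AE x in \<mu>. \<bar>x\<bar> \<le> R" "AE x in \<nu>. \<bar>x\<bar> \<le> S"
    and "\<And>k. (\<integral>x. x ^ k \<partial>\<mu>) = (\<integral>x. x ^ k \<partial>\<nu>)"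
  shows "\<mu> = \<nu>"
proof (rule Levy_uniqueness[OF assms(1,2)], rule ext)
  fix t
  show "char \<mu> t = char \<nu> t"
    using real_distribution.char_sums[OF assms(1,3), of t] real_distribution.char_sums[OF assms(2,4), of t]
    unfolding assms(5) by (rule sums_unique2)
qed

text \<open>Powers of \<open>x\<close> are unbounded, whereas powers of the truncation are bounded
  and continuous and hence admissible test functions for weak convergence.\<close>

definition cut_off :: "real \<Rightarrow> real \<Rightarrow> real" where
  "cut_off T x = max (- T) (min T x)"

lemma cut_off_abs_le: "0 \<le> T \<Longrightarrow> \<bar>cut_off T x\<bar> \<le> T" "0 \<le> T \<Longrightarrow> \<bar>cut_off T x\<bar> \<le> \<bar>x\<bar>"
  by (auto simp: cut_off_def)

lemma isCont_cut_off: "isCont (cut_off T) x"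
  unfolding cut_off_def[abs_def] by (intro continuous_intros)

lemma cut_off_measurable [measurable]: "cut_off T \<in> borel_measurable borel"
  unfolding cut_off_def[abs_def] by measurable

text \<open>The difference vanishes on \<open>[- T, T]\<close>. Outside it is at most
  \<open>\<bar>x\<bar> ^ k\<close>, and there
  \<open>\<bar>x\<bar> ^ k / T ^ k \<ge> 1\<close>.\<close>

lemma cut_off_power_diff:
  assumes "T > 0"
  shows "\<bar>x ^ k - cut_off T x ^ k\<bar> \<le> x ^ (2 * k) / T ^ k"
proof (cases "\<bar>x\<bar> \<le> T")
  case True
  then have "cut_off T x = x" by (auto simp: cut_off_def)
  then show ?thesis using assms by simp
next
  case False
  define s where "s = T / \<bar>x\<bar>"
  have s: "0 \<le> s" "s \<le> 1" and c: "cut_off T x = s * x"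
  proof -
    show "0 \<le> s" "s \<le> 1" using False assms by (auto simp: s_def)
    show "cut_off T x = s * x"
    proof (cases "0 \<le> x")
      case True
      then show ?thesis using False assms by (simp add: s_def cut_off_def)
    next
      case neg: False
      then show ?thesis using False assms by (simp add: s_def cut_off_def)
    qed
  qed
  have "\<bar>x ^ k - cut_off T x ^ k\<bar> = (1 - s ^ k) * \<bar>x\<bar> ^ k"
  proof -
    have "x ^ k - cut_off T x ^ k = (1 - s ^ k) * x ^ k"
      by (simp add: c power_mult_distrib algebra_simps)
    moreover have "0 \<le> 1 - s ^ k" using s by (simp add: power_le_one)
    ultimately show ?thesis by (simp add: abs_mult power_abs)
  qed
  also have "\<dots> \<le> 1 * \<bar>x\<bar> ^ k"
    using s by (intro mult_right_mono) auto
  also have "\<dots> \<le> \<bar>x\<bar> ^ k * (\<bar>x\<bar> ^ k / T ^ k)"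
  proof -
    have "T ^ k \<le> \<bar>x\<bar> ^ k" using False assms by (intro power_mono) auto
    then have "1 \<le> \<bar>x\<bar> ^ k / T ^ k" using assms by simp
    from mult_left_mono[OF this, of "\<bar>x\<bar> ^ k"] show ?thesis by simp
  qed
  also have "\<dots> = x ^ (2 * k) / T ^ k"
    by (simp add: power_mult power2_eq_square power_mult_distrib[symmetric])
  finally show ?thesis .
qed

text \<open>By \<open>cut_off_power_diff\<close> the truncation error of the moment of order
  \<open>k\<close> under \<open>\<mu> n\<close> is at most the moment of order \<open>2 * k\<close>
  divided by \<open>T ^ k\<close>, which is controlled uniformly in \<open>n\<close> since these
  moments converge. Weak convergence carries the truncated moments over to \<nu>, and then
  \<open>T\<close> tends to infinity.\<close>

lemma weak_limit_moments:
  fixes \<mu> :: "nat \<Rightarrow> real measure"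
  assumes rd: "\<And>n. real_distribution (\<mu> n)" "real_distribution \<nu>" and conv: "weak_conv_m \<mu> \<nu>"
    and int: "\<And>n k. integrable (\<mu> n) (\<lambda>x. x ^ k)"
    and lim: "\<And>k. (\<lambda>n. \<integral>x. x ^ k \<partial>\<mu> n) \<longlonglongrightarrow> m k"
  shows "integrable \<nu> (\<lambda>x. x ^ k)" and "(\<integral>x. x ^ k \<partial>\<nu>) = m k"
proof -
  interpret \<nu>: real_distribution \<nu> by fact
  interpret \<mu>: real_distribution "\<mu> n" for n by (rule rd)
  have cut_off_lim: "(\<lambda>n. \<integral>x. cut_off T x ^ k \<partial>\<mu> n) \<longlonglongrightarrow> (\<integral>x. cut_off T x ^ k \<partial>\<nu>)" if "T \<ge> 0" for T k
  proof (rule weak_conv_imp_integral_bdd_continuous_conv[OF rd conv])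
    show "isCont (\<lambda>x. cut_off T x ^ k) x" for x
      by (intro continuous_intros isCont_cut_off)
    show "norm (cut_off T x ^ k) \<le> T ^ k" for x
      using cut_off_abs_le[OF that, of x] by (simp add: power_abs power_mono)
  qed
  have bound: "\<bar>m k - (\<integral>x. cut_off T x ^ k \<partial>\<nu>)\<bar> \<le> m (2 * k) / T ^ k" if T: "T > 0" for T k
  proof (rule LIMSEQ_le)
    show "(\<lambda>n. \<bar>(\<integral>x. x ^ k \<partial>\<mu> n) - (\<integral>x. cut_off T x ^ k \<partial>\<mu> n)\<bar>) \<longlonglongrightarrow> \<bar>m k - (\<integral>x. cut_off T x ^ k \<partial>\<nu>)\<bar>"
      using T by (intro tendsto_intros lim cut_off_lim) auto
    show "(\<lambda>n. (\<integral>x. x ^ (2 * k) \<partial>\<mu> n) / T ^ k) \<longlonglongrightarrow> m (2 * k) / T ^ k"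
      using T by (intro tendsto_intros lim) auto
    have "\<bar>(\<integral>x. x ^ k \<partial>\<mu> n) - (\<integral>x. cut_off T x ^ k \<partial>\<mu> n)\<bar> \<le> (\<integral>x. x ^ (2 * k) \<partial>\<mu> n) / T ^ k" for n
    proof -
      have ic: "integrable (\<mu> n) (\<lambda>x. cut_off T x ^ k)"
        by (rule \<mu>.integrable_const_bound[where B = "T ^ k"])
           (use cut_off_abs_le[of T] T in \<open>auto simp: power_abs intro!: AE_I2 power_mono\<close>)
      have "\<bar>(\<integral>x. x ^ k \<partial>\<mu> n) - (\<integral>x. cut_off T x ^ k \<partial>\<mu> n)\<bar> = \<bar>\<integral>x. x ^ k - cut_off T x ^ k \<partial>\<mu> n\<bar>"
        by (simp add: int ic)
      also have "\<dots> \<le> (\<integral>x. \<bar>x ^ k - cut_off T x ^ k\<bar> \<partial>\<mu> n)"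
        by (rule integral_abs_bound)
      also have "\<dots> \<le> (\<integral>x. x ^ (2 * k) / T ^ k \<partial>\<mu> n)"
        by (rule integral_mono) (use T in \<open>auto intro!: int ic integrable_abs Bochner_Integration.integrable_diff cut_off_power_diff\<close>)
      finally show ?thesis by simp
    qed
    then show "\<exists>N. \<forall>n\<ge>N. \<bar>(\<integral>x. x ^ k \<partial>\<mu> n) - (\<integral>x. cut_off T x ^ k \<partial>\<mu> n)\<bar> \<le> (\<integral>x. x ^ (2 * k) \<partial>\<mu> n) / T ^ k"
      by blast
  qed
  have inv0: "(\<lambda>j. m (2 * k) / real (Suc j) ^ k) \<longlonglongrightarrow> 0" if "k > 0" for k
  proof -
    have "(\<lambda>j. m (2 * k) * (inverse (real (Suc j))) ^ k) \<longlonglongrightarrow> m (2 * k) * 0 ^ k"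
      by (intro tendsto_intros LIMSEQ_inverse_real_of_nat)
    then show ?thesis using that by (simp add: divide_inverse power_inverse zero_power)
  qed
  have to_m: "(\<lambda>j. \<integral>x. cut_off (real (Suc j)) x ^ k \<partial>\<nu>) \<longlonglongrightarrow> m k" if "k > 0" for k
  proof (rule LIM_zero_cancel, rule Lim_null_comparison[OF _ inv0[OF that]])
    show "eventually (\<lambda>j. norm ((\<integral>x. cut_off (real (Suc j)) x ^ k \<partial>\<nu>) - m k) \<le> m (2 * k) / real (Suc j) ^ k) sequentially"
      using bound[of "real (Suc _)" k] by (intro always_eventually allI) (simp add: abs_minus_commute)
  qed
  have cut_off_eventually: "eventually (\<lambda>j. cut_off (real (Suc j)) x = x) sequentially" for x
  proof -
    have "eventually (\<lambda>j. \<bar>x\<bar> \<le> real j) sequentially"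
      using filterlim_real_sequentially by (auto simp: filterlim_at_top)
    then show ?thesis by eventually_elim (auto simp: cut_off_def)
  qed
  have cut_off_to: "(\<lambda>j. cut_off (real (Suc j)) x ^ k) \<longlonglongrightarrow> x ^ k" for x k
    by (rule tendsto_eventually) (use cut_off_eventually[of x] in \<open>auto elim!: eventually_mono\<close>)
  \<comment> \<open>Even powers of the truncation increase with the level, so monotone convergence
    yields integrability; general powers are dominated by \<open>1 + x ^ (2 * k)\<close>
    afterwards.\<close>
  have even_int: "integrable \<nu> (\<lambda>x. x ^ (2 * k))" if "k > 0" for k
  proof (rule integrable_monotone_convergence)
    show "integrable \<nu> (\<lambda>x. cut_off (real (Suc j)) x ^ (2 * k))" for j
      by (rule \<nu>.integrable_const_bound[where B = "real (Suc j) ^ (2 * k)"])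
         (use cut_off_abs_le[of "real (Suc j)"] in \<open>auto simp: power_abs simp del: of_nat_Suc intro!: AE_I2 power_mono\<close>)
    show "AE x in \<nu>. mono (\<lambda>j. cut_off (real (Suc j)) x ^ (2 * k))"
    proof (intro AE_I2 monoI)
      fix x i j assume "(i::nat) \<le> j"
      then have "\<bar>cut_off (real (Suc i)) x\<bar> \<le> \<bar>cut_off (real (Suc j)) x\<bar>" by (auto simp: cut_off_def)
      then show "cut_off (real (Suc i)) x ^ (2 * k) \<le> cut_off (real (Suc j)) x ^ (2 * k)"
        by (metis power_mono abs_ge_zero power_even_abs dvd_triv_left)
    qed
    show "AE x in \<nu>. (\<lambda>j. cut_off (real (Suc j)) x ^ (2 * k)) \<longlonglongrightarrow> x ^ (2 * k)"
      using cut_off_to by simp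
    show "(\<lambda>j. \<integral>x. cut_off (real (Suc j)) x ^ (2 * k) \<partial>\<nu>) \<longlonglongrightarrow> m (2 * k)"
      using that by (intro to_m) simp
  qed measurable
  have int\<nu>: "integrable \<nu> (\<lambda>x. x ^ k)" for k
  proof (cases "k = 0")
    case False
    have le: "\<bar>x ^ k\<bar> \<le> 1 + x ^ (2 * k)" for x :: real
    proof -
      have "2 * 1 * \<bar>x ^ k\<bar> \<le> 1\<^sup>2 + \<bar>x ^ k\<bar>\<^sup>2" by (rule sum_squares_bound)
      moreover have "\<bar>x ^ k\<bar>\<^sup>2 = x ^ (2 * k)" by (simp add: power_mult[symmetric] mult.commute)
      moreover have "0 \<le> \<bar>x ^ k\<bar>" by simp
      ultimately show ?thesis by simp
    qed
    show ?thesis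
      by (rule Bochner_Integration.integrable_bound[where f = "\<lambda>x. 1 + x ^ (2 * k)"])
         (use even_int[of k] False le in \<open>auto intro!: AE_I2 order.trans[OF le abs_ge_self]\<close>)
  qed simp
  then show "integrable \<nu> (\<lambda>x. x ^ k)" .
  show "(\<integral>x. x ^ k \<partial>\<nu>) = m k"
  proof (cases "k = 0")
    case True
    have "(\<lambda>n. 1) \<longlonglongrightarrow> m 0"
      using lim[of 0] by (simp add: \<mu>.prob_space[simplified])
    then have "m 0 = 1" by (simp add: LIMSEQ_const_iff)
    then show ?thesis by (simp add: True \<nu>.prob_space[simplified])
  next
    case False
    have "(\<lambda>j. \<integral>x. cut_off (real (Suc j)) x ^ k \<partial>\<nu>) \<longlonglongrightarrow> (\<integral>x. x ^ k \<partial>\<nu>)"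
    proof (rule integral_dominated_convergence[where w = "\<lambda>x. \<bar>x ^ k\<bar>"])
      show "integrable \<nu> (\<lambda>x. \<bar>x ^ k\<bar>)" using int\<nu> by (rule integrable_abs)
      show "AE x in \<nu>. norm (cut_off (real (Suc j)) x ^ k) \<le> \<bar>x ^ k\<bar>" for j
        using cut_off_abs_le(2)[of "real (Suc j)"] by (intro AE_I2) (auto simp: power_abs intro: power_mono)
    qed (use cut_off_to in auto)
    with to_m[of k] False show ?thesis using LIMSEQ_unique by blast
  qed
qed

text \<open>Markov's inequality for \<open>x ^ (2 * k)\<close> bounds the mass of
  \<open>\<bar>x\<bar> \<ge> R * q\<close> by \<open>C / q ^ (2 * k)\<close>, which tends to 0 as
  \<open>k\<close> grows, for every \<open>q > 1\<close>.\<close>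

lemma (in real_distribution) bounded_of_moments:
  assumes int: "\<And>k. integrable M (\<lambda>x. x ^ k)" and le: "\<And>k. (\<integral>x. x ^ (2 * k) \<partial>M) \<le> C * R ^ (2 * k)" and R: "R > 0"
  shows "AE x in M. \<bar>x\<bar> \<le> R"
proof -
  have "AE x in M. \<bar>x\<bar> < R * (1 + 1 / real (Suc j))" for j
  proof -
    \<comment> \<open>A sequence of factors decreasing to 1, so that countably many null sets
      suffice to reach the radius \<open>R\<close> itself.\<close>
    define q where "q = 1 + 1 / real (Suc j)"
    have q: "q > 1" by (simp add: q_def)
    have Rq: "R * q > 0" using R q by simp
    have "measure M {x \<in> space M. R * q \<le> \<bar>x\<bar>} \<le> C / q ^ (2 * k)" for k
    proof -
      have "measure M {x \<in> space M. R * q \<le> \<bar>x\<bar>} \<le> measure M {x \<in> space M. (R * q) ^ (2 * k) \<le> x ^ (2 * k)}"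
      proof (rule finite_measure_mono)
        have "(R * q) ^ (2 * k) \<le> x ^ (2 * k)" if "R * q \<le> \<bar>x\<bar>" for x
          using power_mono[OF that, of "2 * k"] Rq by (simp add: power_even_abs)
        then show "{x \<in> space M. R * q \<le> \<bar>x\<bar>} \<subseteq> {x \<in> space M. (R * q) ^ (2 * k) \<le> x ^ (2 * k)}" by blast
      qed measurable
      also have "\<dots> \<le> (\<integral>x. x ^ (2 * k) \<partial>M) / (R * q) ^ (2 * k)"
        by (rule integral_Markov_inequality_measure[where A = "{}"]) (use int Rq in auto)
      also have "\<dots> \<le> C * R ^ (2 * k) / (R * q) ^ (2 * k)"
        by (rule divide_right_mono[OF le]) (use Rq in simp)
      also have "\<dots> = C / q ^ (2 * k)"
        using R q by (simp add: power_mult_distrib)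
      finally show ?thesis .
    qed
    moreover have "(\<lambda>k. C / q ^ (2 * k)) \<longlonglongrightarrow> 0"
    proof -
      have "(\<lambda>k. C * (inverse (q\<^sup>2)) ^ k) \<longlonglongrightarrow> C * 0"
        by (intro tendsto_mult tendsto_const LIMSEQ_realpow_zero) (use one_less_power[OF q, of 2] in \<open>simp_all add: inverse_less_1_iff\<close>)
      then show ?thesis by (simp only: power_mult divide_inverse power_inverse mult_zero_right)
    qed
    ultimately have "measure M {x \<in> space M. R * q \<le> \<bar>x\<bar>} \<le> 0"
      by (intro LIMSEQ_le_const) auto
    then have "measure M {x \<in> space M. R * q \<le> \<bar>x\<bar>} = 0"
      by (simp add: measure_le_0_iff)
    then have "AE x in M. \<not> R * q \<le> \<bar>x\<bar>"
      by (subst AE_iff_measurable[OF _ refl]) (simp_all add: emeasure_eq_measure)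
    then show ?thesis by (simp add: not_le q_def)
  qed
  then have "AE x in M. \<forall>j. \<bar>x\<bar> < R * (1 + 1 / real (Suc j))"
    by (simp add: AE_all_countable)
  then show ?thesis
  proof eventually_elim
    case (elim x)
    have "(\<lambda>j. R * (1 + inverse (real (Suc j)))) \<longlonglongrightarrow> R * (1 + 0)"
      by (intro tendsto_intros LIMSEQ_inverse_real_of_nat)
    then show ?case
      by (intro LIMSEQ_le_const[of _ R]) (use elim in \<open>auto simp: divide_inverse intro: less_imp_le\<close>)
  qed
qed

lemma tight_of_second_moment:
  assumes rd: "\<And>n. real_distribution (\<mu> n)" and int: "\<And>n. integrable (\<mu> n) (\<lambda>x. x ^ 2)"
    and le: "\<And>n. (\<integral>x. x ^ 2 \<partial>\<mu> n) \<le> B"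
  shows "tight \<mu>"
  unfolding tight_def
proof (intro conjI allI impI rd)
  fix \<epsilon> :: real assume \<epsilon>: "\<epsilon> > 0"
  \<comment> \<open>The summand 1 keeps \<open>a\<close> positive and makes Chebyshev's bound
    \<open>\<bar>B\<bar> / a\<^sup>2\<close> strictly smaller than \<epsilon>.\<close>
  define a where "a = sqrt ((\<bar>B\<bar> + 1) / \<epsilon>)"
  have a: "a > 0" and a2: "a\<^sup>2 = (\<bar>B\<bar> + 1) / \<epsilon>"
    using \<epsilon> by (simp_all add: a_def)
  have "measure (\<mu> n) {-(2 * a)<..2 * a} > 1 - \<epsilon>" for n
  proof -
    interpret real_distribution "\<mu> n" by (rule rd)
    have "1 - measure (\<mu> n) {-(2 * a)<..2 * a} = measure (\<mu> n) (space (\<mu> n) - {-(2 * a)<..2 * a})"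
      by (rule prob_compl[symmetric]) simp
    also have "\<dots> \<le> measure (\<mu> n) {x \<in> space (\<mu> n). a\<^sup>2 \<le> x ^ 2}"
    proof (rule finite_measure_mono)
      have "a\<^sup>2 \<le> x\<^sup>2" if "x \<notin> {-(2 * a)<..2 * a}" for x
      proof -
        have "\<bar>a\<bar> \<le> \<bar>x\<bar>" using that a by auto
        then show ?thesis by (simp add: abs_le_square_iff)
      qed
      then show "space (\<mu> n) - {-(2 * a)<..2 * a} \<subseteq> {x \<in> space (\<mu> n). a\<^sup>2 \<le> x ^ 2}" by blast
    qed measurable
    also have "\<dots> \<le> (\<integral>x. x ^ 2 \<partial>\<mu> n) / a\<^sup>2"
      by (rule integral_Markov_inequality_measure[where A = "{}"]) (use int a in auto)
    also have "\<dots> \<le> \<bar>B\<bar> / a\<^sup>2"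
      using le[of n] by (intro divide_right_mono) auto
    also have "\<dots> < \<epsilon>"
      using \<epsilon> unfolding a2 by (simp add: field_simps)
    finally show ?thesis by simp
  qed
  then show "\<exists>a b. a < b \<and> (\<forall>n. measure (\<mu> n) {a<..b} > 1 - \<epsilon>)"
    using a by (intro exI[of _ "-(2 * a)"] exI[of _ "2 * a"]) auto
qed

text \<open>Every weak limit of a subsequence has the moments \<open>m\<close> and, by their growth,
  bounded support; such a law is determined by its moments, so all these limits coincide and
  tightness gives convergence of the whole sequence.\<close>

theorem method_of_moments:
  fixes \<mu> :: "nat \<Rightarrow> real measure"
  assumes rd: "\<And>n. real_distribution (\<mu> n)"
    and int: "\<And>n k. integrable (\<mu> n) (\<lambda>x. x ^ k)"
    and lim: "\<And>k. (\<lambda>n. \<integral>x. x ^ k \<partial>\<mu> n) \<longlonglongrightarrow> m k"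
    and bound: "\<And>k. m k \<le> C * R ^ k" and R: "R > 0"
  obtains \<nu> where "real_distribution \<nu>" "weak_conv_m \<mu> \<nu>"
    "\<And>k. integrable \<nu> (\<lambda>x. x ^ k)" "\<And>k. (\<integral>x. x ^ k \<partial>\<nu>) = m k" "AE x in \<nu>. \<bar>x\<bar> \<le> R"
proof -
  have "Bseq (\<lambda>n. \<integral>x. x ^ 2 \<partial>\<mu> n)"
    using lim[of 2] by (intro convergent_imp_Bseq convergentI)
  then obtain B where "\<And>n. \<bar>\<integral>x. x ^ 2 \<partial>\<mu> n\<bar> \<le> B"
    by (auto simp: Bseq_def)
  then have B: "(\<integral>x. x ^ 2 \<partial>\<mu> n) \<le> B" for n
    by (rule order.trans[OF abs_ge_self])
  have tight: "tight \<mu>"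
    by (rule tight_of_second_moment[OF rd int B])
  have limit: "(\<forall>k. integrable \<nu> (\<lambda>x. x ^ k)) \<and> (\<forall>k. (\<integral>x. x ^ k \<partial>\<nu>) = m k) \<and> (AE x in \<nu>. \<bar>x\<bar> \<le> R)"
    if s: "strict_mono s" and \<nu>: "real_distribution \<nu>" and conv: "weak_conv_m (\<mu> \<circ> s) \<nu>" for s \<nu>
  proof -
    have lim': "(\<lambda>n. \<integral>x. x ^ k \<partial>(\<mu> \<circ> s) n) \<longlonglongrightarrow> m k" for k
      using LIMSEQ_subseq_LIMSEQ[OF lim s, of k] by (simp add: comp_def)
    note w = weak_limit_moments[OF _ \<nu> conv _ lim']
    have i: "integrable \<nu> (\<lambda>x. x ^ k)" and e: "(\<integral>x. x ^ k \<partial>\<nu>) = m k" for k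
      by (rule w; simp add: rd int)+
    moreover have "AE x in \<nu>. \<bar>x\<bar> \<le> R"
      by (rule real_distribution.bounded_of_moments[OF \<nu> i, where C = C]) (simp_all add: e bound R)
    ultimately show ?thesis by auto
  qed
  obtain r \<nu> where r: "strict_mono r" and \<nu>: "real_distribution \<nu>" and conv: "weak_conv_m (\<mu> \<circ> r) \<nu>"
    using tight_imp_convergent_subsubsequence[OF tight strict_mono_id] by auto
  note \<nu>_prop = limit[OF r \<nu> conv]
  have "weak_conv_m \<mu> \<nu>"
  proof (rule tight_subseq_weak_converge[OF rd \<nu> tight])
    fix s \<nu>' assume *: "strict_mono s" "real_distribution \<nu>'" "weak_conv_m (\<mu> \<circ> s) \<nu>'"
    have "\<nu>' = \<nu>"
      by (rule bounded_moments_determine[OF *(2) \<nu>, where R = R and S = R]) (use limit[OF *] \<nu>_prop in auto)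
    with * show "weak_conv_m (\<mu> \<circ> s) \<nu>" by simp
  qed
  with \<nu> \<nu>_prop show ?thesis by (intro that) auto
qed

section \<open>Symmetrization\<close>

text \<open>Identifies the measure reconstructed from the limiting distribution function with the
  weak limit found by the method of moments.\<close>

lemma interval_measure_cdf:
  assumes "real_distribution \<mu>"
  shows "interval_measure (cdf \<mu>) = \<mu>"
proof -
  interpret real_distribution \<mu> by fact
  have mono: "x \<le> y \<Longrightarrow> cdf \<mu> x \<le> cdf \<mu> y" for x y by (rule cdf_nondecreasing)
  have 1: "real_distribution (interval_measure (cdf \<mu>))"
    by (rule real_distribution_interval_measure[OF mono cdf_is_right_cont cdf_lim_at_bot cdf_lim_at_top_prob])
  show ?thesis
    by (rule cdf_unique[OF 1 assms]) (rule cdf_interval_measure[OF mono cdf_is_right_cont cdf_lim_at_bot])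
qed

context
  fixes \<mu> :: "real measure"
  assumes rd: "real_distribution \<mu>"
begin

interpretation real_distribution \<mu> by (rule rd)

lemma nn_integral_symmetrization:
  assumes [measurable]: "g \<in> borel_measurable borel"
  shows "(\<integral>\<^sup>+y. g y \<partial>symmetrization \<mu>)
    = ((\<integral>\<^sup>+x. g (- sqrt x) \<partial>\<mu>) + (\<integral>\<^sup>+x. g (sqrt x) \<partial>\<mu>)) / 2"
proof -
  let ?P = "measure_pmf (pmf_of_set {-1, 1 :: real})"
  interpret P: pair_prob_space ?P \<mu> ..
  have sets: "sets (?P \<Otimes>\<^sub>M \<mu>) = sets (count_space UNIV \<Otimes>\<^sub>M (borel :: real measure))"
    by (intro sets_pair_measure_cong) simp_all
  have id: "(\<lambda>x::real. x) \<in> measurable (count_space UNIV) borel" by simp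
  have [measurable]: "(\<lambda>(\<epsilon>, \<xi>). \<epsilon> * sqrt \<xi>) \<in> borel_measurable (?P \<Otimes>\<^sub>M \<mu>)"
    unfolding measurable_cong_sets[OF sets refl] case_prod_beta
    by (intro borel_measurable_times measurable_compose[OF measurable_fst id]
        measurable_compose[OF measurable_snd borel_measurable_continuous_onI]) (intro continuous_intros)
  have "(\<integral>\<^sup>+y. g y \<partial>symmetrization \<mu>) = (\<integral>\<^sup>+p. g ((\<lambda>(\<epsilon>, \<xi>). \<epsilon> * sqrt \<xi>) p) \<partial>(?P \<Otimes>\<^sub>M \<mu>))"
    unfolding symmetrization_def by (rule nn_integral_distr) measurable
  also have "\<dots> = (\<integral>\<^sup>+\<epsilon>. \<integral>\<^sup>+x. g (\<epsilon> * sqrt x) \<partial>\<mu> \<partial>?P)"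
    unfolding case_prod_beta by (subst nn_integral_fst[symmetric]) simp_all
  also have "\<dots> = ((\<integral>\<^sup>+x. g (- sqrt x) \<partial>\<mu>) + (\<integral>\<^sup>+x. g (sqrt x) \<partial>\<mu>)) / 2"
    by (subst nn_integral_pmf_of_set) simp_all
  finally show ?thesis .
qed

lemma real_distribution_symmetrization: "real_distribution (symmetrization \<mu>)"
proof -
  have sets: "sets (symmetrization \<mu>) = sets borel" and space: "space (symmetrization \<mu>) = UNIV"
    by (simp_all add: symmetrization_def)
  have "emeasure (symmetrization \<mu>) UNIV = (\<integral>\<^sup>+y. 1 \<partial>symmetrization \<mu>)"
    using space by simp
  also have "\<dots> = (1 + 1) / 2"
    by (subst nn_integral_symmetrization) (simp_all add: emeasure_space_1[simplified])
  also have "\<dots> = (1 :: ennreal)"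
    by (simp add: ennreal_divide_self)
  finally have "prob_space (symmetrization \<mu>)"
    by (intro prob_spaceI) (simp add: space)
  then show ?thesis
    by (simp add: real_distribution_def real_distribution_axioms_def sets)
qed

lemma ennreal_half_add: "0 \<le> a \<Longrightarrow> 0 \<le> b \<Longrightarrow> (ennreal a + ennreal b) / 2 = ennreal ((a + b) / 2)"
  using divide_ennreal[of "a + b" 2] by (simp add: ennreal_plus)

lemma measure_symmetrization:
  assumes "A \<in> sets borel"
  shows "measure (symmetrization \<mu>) A = (measure \<mu> {x. - sqrt x \<in> A} + measure \<mu> {x. sqrt x \<in> A}) / 2"
proof -
  have [measurable]: "sqrt \<in> borel_measurable borel" "(\<lambda>x. - sqrt x) \<in> borel_measurable borel"
    by (intro borel_measurable_continuous_onI continuous_intros)+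
  have m: "{x. - sqrt x \<in> A} \<in> sets borel" "{x. sqrt x \<in> A} \<in> sets borel"
    using measurable_sets[of "\<lambda>x. - sqrt x" borel borel A] measurable_sets[of sqrt borel borel A] assms
    by (simp_all add: vimage_def)
  have "emeasure (symmetrization \<mu>) A = (\<integral>\<^sup>+y. indicator A y \<partial>symmetrization \<mu>)"
    using assms by (simp add: symmetrization_def)
  also have "\<dots> = ((\<integral>\<^sup>+x. indicator A (- sqrt x) \<partial>\<mu>) + (\<integral>\<^sup>+x. indicator A (sqrt x) \<partial>\<mu>)) / 2"
    by (rule nn_integral_symmetrization) (use assms in simp)
  also have "(\<integral>\<^sup>+x. indicator A (- sqrt x) \<partial>\<mu>) = emeasure \<mu> {x. - sqrt x \<in> A}"
    
  proof -
    have "(\<integral>\<^sup>+x. indicator A (- sqrt x) \<partial>\<mu>) = (\<integral>\<^sup>+x. indicator {x. - sqrt x \<in> A} x \<partial>\<mu>)"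
      by (rule nn_integral_cong) (simp add: indicator_def)
    then show ?thesis using m by (simp only: nn_integral_indicator events_eq_borel)
  qed
  also have "(\<integral>\<^sup>+x. indicator A (sqrt x) \<partial>\<mu>) = emeasure \<mu> {x. sqrt x \<in> A}"
    
  proof -
    have "(\<integral>\<^sup>+x. indicator A (sqrt x) \<partial>\<mu>) = (\<integral>\<^sup>+x. indicator {x. sqrt x \<in> A} x \<partial>\<mu>)"
      by (rule nn_integral_cong) (simp add: indicator_def)
    then show ?thesis using m by (simp only: nn_integral_indicator events_eq_borel)
  qed
  finally have "emeasure (symmetrization \<mu>) A
      = ennreal ((measure \<mu> {x. - sqrt x \<in> A} + measure \<mu> {x. sqrt x \<in> A}) / 2)"
    by (simp only: emeasure_eq_measure ennreal_half_add measure_nonneg)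
  then show ?thesis
    by (simp only: measure_def[of "symmetrization \<mu>"]) (rule enn2real_ennreal, simp)
qed

lemma AE_symmetrization:
  assumes "AE x in \<mu>. P (- sqrt x) \<and> P (sqrt x)" and [measurable]: "Measurable.pred borel P"
  shows "AE y in symmetrization \<mu>. P y"
proof -
  interpret S: real_distribution "symmetrization \<mu>" by (rule real_distribution_symmetrization)
  have A: "{y. \<not> P y} \<in> sets borel" by measurable
  have "measure \<mu> {x. - sqrt x \<in> {y. \<not> P y}} = 0" "measure \<mu> {x. sqrt x \<in> {y. \<not> P y}} = 0"
  proof -
    have [measurable]: "sqrt \<in> borel_measurable borel" "(\<lambda>x. - sqrt x) \<in> borel_measurable borel"
      by (intro borel_measurable_continuous_onI continuous_intros)+
    have "AE x in \<mu>. P (- sqrt x)" "AE x in \<mu>. P (sqrt x)" using assms(1) by auto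
    moreover have m: "{x \<in> space \<mu>. \<not> P (- sqrt x)} \<in> sets \<mu>" "{x \<in> space \<mu>. \<not> P (sqrt x)} \<in> sets \<mu>"
      by measurable
    ultimately have "emeasure \<mu> {x \<in> space \<mu>. \<not> P (- sqrt x)} = 0"
      "emeasure \<mu> {x \<in> space \<mu>. \<not> P (sqrt x)} = 0"
      by (simp_all only: AE_iff_measurable[OF m(1) refl] AE_iff_measurable[OF m(2) refl])
    then show "measure \<mu> {x. - sqrt x \<in> {y. \<not> P y}} = 0" "measure \<mu> {x. sqrt x \<in> {y. \<not> P y}} = 0"
      by (simp_all add: emeasure_eq_measure)
  qed
  then have "measure (symmetrization \<mu>) {y. \<not> P y} = 0"
    by (simp only: measure_symmetrization[OF A]) simp
  then have "emeasure (symmetrization \<mu>) {y. \<not> P y} = 0"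
    by (simp add: S.emeasure_eq_measure)
  then show ?thesis
    using A by (intro AE_iff_measurable[THEN iffD2, of "{y. \<not> P y}"]) auto
qed

end

lemma moment_symmetrization:
  assumes rd: "real_distribution \<mu>" and R: "R > 0" and supp: "AE x in \<mu>. 0 \<le> x \<and> x \<le> R"
  shows "AE y in symmetrization \<mu>. \<bar>y\<bar> \<le> sqrt R"
    and "moment (symmetrization \<mu>) n = (if even n then moment \<mu> (n div 2) else 0)"
proof -
  interpret real_distribution \<mu> by (rule rd)
  interpret S: real_distribution "symmetrization \<mu>" by (rule real_distribution_symmetrization[OF rd])
  have [measurable]: "sqrt \<in> borel_measurable borel" "(\<lambda>x. - sqrt x) \<in> borel_measurable borel"
    by (intro borel_measurable_continuous_onI continuous_intros)+
  show bdd: "AE y in symmetrization \<mu>. \<bar>y\<bar> \<le> sqrt R"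
    by (rule AE_symmetrization[OF rd]) (use supp in \<open>eventually_elim, simp\<close>, measurable)
  \<comment> \<open>Odd powers change sign on the support of the symmetrization. Adding the constant
    \<open>c\<close> makes the integrand nonnegative, so that
    \<open>nn_integral_symmetrization\<close> applies; it is subtracted again at the end.\<close>
  define c where "c = sqrt R ^ n"
  have c0: "c \<ge> 0" using R by (simp add: c_def)
  have pow_le: "\<bar>y ^ n\<bar> \<le> c" if "\<bar>y\<bar> \<le> sqrt R" for y
    using that by (simp add: c_def power_abs power_mono)
  have pow_ge: "0 \<le> y ^ n + c" if "\<bar>y\<bar> \<le> sqrt R" for y
    using pow_le[OF that] by (simp add: abs_le_iff)
  have bdd\<mu>: "AE x in \<mu>. \<bar>sqrt x\<bar> \<le> sqrt R" using supp by eventually_elim simp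
  have norm_le: "AE x in \<mu>. norm (sqrt x ^ n) \<le> c"
    using bdd\<mu> by eventually_elim (unfold real_norm_def, rule pow_le)
  have norm_le': "AE x in \<mu>. norm ((- sqrt x) ^ n) \<le> c"
    using bdd\<mu> by eventually_elim (unfold real_norm_def, rule pow_le, simp)
  have norm_leS: "AE y in symmetrization \<mu>. norm (y ^ n) \<le> c"
    using bdd by eventually_elim (unfold real_norm_def, rule pow_le)
  have int1: "integrable \<mu> (\<lambda>x. sqrt x ^ n)"
    by (rule integrable_const_bound[where B = c]) (use norm_le in simp_all)
  have int2: "integrable \<mu> (\<lambda>x. (- sqrt x) ^ n)"
    by (rule integrable_const_bound[where B = c]) (use norm_le' in simp_all)
  have intS: "integrable (symmetrization \<mu>) (\<lambda>y. y ^ n)"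
    by (rule S.integrable_const_bound[where B = c]) (use norm_leS in simp_all)
  have nonneg: "AE y in symmetrization \<mu>. 0 \<le> y ^ n + c"
    using bdd by eventually_elim (rule pow_ge)
  have nn1: "(\<integral>\<^sup>+x. ennreal (sqrt x ^ n + c) \<partial>\<mu>) = ennreal (expectation (\<lambda>x. sqrt x ^ n) + c)"
    and nn2: "(\<integral>\<^sup>+x. ennreal ((- sqrt x) ^ n + c) \<partial>\<mu>) = ennreal (expectation (\<lambda>x. (- sqrt x) ^ n) + c)"
    and ge: "0 \<le> expectation (\<lambda>x. sqrt x ^ n) + c" "0 \<le> expectation (\<lambda>x. (- sqrt x) ^ n) + c"
  proof -
    have a1: "AE x in \<mu>. 0 \<le> sqrt x ^ n + c"
      using bdd\<mu> by eventually_elim (rule pow_ge)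
    have a2: "AE x in \<mu>. 0 \<le> (- sqrt x) ^ n + c"
      using bdd\<mu> by eventually_elim (rule pow_ge, simp)
    have e1: "expectation (\<lambda>x. sqrt x ^ n + c) = expectation (\<lambda>x. sqrt x ^ n) + c"
      and e2: "expectation (\<lambda>x. (- sqrt x) ^ n + c) = expectation (\<lambda>x. (- sqrt x) ^ n) + c"
      using int1 int2 by (simp_all add: prob_space[simplified])
    show "(\<integral>\<^sup>+x. ennreal (sqrt x ^ n + c) \<partial>\<mu>) = ennreal (expectation (\<lambda>x. sqrt x ^ n) + c)"
      using int1 a1 by (subst nn_integral_eq_integral) (simp_all add: e1)
    show "(\<integral>\<^sup>+x. ennreal ((- sqrt x) ^ n + c) \<partial>\<mu>) = ennreal (expectation (\<lambda>x. (- sqrt x) ^ n) + c)"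
      using int2 a2 by (subst nn_integral_eq_integral) (simp_all add: e2)
    show "0 \<le> expectation (\<lambda>x. sqrt x ^ n) + c" "0 \<le> expectation (\<lambda>x. (- sqrt x) ^ n) + c"
      using integral_nonneg_AE[OF a1] integral_nonneg_AE[OF a2] by (simp_all only: e1 e2)
  qed
  have "ennreal (S.expectation (\<lambda>y. y ^ n) + c) = (\<integral>\<^sup>+y. ennreal (y ^ n + c) \<partial>symmetrization \<mu>)"
    using intS nonneg by (subst nn_integral_eq_integral) (simp_all add: S.prob_space[simplified])
  also have "\<dots> = ((\<integral>\<^sup>+x. ennreal ((- sqrt x) ^ n + c) \<partial>\<mu>) + (\<integral>\<^sup>+x. ennreal (sqrt x ^ n + c) \<partial>\<mu>)) / 2"
    by (rule nn_integral_symmetrization[OF rd]) measurable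
  also have "\<dots> = ennreal ((expectation (\<lambda>x. (- sqrt x) ^ n) + c + (expectation (\<lambda>x. sqrt x ^ n) + c)) / 2)"
    unfolding nn1 nn2 by (rule ennreal_half_add[OF rd ge(2,1)])
  finally have "S.expectation (\<lambda>y. y ^ n) + c = (expectation (\<lambda>x. (- sqrt x) ^ n) + c + (expectation (\<lambda>x. sqrt x ^ n) + c)) / 2"
  proof (rule ennreal_inj[THEN iffD1, rotated -1])
    have "0 \<le> S.expectation (\<lambda>y. y ^ n + c)" by (rule integral_nonneg_AE[OF nonneg])
    then show "0 \<le> S.expectation (\<lambda>y. y ^ n) + c" using intS by (simp add: S.prob_space[simplified])
  qed (use ge in simp)
  then have eq: "S.expectation (\<lambda>y. y ^ n) = (expectation (\<lambda>x. (- sqrt x) ^ n) + expectation (\<lambda>x. sqrt x ^ n)) / 2"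
    by (simp add: field_simps)
  show "moment (symmetrization \<mu>) n = (if even n then moment \<mu> (n div 2) else 0)"
  proof (cases "even n")
    case True
    then obtain k where k: "n = 2 * k" by (elim evenE)
    have "S.expectation (\<lambda>y. y ^ n) = expectation (\<lambda>x. sqrt x ^ n)"
      unfolding eq using True by simp
    also have "\<dots> = expectation (\<lambda>x. x ^ k)"
    proof (rule integral_cong_AE)
      show "AE x in \<mu>. sqrt x ^ n = x ^ k"
        using supp by eventually_elim (simp add: k power_mult)
    qed measurable
    finally show ?thesis by (simp add: moment_def k)
  next
    case False
    then show ?thesis by (simp add: moment_def eq)
  qed
qed

text \<open>Absence of atoms enters twice: at \<open>x = 0\<close> the value must be 1/2, which
  requires no mass at 0, and for \<open>x < 0\<close> the mass of \<open>{x\<^sup>2..}\<close> is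
  the complement of \<open>cdf \<mu> (x\<^sup>2)\<close> only if \<open>x\<^sup>2\<close> carries
  none.\<close>

lemma cdf_symmetrization:
  assumes rd: "real_distribution \<mu>" and supp: "AE x in \<mu>. 0 \<le> x" and no_atom: "\<And>a. measure \<mu> {a} = 0"
  shows "cdf (symmetrization \<mu>) x = 1 / 2 * (1 + sgn x * cdf \<mu> (x\<^sup>2))"
proof -
  interpret real_distribution \<mu> by (rule rd)
  have [measurable]: "sqrt \<in> borel_measurable borel" "(\<lambda>x. - sqrt x) \<in> borel_measurable borel"
    by (intro borel_measurable_continuous_onI continuous_intros)+
  have pos: "AE x in \<mu>. 0 < x"
  proof -
    have "emeasure \<mu> {0} = 0" using no_atom by (simp add: emeasure_eq_measure)
    then have "AE x in \<mu>. x \<noteq> 0" by (intro AE_iff_measurable[THEN iffD2, of "{0}"]) auto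
    with supp show ?thesis by eventually_elim simp
  qed
  have eqI: "measure \<mu> A = measure \<mu> B" if "A \<in> sets borel" "B \<in> sets borel" "\<And>y. 0 < y \<Longrightarrow> y \<in> A \<longleftrightarrow> y \<in> B" for A B
  proof (rule finite_measure_eq_AE)
    show "AE y in \<mu>. y \<in> A \<longleftrightarrow> y \<in> B" using pos by eventually_elim (rule that(3))
  qed (use that in simp_all)
  have m: "{y. - sqrt y \<le> x} \<in> sets borel" "{y. sqrt y \<le> x} \<in> sets borel" by measurable
  have c: "cdf (symmetrization \<mu>) x = (measure \<mu> {y. - sqrt y \<le> x} + measure \<mu> {y. sqrt y \<le> x}) / 2"
    unfolding cdf_def by (subst measure_symmetrization[OF rd]) simp_all
  have one: "measure \<mu> UNIV = 1" and zero: "measure \<mu> {} = 0" using prob_space by simp_all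
  show ?thesis
  proof (cases "x \<ge> 0")
    case True
    have "measure \<mu> {y. - sqrt y \<le> x} = measure \<mu> UNIV"
      using True m by (intro eqI) (auto intro: order.trans[of _ 0])
    moreover have "measure \<mu> {y. sqrt y \<le> x} = measure \<mu> {..x\<^sup>2}"
      
    proof (rule eqI)
      fix y :: real
      have "sqrt y \<le> sqrt (x\<^sup>2) \<longleftrightarrow> y \<le> x\<^sup>2" by (rule real_sqrt_le_iff)
      then show "y \<in> {y. sqrt y \<le> x} \<longleftrightarrow> y \<in> {..x\<^sup>2}" using True by simp
    qed (use m in auto)
    moreover have "cdf \<mu> 0 = 0"
    proof -
      have "measure \<mu> {..0} = measure \<mu> {}" by (intro eqI) auto
      then show ?thesis by (simp add: cdf_def)
    qed
    ultimately show ?thesis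
      using True c by (cases "x = 0") (simp_all add: one cdf_def sgn_if)
  next
    case False
    have "measure \<mu> {y. sqrt y \<le> x} = measure \<mu> {}"
      using False m by (intro eqI) (auto simp: not_le intro: less_le_trans[of _ 0])
    moreover have "measure \<mu> {y. - sqrt y \<le> x} = measure \<mu> {x\<^sup>2..}"
    proof (rule eqI)
      fix y :: real assume "0 < y"
      have "- sqrt y \<le> x \<longleftrightarrow> \<bar>x\<bar> \<le> sqrt y" using False by auto
      also have "\<dots> \<longleftrightarrow> x\<^sup>2 \<le> y"
        using real_sqrt_le_iff[of "x\<^sup>2" y] by simp
      finally show "y \<in> {y. - sqrt y \<le> x} \<longleftrightarrow> y \<in> {x\<^sup>2..}" by simp
    qed (use m in auto)
    moreover have "measure \<mu> {x\<^sup>2..} = 1 - cdf \<mu> (x\<^sup>2)"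
    proof -
      have "measure \<mu> {x\<^sup>2..} = measure \<mu> ({x\<^sup>2<..} \<union> {x\<^sup>2})"
        by (intro arg_cong[where f = "measure \<mu>"]) auto
      also have "\<dots> = measure \<mu> {x\<^sup>2<..}"
        by (subst finite_measure_Union) (simp_all add: no_atom)
      also have "\<dots> = measure \<mu> (space \<mu> - {..x\<^sup>2})"
        by (intro arg_cong[where f = "measure \<mu>"]) auto
      also have "\<dots> = 1 - cdf \<mu> (x\<^sup>2)"
        unfolding cdf_def by (rule prob_compl) simp
      finally show ?thesis .
    qed
    ultimately show ?thesis using False by (simp add: c[unfolded cdf_def] cdf_def zero sgn_if)
  qed
qed

section \<open>Generating functions and free cumulants\<close>

no_notation Matrix.vec_index (infixl "$" 100)
unbundle fps_syntax
text \<open>The weights in \<open>fm0_Suc\<close> and \<open>fm1_Suc\<close> depend on the parity of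
  \<open>j\<close>; splitting by parity turns the recursions into polynomial equations between power
  series.\<close>

definition even_part :: "(nat \<Rightarrow> real) \<Rightarrow> real fps" where
  "even_part f = Abs_fps (\<lambda>n. if even n then f n else 0)"
definition odd_part :: "(nat \<Rightarrow> real) \<Rightarrow> real fps" where
  "odd_part f = Abs_fps (\<lambda>n. if even n then 0 else f n)"

lemma fps_parity_recursion:
  assumes "f 0 = 1" "\<And>n. f (Suc n) = (\<Sum>j\<le>n. (if even j then a else b) * g j * f (n - j))"
  shows "even_part f = 1 + fps_X * (fps_const a * even_part g * odd_part f + fps_const b * odd_part g * even_part f)"
    and "odd_part f = fps_X * (fps_const a * even_part g * even_part f + fps_const b * odd_part g * odd_part f)"
proof -
  have nth: "(fps_const c * F * G) $ n = (\<Sum>j\<le>n. c * F $ j * G $ (n - j))" for c :: real and F G n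
    unfolding mult.assoc fps_mult_left_const_nth
    unfolding fps_mult_nth sum_distrib_left atLeast0AtMost ..
  have parity: "a * even_part g $ j * odd_part f $ (m - j) + b * odd_part g $ j * even_part f $ (m - j)
      = (if even (Suc m) then (if even j then a else b) * g j * f (m - j) else 0)"
    "a * even_part g $ j * even_part f $ (m - j) + b * odd_part g $ j * odd_part f $ (m - j)
      = (if even (Suc m) then 0 else (if even j then a else b) * g j * f (m - j))" if "j \<le> m" for j m
  proof -
    have "even (m - j) \<longleftrightarrow> (even m \<longleftrightarrow> even j)"
      using that by (simp add: even_diff_nat)
    then show "a * even_part g $ j * odd_part f $ (m - j) + b * odd_part g $ j * even_part f $ (m - j)
      = (if even (Suc m) then (if even j then a else b) * g j * f (m - j) else 0)"
      "a * even_part g $ j * even_part f $ (m - j) + b * odd_part g $ j * odd_part f $ (m - j)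
      = (if even (Suc m) then 0 else (if even j then a else b) * g j * f (m - j))"
      unfolding even_part_def odd_part_def fps_nth_Abs_fps
      by (cases "even j"; cases "even m"; simp)+
  qed
  have "(fps_const a * even_part g * odd_part f + fps_const b * odd_part g * even_part f) $ m
      = (if even (Suc m) then f (Suc m) else 0)" for m
  proof -
    have "(fps_const a * even_part g * odd_part f + fps_const b * odd_part g * even_part f) $ m
      = (\<Sum>j\<le>m. if even (Suc m) then (if even j then a else b) * g j * f (m - j) else 0)"
      by (simp only: fps_add_nth nth sum.distrib[symmetric]) (rule sum.cong[OF refl], rule parity, simp)
    then show ?thesis
      by (cases "even (Suc m)"; simp only: if_True if_False assms(2) sum.neutral_const)
  qed
  then have "even_part f $ n
      = (1 + fps_X * (fps_const a * even_part g * odd_part f + fps_const b * odd_part g * even_part f)) $ n" for n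
    by (cases n) (simp_all add: even_part_def assms(1))
  then show "even_part f = 1 + fps_X * (fps_const a * even_part g * odd_part f + fps_const b * odd_part g * even_part f)"
    by (rule fps_ext)
  have "(fps_const a * even_part g * even_part f + fps_const b * odd_part g * odd_part f) $ m
      = (if even (Suc m) then 0 else f (Suc m))" for m
  proof -
    have "(fps_const a * even_part g * even_part f + fps_const b * odd_part g * odd_part f) $ m
      = (\<Sum>j\<le>m. if even (Suc m) then 0 else (if even j then a else b) * g j * f (m - j))"
      by (simp only: fps_add_nth nth sum.distrib[symmetric]) (rule sum.cong[OF refl], rule parity, simp)
    then show ?thesis
      by (cases "even (Suc m)"; simp only: if_True if_False assms(2) sum.neutral_const)
  qed
  then have "odd_part f $ n
      = (fps_X * (fps_const a * even_part g * even_part f + fps_const b * odd_part g * odd_part f)) $ n" for n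
    by (cases n) (simp_all add: odd_part_def)
  then show "odd_part f = fps_X * (fps_const a * even_part g * even_part f + fps_const b * odd_part g * odd_part f)"
    by (rule fps_ext)
qed

text \<open>The generating function of the moments of \<open>G\<close>, whose odd moments vanish;
  its product with the variable is the Cauchy transform.\<close>

definition moment_fps :: "real \<Rightarrow> real fps" where
  "moment_fps \<rho> = even_part (fm0 \<rho>)"

text \<open>With \<open>g = (1 - r\<^sup>2) * s\<close>, the series \<open>b\<close> solves
  \<open>r * b\<^sup>2 - (1 - g) * b + r * s = 0\<close>, and the inverse of the moment series is
  \<open>1 - g - 2 * r * b\<close>. Up to sign this is the square root of the discriminant,
  \<open>(1 - g)\<^sup>2 - 4 * r\<^sup>2 * s = (1 + g)\<^sup>2 - 4 * s\<close>.\<close>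

lemma moment_fps_equation:
  fixes \<rho> :: real
  defines "S \<equiv> fps_X * moment_fps \<rho>"
  shows "(moment_fps \<rho>)\<^sup>2 * ((fps_const (\<rho>\<^sup>2 - 1) * S\<^sup>2 - 1)\<^sup>2 - 4 * S\<^sup>2) = 1"
proof -
  let ?Pe = "even_part (fm0 \<rho>)" and ?Po = "odd_part (fm0 \<rho>)"
    and ?Qe = "even_part (fm1 \<rho>)" and ?Qo = "odd_part (fm1 \<rho>)" and ?r = "fps_const \<rho>"
  note P = fps_parity_recursion[of "fm0 \<rho>", OF fm0_0 fm0_Suc]
  note Q = fps_parity_recursion[of "fm1 \<rho>", OF fm1_0 fm1_Suc]
  \<comment> \<open>The equations for the two even parts have the same right-hand side, and so one
    of four unknown series disappears.\<close>
  have QP: "?Qe = ?Pe"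
    by (rule trans[OF Q(1) trans[OF _ P(1)[symmetric]]]) (simp add: algebra_simps)
  have eqs: "?Pe = 1 + fps_X * ?Pe * (?r * ?Po + ?Qo)"
    "?Po = fps_X * (?r * ?Pe * ?Pe + ?Qo * ?Po)" "?Qo = fps_X * (?Pe * ?Pe + ?r * ?Po * ?Qo)"
  proof -
    show "?Pe = 1 + fps_X * ?Pe * (?r * ?Po + ?Qo)"
      by (rule trans[OF P(1)]) (simp add: QP algebra_simps)
    show "?Po = fps_X * (?r * ?Pe * ?Pe + ?Qo * ?Po)"
      by (rule trans[OF P(2)]) (simp add: QP algebra_simps)
    show "?Qo = fps_X * (?Pe * ?Pe + ?r * ?Po * ?Qo)"
      by (rule trans[OF Q(2)]) (simp add: QP algebra_simps)
  qed
  have key: "m\<^sup>2 * (((r\<^sup>2 - 1) * (x * m)\<^sup>2 - 1)\<^sup>2 - 4 * (x * m)\<^sup>2) = 1"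
    if "m = 1 + x * m * (r * p + q)" "p = x * (r * m * m + q * p)" "q = x * (m * m + r * p * q)"
    for m x r p q :: "real fps"
  proof -
    define b c s where "b = x * p" and "c = x * q" and "s = (x * m)\<^sup>2"
    let ?g = "(1 - r\<^sup>2) * s"
    have "b = x * (x * (r * m * m + q * p))" unfolding b_def by (rule arg_cong[OF that(2)])
    also have "\<dots> = r * s + b * c"
      by (simp add: b_def c_def s_def power2_eq_square algebra_simps)
    finally have b: "b = r * s + b * c" .
    have "c = x * (x * (m * m + r * p * q))" unfolding c_def by (rule arg_cong[OF that(3)])
    also have "\<dots> = s + r * (r * s + b * c) - r\<^sup>2 * s"
      by (simp add: b_def c_def s_def power2_eq_square algebra_simps)
    finally have c: "c = ?g + r * b"
      unfolding b[symmetric] by (simp add: algebra_simps)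
    have m: "m * (1 - r * b - c) = 1"
    proof -
      have "m' - t = 1" if "m' = 1 + t" for m' t :: "real fps" using that by simp
      from this[OF that(1)] show ?thesis
        by (simp add: b_def c_def algebra_simps)
    qed
    have "(r * s + b * (?g + r * b)) - r * s - b * ?g = r * b * b"
      by (simp add: algebra_simps)
    then have e: "b - r * s - b * ?g = r * b * b"
      unfolding b[unfolded c, symmetric] .
    \<comment> \<open>The last summand is 0 by \<open>e\<close>; with it, the equation is a
      polynomial identity in \<open>r\<close>, \<open>s\<close> and \<open>b\<close>.\<close>
    have "(1 - r * b - (?g + r * b))\<^sup>2 = ((r\<^sup>2 - 1) * s - 1)\<^sup>2 - 4 * s
        + 4 * r * (r * b * b - (b - r * s - b * ?g))"
      by (simp add: power2_eq_square algebra_simps)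
    then have "(1 - r * b - c)\<^sup>2 = ((r\<^sup>2 - 1) * s - 1)\<^sup>2 - 4 * s"
      unfolding e c by simp
    then have "m\<^sup>2 * (((r\<^sup>2 - 1) * s - 1)\<^sup>2 - 4 * s) = (m * (1 - r * b - c))\<^sup>2"
      by (simp add: power_mult_distrib)
    then show ?thesis by (simp add: m s_def)
  qed
  have "fps_const (\<rho>\<^sup>2 - 1) = ?r\<^sup>2 - 1"
    by (simp flip: fps_const_sub fps_const_power)
  with key[OF eqs] show ?thesis
    by (simp only: moment_fps_def S_def)
qed

section \<open>Narayana polynomials of type B and their generating function\<close>

definition narayana_B :: "real \<Rightarrow> nat \<Rightarrow> real" where
  "narayana_B u n = (\<Sum>k=0..n. (real (n choose k))\<^sup>2 * u ^ k)"

text \<open>The coefficient of \<open>u ^ (k + 2)\<close> in \<open>narayana_B_rec\<close>.\<close>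

lemma binomial_square_recurrence:
  fixes m k :: nat
  defines "c \<equiv> \<lambda>n k. (real (n choose k))\<^sup>2"
  shows "real (m + 2) * c (m + 2) (k + 2) = real (2 * m + 3) * (c (m + 1) (k + 2) + c (m + 1) (k + 1))
    - real (m + 1) * (c m (k + 2) - 2 * c m (k + 1) + c m k)"
proof -
  define A B C where "A = real (m choose k)" and "B = real (m choose (k + 1))" and "C = real (m choose (k + 2))"
  have absorb: "real (j + 1) * real (m choose (j + 1)) = (real m - real j) * real (m choose j)" for j
  proof (cases "j \<le> m")
    case True
    have "Suc j * (m choose Suc j) = (m - j) * (m choose j)"
      by (simp only: binomial_absorption binomial_absorb_comp)
    from arg_cong[OF this, of real] True show ?thesis
      by (simp only: of_nat_mult of_nat_diff Suc_eq_plus1)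
  qed (simp add: binomial_eq_0)
  have 1: "(real k + 1) * B = (real m - real k) * A" and 2: "(real k + 2) * C = (real m - real k - 1) * B"
    using absorb[of k] absorb[of "k + 1"] by (simp_all add: A_def B_def C_def algebra_simps)
  \<comment> \<open>Both absorption relations are linear in \<open>k\<close>. Eliminating
    \<open>k\<close> leaves the quadratic relation \<open>key\<close>, and by Pascal's rule the two
    sides of the recurrence differ by twice its left-hand side.\<close>
  have e1: "real k * (A + B) = real m * A - B" and e2: "real k * (B + C) = (real m - 1) * B - 2 * C"
    using 1 2 by (simp_all add: algebra_simps)
  have "(real m * A - B) * (B + C) = ((real m - 1) * B - 2 * C) * (A + B)"
    unfolding e1[symmetric] e2[symmetric] by (simp only: mult_ac)
  then have key: "A * B + (real m + 2) * A * C - real m * B\<^sup>2 + B * C = 0"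
    by (simp add: algebra_simps power2_eq_square)
  have pascal: "real ((m + 1) choose (k + 1)) = A + B" "real ((m + 1) choose (k + 2)) = B + C"
    "real ((m + 2) choose (k + 2)) = A + 2 * B + C"
    by (simp_all add: A_def B_def C_def numeral_2_eq_2)
  show ?thesis
    unfolding c_def pascal A_def[symmetric] B_def[symmetric] C_def[symmetric]
    using key by (simp add: algebra_simps power2_eq_square)
qed

text \<open>This is Bonnet's recursion for the Legendre polynomials \<open>P n\<close>: for
  \<open>u \<noteq> 1\<close>, \<open>narayana_B u n\<close> equals \<open>(1 - u) ^ n\<close> times
  the value of \<open>P n\<close> at \<open>(1 + u) / (1 - u)\<close>. Comparing coefficients in
  \<open>u\<close> treats all \<open>u\<close> at once.\<close>

lemma narayana_B_rec:
  "real (m + 2) * narayana_B u (m + 2) = real (2 * m + 3) * (1 + u) * narayana_B u (m + 1)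
     - real (m + 1) * (1 - u)\<^sup>2 * narayana_B u m"
proof -
  define P where "P = (\<lambda>n. \<Sum>k\<le>n. monom ((real (n choose k))\<^sup>2) k)"
  have coeff_P: "coeff (P n) k = (real (n choose k))\<^sup>2" for n k
  proof -
    have "coeff (P n) k = (\<Sum>i\<le>n. if i = k then (real (n choose k))\<^sup>2 else 0)"
      unfolding P_def coeff_sum by (intro sum.cong) auto
    then show ?thesis by (simp add: binomial_eq_0)
  qed
  have poly_P: "poly (P n) u = narayana_B u n" for n
    by (simp add: P_def narayana_B_def poly_sum poly_monom atLeast0AtMost)
  have "Polynomial.smult (real (m + 2)) (P (m + 2)) = Polynomial.smult (real (2 * m + 3)) ([:1, 1:] * P (m + 1))
      - Polynomial.smult (real (m + 1)) ([:1, -2, 1:] * P m)"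
  proof (rule poly_eqI)
    fix k
    let ?R = "Polynomial.smult (real (2 * m + 3)) ([:1, 1:] * P (m + 1))
      - Polynomial.smult (real (m + 1)) ([:1, -2, 1:] * P m)"
    show "coeff (Polynomial.smult (real (m + 2)) (P (m + 2))) k = coeff ?R k"
    proof (cases k)
      case 0
      then show ?thesis by (simp add: coeff_P)
    next
      case k: (Suc i)
      show ?thesis
      proof (cases i)
        case 0
        then show ?thesis by (simp add: k coeff_P power2_eq_square algebra_simps)
      next
        case (Suc j)
        have "coeff ?R k = real (2 * m + 3) * ((real (m + 1 choose (j + 2)))\<^sup>2 + (real (m + 1 choose (j + 1)))\<^sup>2)
          - real (m + 1) * ((real (m choose (j + 2)))\<^sup>2 - 2 * (real (m choose (j + 1)))\<^sup>2 + (real (m choose j))\<^sup>2)"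
          by (simp add: k Suc coeff_P del: binomial_Suc_Suc of_nat_Suc of_nat_add)
        then show ?thesis
          unfolding binomial_square_recurrence[symmetric] by (simp add: k Suc coeff_P del: binomial_Suc_Suc)
      qed
    qed
  qed
  from arg_cong[OF this, of "\<lambda>p. poly p u"] show ?thesis
    unfolding poly_smult poly_diff poly_mult poly_P by (simp add: power2_eq_square algebra_simps)
qed

text \<open>The three-term recurrence says that \<open>E\<close>, which is
  \<open>D * H' + D' * H / 2\<close> with primes for derivatives, vanishes. Hence
  \<open>D * H\<^sup>2\<close> has derivative \<open>2 * H * E = 0\<close> and equals its constant
  coefficient.\<close>

lemma narayana_B_gf:
  fixes u :: real
  defines "H \<equiv> Abs_fps (narayana_B u)"
  shows "(1 - fps_const (2 * (1 + u)) * fps_X + fps_const ((1 - u)\<^sup>2) * fps_X\<^sup>2) * H\<^sup>2 = 1"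
proof -
  define D where "D = 1 - fps_const (2 * (1 + u)) * fps_X + fps_const ((1 - u)\<^sup>2) * fps_X\<^sup>2"
  define E where "E = fps_deriv H - fps_const (2 * (1 + u)) * (fps_X * fps_deriv H)
    + fps_const ((1 - u)\<^sup>2) * (fps_X * (fps_X * fps_deriv H))
    + fps_const ((1 - u)\<^sup>2) * (fps_X * H) - fps_const (1 + u) * H"
  have XH: "(fps_X * fps_deriv H) $ m = real m * narayana_B u m" for m
    by (cases m) (simp_all add: H_def)
  have "E $ n = 0" for n
  proof (cases n)
    case 0
    then show ?thesis by (simp add: E_def H_def narayana_B_def)
  next
    case (Suc m)
    have "E $ n = real (m + 2) * narayana_B u (m + 2) - 2 * (1 + u) * (real (m + 1) * narayana_B u (m + 1))
      + (1 - u)\<^sup>2 * (real m * narayana_B u m) + (1 - u)\<^sup>2 * narayana_B u m - (1 + u) * narayana_B u (m + 1)"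
    proof -
      have "(fps_X * (fps_X * fps_deriv H)) $ Suc m = real m * narayana_B u m"
        unfolding fps_X_mult_nth[of "fps_X * _"] XH by simp
      moreover have "fps_deriv H $ Suc m = real (m + 2) * narayana_B u (m + 2)"
        by (simp add: H_def algebra_simps)
      moreover have "(fps_X * H) $ Suc m = narayana_B u m" "H $ Suc m = narayana_B u (m + 1)"
        by (simp_all add: H_def)
      ultimately show ?thesis
        unfolding E_def Suc fps_add_nth fps_sub_nth fps_mult_left_const_nth XH by simp
    qed
    then show ?thesis
      using narayana_B_rec[of m u] by (simp add: algebra_simps)
  qed
  then have E0: "E = 0" by (simp add: fps_eq_iff)
  have "fps_deriv (D * H\<^sup>2) = 2 * H * E"
  proof -
    have D': "fps_deriv D = 2 * (fps_const ((1 - u)\<^sup>2) * fps_X) - 2 * fps_const (1 + u)"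
      by (rule fps_ext) (simp add: D_def power2_eq_square fps_numeral_fps_const)
    have "2 * fps_const (1 + u) = fps_const (2 * (1 + u))"
      by (rule fps_ext) (simp add: fps_numeral_fps_const)
    then show ?thesis
      unfolding power2_eq_square fps_deriv_mult D' unfolding D_def E_def
      by (simp add: algebra_simps power2_eq_square)
  qed
  then have "fps_deriv (D * H\<^sup>2) = 0" by (simp add: E0)
  then have "D * H\<^sup>2 = fps_const ((D * H\<^sup>2) $ 0)"
    by (simp only: fps_deriv_eq_0_iff)
  also have "(D * H\<^sup>2) $ 0 = 1"
    by (simp add: D_def H_def narayana_B_def power2_eq_square)
  finally show ?thesis by (simp add: D_def)
qed

text \<open>Power series form an integral domain, so the constant coefficient alone decides between
  the two square roots.\<close>

lemma fps_square_eq_1: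
  fixes z :: "real fps"
  assumes "z\<^sup>2 = 1" "z $ 0 = 1"
  shows "z = 1"
proof -
  have "(z - 1) * (z + 1) = 0"
    using assms(1) by (simp add: power2_eq_square algebra_simps)
  moreover have "(z + 1) $ 0 \<noteq> 0" using assms(2) by simp
  then have "z + 1 \<noteq> 0" by (metis fps_zero_nth)
  ultimately show ?thesis by auto
qed

section \<open>The R-transform and its inversion\<close>

definition disc :: "real \<Rightarrow> real fps" where
  "disc \<rho> = (fps_const (\<rho>\<^sup>2 - 1) * fps_X\<^sup>2 - 1)\<^sup>2 - 4 * fps_X\<^sup>2"

lemma disc_compose:
  fixes S :: "real fps"
  assumes "S $ 0 = 0"
  shows "disc \<rho> oo S = (fps_const (\<rho>\<^sup>2 - 1) * S\<^sup>2 - 1)\<^sup>2 - 4 * S\<^sup>2"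
proof -
  have 4: "(4 :: real fps) = fps_const 4" by (simp add: fps_numeral_fps_const)
  show ?thesis
    unfolding disc_def 4
    by (simp add: fps_compose_sub_distrib fps_compose_mult_distrib[OF assms] assms
        flip: fps_compose_power[OF assms])
qed

lemma disc_nth_0: "disc \<rho> $ 0 = 1"
  by (simp add: disc_def power2_eq_square)

lemma disc_sqrt:
  defines "r \<equiv> \<lambda>\<rho>. fps_radical root 2 (disc \<rho>)"
  shows "(r \<rho>)\<^sup>2 = disc \<rho>" and "r \<rho> $ 0 = 1"
proof -
  note d0 = disc_nth_0[of \<rho>]
  have "(root (Suc 1) (disc \<rho> $ 0)) ^ Suc 1 = disc \<rho> $ 0"
    unfolding d0 by simp
  then have "fps_radical root (Suc 1) (disc \<rho>) ^ Suc 1 = disc \<rho>"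
    by (subst (asm) power_radical) (simp_all add: d0)
  then show "(r \<rho>)\<^sup>2 = disc \<rho>"
    by (simp add: r_def numeral_2_eq_2)
  show "r \<rho> $ 0 = 1"
    by (simp add: r_def d0)
qed

definition R_series :: "real \<Rightarrow> real fps" where
  "R_series \<rho> = (1 / fps_radical root 2 (disc \<rho>) - 1) / fps_X"

text \<open>Expanded, \<open>disc \<rho>\<close> is the quadratic polynomial of
  \<open>narayana_B_gf\<close> for \<open>u = \<rho>\<^sup>2\<close>, evaluated at the square of the
  variable. Both sides therefore have the same square, and both have constant coefficient 1.\<close>

lemma inverse_disc_sqrt:
  "1 / fps_radical root 2 (disc \<rho>) = Abs_fps (narayana_B (\<rho>\<^sup>2)) oo fps_X\<^sup>2"
  (is "1 / ?r = ?K")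
proof -
  let ?H = "Abs_fps (narayana_B (\<rho>\<^sup>2))"
  have X2: "(fps_X\<^sup>2 :: real fps) $ 0 = 0" by simp
  have "((1 - fps_const (2 * (1 + \<rho>\<^sup>2)) * fps_X + fps_const ((1 - \<rho>\<^sup>2)\<^sup>2) * fps_X\<^sup>2) * ?H\<^sup>2) oo fps_X\<^sup>2 = 1 oo fps_X\<^sup>2"
    by (simp only: narayana_B_gf)
  then have "(1 - fps_const (2 * (1 + \<rho>\<^sup>2)) * fps_X\<^sup>2 + fps_const ((1 - \<rho>\<^sup>2)\<^sup>2) * (fps_X\<^sup>2)\<^sup>2) * ?K\<^sup>2 = 1"
    by (simp add: fps_compose_mult_distrib[OF X2] fps_compose_add_distrib fps_compose_sub_distrib
        fps_compose_power[OF X2, symmetric])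
  moreover have "disc \<rho> = 1 - fps_const (2 * (1 + \<rho>\<^sup>2)) * fps_X\<^sup>2 + fps_const ((1 - \<rho>\<^sup>2)\<^sup>2) * (fps_X\<^sup>2)\<^sup>2"
  proof -
    have *: "(c * Y - 1)\<^sup>2 - 4 * Y = 1 - (2 * c + 4) * Y + c\<^sup>2 * Y\<^sup>2" for c Y :: "real fps"
      by (simp add: power2_eq_square algebra_simps)
    have "2 * fps_const (\<rho>\<^sup>2 - 1) + 4 = fps_const (2 * (1 + \<rho>\<^sup>2))"
      by (simp add: fps_numeral_fps_const algebra_simps)
    moreover have "(fps_const (\<rho>\<^sup>2 - 1))\<^sup>2 = fps_const ((1 - \<rho>\<^sup>2)\<^sup>2)"
      by (simp add: fps_const_power power2_commute)
    ultimately show ?thesis unfolding disc_def * by simp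
  qed
  ultimately have "disc \<rho> * ?K\<^sup>2 = 1"
    by (simp only:)
  then have "(?r * ?K)\<^sup>2 = 1"
    by (simp only: power_mult_distrib disc_sqrt(1))
  then have rK: "?r * ?K = 1"
    by (rule fps_square_eq_1) (simp add: disc_nth_0 narayana_B_def fps_compose_def)
  have "?r $ 0 \<noteq> 0" by (simp add: disc_nth_0)
  then have "1 / ?r = inverse ?r" by (simp add: fps_divide_unit)
  also have "\<dots> = ?K" using rK by (rule fps_inverse_unique)
  finally show ?thesis .
qed

text \<open>The division in \<open>R_series\<close> is exact: the constant coefficient of the
  numerator is \<open>narayana_B (\<rho>\<^sup>2) 0 - 1 = 0\<close>.\<close>

lemma R_series_eq: "fps_X * R_series \<rho> = (Abs_fps (narayana_B (\<rho>\<^sup>2)) oo fps_X\<^sup>2) - 1"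
proof -
  let ?K = "Abs_fps (narayana_B (\<rho>\<^sup>2)) oo fps_X\<^sup>2"
  have "(?K - 1) $ 0 = 0" by (simp add: narayana_B_def fps_compose_def)
  then have K: "?K - 1 = fps_X * fps_shift 1 (?K - 1)"
    by (intro fps_ext) auto
  have "R_series \<rho> = fps_X * fps_shift 1 (?K - 1) / fps_X"
    unfolding R_series_def inverse_disc_sqrt by (subst K) simp
  also have "\<dots> = fps_shift 1 (?K - 1)"
    by (rule nonzero_mult_div_cancel_left) simp
  finally show ?thesis by (simp only: K[symmetric])
qed

text \<open>Odd \<open>n\<close> carry the even cumulants, because the coefficient of index
  \<open>n\<close> is the cumulant of order \<open>n + 1\<close>.\<close>

lemma R_series_nth:
  "R_series \<rho> $ n = (if odd n then narayana_B (\<rho>\<^sup>2) (Suc n div 2) else 0)"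
proof -
  have "R_series \<rho> $ n = (fps_X * R_series \<rho>) $ Suc n" by simp
  also have "\<dots> = (if odd n then narayana_B (\<rho>\<^sup>2) (Suc n div 2) else 0)"
    unfolding R_series_eq by (simp add: fps_nth_compose_X_power)
  finally show ?thesis .
qed

text \<open>By the moment equation the root of \<open>disc \<rho>\<close> composed with
  \<open>S\<close> is the inverse of the moment series. Substituting \<open>S\<close> into the
  formula for \<open>R_series\<close> gives
  \<open>S * (R_series \<rho> oo S) = moment_fps \<rho> - 1\<close>, which is the defining relation
  of the R-transform multiplied by \<open>S\<close>.\<close>

lemma R_transform_eq:
  assumes "real_distribution \<mu>" and "\<And>n. moment \<mu> n = (if even n then fm0 \<rho> n else 0)"
  shows "R_transform \<mu> = R_series \<rho>"
proof -
  let ?m = "moment_fps \<rho>"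
  define S where "S = fps_X * ?m"
  have S: "cauchy_transform \<mu> = S"
  proof (rule fps_ext)
    fix n show "cauchy_transform \<mu> $ n = S $ n"
      by (cases n) (auto simp: cauchy_transform_def S_def moment_fps_def even_part_def assms(2))
  qed
  have S0: "S $ 0 = 0" by (simp add: S_def)
  have m0: "?m $ 0 = 1" by (simp add: moment_fps_def even_part_def)
  let ?r = "fps_radical root 2 (disc \<rho>)"
  have "((?r oo S) * ?m)\<^sup>2 = (disc \<rho> oo S) * ?m\<^sup>2"
    by (simp add: power_mult_distrib fps_compose_power[OF S0] disc_sqrt)
  also have "\<dots> = 1"
    using moment_fps_equation[of \<rho>] unfolding disc_compose[OF S0] by (simp add: S_def mult.commute)
  finally have rm: "(?r oo S) * ?m = 1"
    by (rule fps_square_eq_1) (simp add: m0 disc_nth_0 fps_compose_def)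
  have "fps_X * R_series \<rho> = 1 / ?r - 1"
    by (simp only: R_series_eq inverse_disc_sqrt)
  then have "(fps_X * R_series \<rho>) * ?r = 1 - ?r"
    using disc_sqrt(2)[of \<rho>] by (simp add: left_diff_distrib fps_divide_unit inverse_mult_eq_1)
  then have "((fps_X * R_series \<rho>) * ?r) oo S = (1 - ?r) oo S" by simp
  then have "S * (R_series \<rho> oo S) * (?r oo S) = 1 - (?r oo S)"
    by (simp add: fps_compose_mult_distrib[OF S0] fps_compose_sub_distrib S0)
  then have "S * (R_series \<rho> oo S) * ((?r oo S) * ?m) = ?m - (?r oo S) * ?m"
    by (simp add: left_diff_distrib mult.assoc[symmetric])
  then have SR: "S * (R_series \<rho> oo S) = ?m - 1"
    by (simp add: rm)
  have fls: "t + inverse s = inverse x" if "s = x * m" "s * t = m - 1" "x \<noteq> 0" "m \<noteq> 0" for s t x m :: "real fls"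
  proof -
    have "s \<noteq> 0" using that by simp
    then have "s * (t + inverse s) = m" using that(2) by (simp add: distrib_left)
    then have "x * (t + inverse s) = 1" using that by (simp add: mult.assoc mult.left_commute)
    then show ?thesis using inverse_unique by metis
  qed
  have "is_R_transform \<mu> (R_series \<rho>)"
    unfolding is_R_transform_def S fls_inverse_X[symmetric]
  proof (rule fls)
    show "fps_to_fls S = fls_X * fps_to_fls ?m"
      by (simp add: S_def fls_times_fps_to_fls)
    show "fps_to_fls S * fps_to_fls (R_series \<rho> oo S) = fps_to_fls ?m - 1"
      by (simp flip: fls_times_fps_to_fls add: SR)
    show "fps_to_fls ?m \<noteq> 0" using m0 by auto
  qed simp
  then show ?thesis
    unfolding R_transform_def using R_transform_exists_unique[OF assms(1)] by (metis the1_equality)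
qed

text \<open>Multiplied by \<open>fps_X * S\<close>, the defining relation reads
  \<open>fps_X * (1 + S * (R oo S)) = S\<close>, so that \<open>fps_X / (1 + fps_X * R)\<close> is a
  compositional inverse of \<open>S\<close>. Hence free cumulants determine moments.\<close>

lemma cauchy_transform_eq_fps_inv:
  assumes "real_distribution \<mu>"
  shows "cauchy_transform \<mu> = fps_inv (fps_X * inverse (1 + fps_X * R_transform \<mu>))"
proof -
  interpret real_distribution \<mu> by fact
  define S where "S = cauchy_transform \<mu>"
  define R where "R = R_transform \<mu>"
  define K where "K = 1 + fps_X * R"
  define L where "L = fps_X * inverse K"
  have S0: "S $ 0 = 0" and S1: "S $ 1 = 1"
    by (simp_all add: S_def cauchy_transform_def moment_def prob_space[simplified])
  have K0: "K $ 0 = 1" by (simp add: K_def)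
  have "is_R_transform \<mu> R"
    unfolding R_def R_transform_def by (rule theI'[OF R_transform_exists_unique[OF assms]])
  then have "fps_to_fls (R oo S) + inverse (fps_to_fls S) = inverse fls_X"
    by (simp add: is_R_transform_def S_def fls_inverse_X)
  moreover have "x * (s * t + 1) = s" if "t + inverse s = inverse x" "s \<noteq> 0" "x \<noteq> 0" for s t x :: "real fls"
  proof -
    have "x * (s * (t + inverse s)) = x * (s * inverse x)" by (simp only: that)
    moreover have "s * (t + inverse s) = s * t + 1" "x * (s * inverse x) = s"
      using that(2,3) by (simp_all add: distrib_left mult.left_commute[of x s])
    ultimately show ?thesis by (simp only:)
  qed
  moreover have "fps_to_fls S \<noteq> 0" using S1 by auto
  ultimately have "fls_X * (fps_to_fls S * fps_to_fls (R oo S) + 1) = fps_to_fls S"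
    by simp
  then have "fps_to_fls (fps_X * (S * (R oo S) + 1)) = fps_to_fls S"
    by (simp add: fls_times_fps_to_fls)
  then have "fps_X * (S * (R oo S) + 1) = S"
    by (simp only: fps_to_fls_eq_iff)
  then have KS: "fps_X * (K oo S) = S"
    by (simp add: K_def fps_compose_add_distrib fps_compose_mult_distrib[OF S0] S0 add.commute)
  have KS0: "(K oo S) $ 0 \<noteq> 0" by (simp add: fps_compose_def K0)
  have "L oo S = S * inverse (K oo S)"
    using K0 by (simp add: L_def fps_compose_mult_distrib[OF S0] fps_inverse_compose[OF S0] S0)
  also have "\<dots> = fps_X * ((K oo S) * inverse (K oo S))"
    by (subst (1) KS[symmetric]) (simp only: mult.assoc)
  also have "\<dots> = fps_X" by (simp only: inverse_mult_eq_1'[OF KS0] mult_1_right)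
  finally have LS: "L oo S = fps_X" .
  have L: "L $ 0 = 0" "L $ 1 \<noteq> 0" by (simp_all add: L_def K0)
  have "S = (fps_inv L oo L) oo S" by (simp add: fps_inv[OF L] S0)
  also have "\<dots> = fps_inv L oo (L oo S)" by (rule fps_compose_assoc[OF S0 L(1), symmetric])
  also have "\<dots> = fps_inv L" by (simp add: LS)
  finally show ?thesis by (simp only: S_def L_def K_def R_def)
qed

lemma distribution_eq_of_free_cumulants:
  assumes "compactly_supported \<mu>" "compactly_supported \<nu>"
    and eq: "\<And>n. n \<ge> 1 \<Longrightarrow> free_cumulant \<mu> n = free_cumulant \<nu> n"
  shows "\<mu> = \<nu>"
proof -
  have rd: "real_distribution \<mu>" "real_distribution \<nu>"
    using assms by (auto simp: compactly_supported_def)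
  have bdd: "\<exists>R. AE x in m. \<bar>x\<bar> \<le> R" if m: "compactly_supported m" for m :: "real measure"
  proof -
    obtain K where K: "compact K" "AE x in m. x \<in> K" using m by (auto simp: compactly_supported_def)
    obtain R where R: "\<And>x. x \<in> K \<Longrightarrow> \<bar>x\<bar> \<le> R"
      using compact_imp_bounded[OF K(1)] by (auto simp: bounded_real)
    have "AE x in m. \<bar>x\<bar> \<le> R" using K(2) by eventually_elim (rule R)
    then show ?thesis ..
  qed
  obtain R R' where R: "AE x in \<mu>. \<bar>x\<bar> \<le> R" "AE x in \<nu>. \<bar>x\<bar> \<le> R'" using bdd[OF assms(1)] bdd[OF assms(2)] by blast
  have "R_transform \<mu> = R_transform \<nu>"
  proof (rule fps_ext)
    fix n show "R_transform \<mu> $ n = R_transform \<nu> $ n"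
      using eq[of "Suc n"] by (simp add: free_cumulant_def)
  qed
  then have "cauchy_transform \<mu> = cauchy_transform \<nu>"
    by (simp only: cauchy_transform_eq_fps_inv rd)
  then have "cauchy_transform \<mu> $ Suc k = cauchy_transform \<nu> $ Suc k" for k by simp
  then have "(\<integral>x. x ^ k \<partial>\<mu>) = (\<integral>x. x ^ k \<partial>\<nu>)" for k
    by (simp add: cauchy_transform_def moment_def)
  then show ?thesis
    by (rule bounded_moments_determine[OF rd R])
qed

section \<open>Absence of atoms\<close>

text \<open>Comparison with the geometric series of \<open>fm_bound\<close>. A positive radius is
  what starts the analytic continuation; 1/8 stays safely inside the 1/4 that the bound
  gives.\<close>

lemma moment_fps_conv_radius:
  assumes "\<bar>\<rho>\<bar> \<le> 1"
  shows "fps_conv_radius (moment_fps \<rho>) \<ge> ereal (1 / 8)"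
  unfolding fps_conv_radius_def
proof (rule conv_radius_geI_ex)
  fix r :: real assume r: "0 < r" "ereal r < ereal (1 / 8)"
  have "summable (\<lambda>n. fps_nth (moment_fps \<rho>) n * r ^ n)"
  proof (rule summable_comparison_test')
    show "summable (\<lambda>n. 2 * (4 * r) ^ n)"
      using r by (intro summable_mult summable_geometric) simp
    fix n :: nat
    have "\<bar>fps_nth (moment_fps \<rho>) n\<bar> \<le> 2 * 4 ^ n"
      using fm_bound[OF assms, of n] by (simp add: moment_fps_def even_part_def)
    from mult_right_mono[OF this, of "r ^ n"] r
    show "norm (fps_nth (moment_fps \<rho>) n * r ^ n) \<le> 2 * (4 * r) ^ n"
      by (simp add: abs_mult power_mult_distrib mult.assoc)
  qed
  then show "\<exists>z. norm z = r \<and> summable (\<lambda>n. fps_nth (moment_fps \<rho>) n * z ^ n)"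
    using r by (intro exI[of _ r]) simp
qed

lemma eval_moment_fps_equation:
  fixes y :: real
  assumes "\<bar>\<rho>\<bar> \<le> 1" "\<bar>y\<bar> < 1 / 8"
  defines "m \<equiv> eval_fps (moment_fps \<rho>) y"
  shows "m\<^sup>2 * (((\<rho>\<^sup>2 - 1) * (y * m)\<^sup>2 - 1)\<^sup>2 - 4 * (y * m)\<^sup>2) = 1"
proof -
  \<comment> \<open>Evaluation is multiplicative only inside the discs of convergence, so
    convergence is propagated together with the values.\<close>
  define ok where "ok = (\<lambda>F :: real fps. ereal (norm y) < fps_conv_radius F)"
  have mult: "ok F \<Longrightarrow> ok G \<Longrightarrow> ok (F * G) \<and> eval_fps (F * G) y = eval_fps F y * eval_fps G y" for F G
    unfolding ok_def by (auto simp: eval_fps_mult intro!: less_le_trans[OF _ fps_conv_radius_mult])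
  have diff: "ok F \<Longrightarrow> ok G \<Longrightarrow> ok (F - G) \<and> eval_fps (F - G) y = eval_fps F y - eval_fps G y" for F G
    unfolding ok_def by (auto simp: eval_fps_diff intro!: less_le_trans[OF _ fps_conv_radius_diff])
  have const: "ok (fps_const c)" "ok fps_X" "ok 1" "ok (numeral v)" for c v
    unfolding ok_def by simp_all
  have m: "ok (moment_fps \<rho>)"
    unfolding ok_def using assms(2) by (intro less_le_trans[OF _ moment_fps_conv_radius[OF assms(1)]]) simp
  let ?m = "moment_fps \<rho>"
  let ?S = "fps_X * ?m"
  note S = mult[OF const(2) m]
  note SS = mult[OF conjunct1[OF S] conjunct1[OF S]]
  note a = diff[OF conjunct1[OF mult[OF const(1)[of "\<rho>\<^sup>2 - 1"] conjunct1[OF SS]]] const(3)]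
  note aa = mult[OF conjunct1[OF a] conjunct1[OF a]]
  note d = diff[OF conjunct1[OF aa] conjunct1[OF mult[OF const(4)[of "num.Bit0 (num.Bit0 num.One)"] conjunct1[OF SS]]]]
  note e = mult[OF conjunct1[OF mult[OF m m]] conjunct1[OF d]]
  have "eval_fps (?m * ?m * ((fps_const (\<rho>\<^sup>2 - 1) * (?S * ?S) - 1) * (fps_const (\<rho>\<^sup>2 - 1) * (?S * ?S) - 1)
      - 4 * (?S * ?S))) y = eval_fps 1 y"
    using moment_fps_equation[of \<rho>] by (simp only: power2_eq_square)
  then show ?thesis
    by (simp only: e d aa a S SS mult[OF m m] mult[OF const(1) conjunct1[OF SS]] mult[OF const(4) conjunct1[OF SS]])
       (simp add: m_def power2_eq_square)
qed

section \<open>The moment generating function on the slit plane\<close>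

locale bounded_distribution = real_distribution M for M +
  fixes R :: real
  assumes R_pos: "R > 0" and support: "AE x in M. 0 \<le> x \<and> x \<le> R"
begin

text \<open>Exactly those \<open>t\<close> for which \<open>1 - t * x\<close> has no zero
  \<open>x\<close> in \<open>[0, R]\<close>.\<close>

definition slit_plane :: "complex set" where
  "slit_plane = {t. \<not> (Im t = 0 \<and> 1 / R \<le> Re t)}"

text \<open>Near 0 this is the power series with the moments as coefficients; the integral continues
  it to the slit plane. At \<open>t = 1 / z\<close> it is \<open>z\<close> times the Cauchy
  transform of the law.\<close>

definition moment_gf :: "complex \<Rightarrow> complex" where
  "moment_gf t = (\<integral>x. 1 / (1 - t * of_real x) \<partial>M)"

lemma open_slit_plane: "open slit_plane"
proof -
  have "slit_plane = {t. Im t \<noteq> 0} \<union> {t. Re t < 1 / R}"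
    by (auto simp: slit_plane_def)
  moreover have "open {t. Im t \<noteq> 0}" "open {t. Re t < 1 / R}"
    by (intro open_Collect_neq open_Collect_less continuous_intros)+
  ultimately show ?thesis by auto
qed

lemma zero_in_slit_plane: "0 \<in> slit_plane"
  using R_pos by (simp add: slit_plane_def)

lemma connected_slit_plane: "connected slit_plane"
proof (rule starlike_imp_connected)
  show "starlike slit_plane"
    unfolding starlike_def
  proof (intro bexI[of _ 0] ballI subsetI zero_in_slit_plane)
    fix t z assume t: "t \<in> slit_plane" and "z \<in> closed_segment 0 t"
    then obtain u where u: "0 \<le> u" "u \<le> 1" "z = of_real u * t"
      by (auto simp: in_segment scaleR_conv_of_real)
    show "z \<in> slit_plane"
    proof (rule ccontr)
      assume "z \<notin> slit_plane"
      then have *: "u * Im t = 0" "1 / R \<le> u * Re t" by (auto simp: slit_plane_def u(3))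
      have "u * Re t > 0" using * R_pos by (meson less_le_trans zero_less_divide_1_iff)
      then have "u > 0" "Re t > 0" using u(1) by (auto simp: zero_less_mult_iff)
      then have "u * Re t \<le> 1 * Re t" using u(2) by (intro mult_right_mono) auto
      with * \<open>u > 0\<close> have "Im t = 0" "1 / R \<le> Re t" by auto
      with t show False by (simp add: slit_plane_def)
    qed
  qed
qed

text \<open>Compactness of \<open>[0, R]\<close> bounds the denominator away from 0 at
  \<open>t0\<close>, hence also nearby; this provides the majorants for dominated
  convergence.\<close>

lemma slit_plane_bound:
  assumes "t0 \<in> slit_plane"
  obtains c \<delta> where "c > 0" "\<delta> > 0"
    "\<And>t x. dist t t0 < \<delta> \<Longrightarrow> 0 \<le> x \<Longrightarrow> x \<le> R \<Longrightarrow> c \<le> norm (1 - t * of_real x)"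
proof -
  have nz: "1 - t0 * of_real x \<noteq> 0" if x: "0 \<le> x" "x \<le> R" for x
  proof
    assume "1 - t0 * of_real x = 0"
    then have eq: "t0 * of_real x = 1" by simp
    then have "x \<noteq> 0" by auto
    with eq x have "x > 0" "t0 = of_real (1 / x)" by (auto simp: field_simps)
    then have "Im t0 = 0" "1 / R \<le> Re t0" using x by (auto simp: frac_le)
    with assms show False by (simp add: slit_plane_def)
  qed
  have "\<exists>x\<in>{0..R}. \<forall>y\<in>{0..R}. norm (1 - t0 * of_real x) \<le> norm (1 - t0 * of_real y)"
    by (rule continuous_attains_inf) (use R_pos in \<open>auto intro!: continuous_intros\<close>)
  then obtain x0 where x0: "x0 \<in> {0..R}"
    "\<And>y. y \<in> {0..R} \<Longrightarrow> norm (1 - t0 * of_real x0) \<le> norm (1 - t0 * of_real y)"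
    by blast
  define c where "c = norm (1 - t0 * of_real x0) / 2"
  have c: "c > 0" using nz[of x0] x0(1) by (simp add: c_def)
  show ?thesis
  \<comment> \<open>The minimum at \<open>t0\<close> is \<open>2 * c\<close>, and moving
    \<open>t\<close> by less than \<open>c / R\<close> changes \<open>t * x\<close> by at most
    \<open>c\<close>.\<close>
  proof (rule that[of c "c / R"])
    fix t x assume t: "dist t t0 < c / R" and x: "0 \<le> x" "x \<le> R"
    have "norm ((t - t0) * of_real x) \<le> (c / R) * R"
      unfolding norm_mult using t x c R_pos by (intro mult_mono) (auto simp: dist_norm)
    then have "norm ((t - t0) * of_real x) \<le> c" using R_pos by simp
    moreover have "2 * c \<le> norm (1 - t0 * of_real x)"
      using x0(2)[of x] x by (simp add: c_def)
    moreover have eq: "1 - t * of_real x = (1 - t0 * of_real x) - (t - t0) * of_real x"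
      by (simp add: algebra_simps)
    ultimately show "c \<le> norm (1 - t * of_real x)"
      unfolding eq using norm_triangle_ineq2[of "1 - t0 * of_real x" "(t - t0) * of_real x"] by linarith
  qed (use c R_pos in auto)
qed

lemma moment_gf_integrable:
  assumes "t \<in> slit_plane"
  shows "integrable M (\<lambda>x. 1 / (1 - t * of_real x))"
proof -
  obtain c \<delta> where c: "c > 0" "\<delta> > 0"
    "\<And>s x. dist s t < \<delta> \<Longrightarrow> 0 \<le> x \<Longrightarrow> x \<le> R \<Longrightarrow> c \<le> norm (1 - s * of_real x)"
    by (rule slit_plane_bound[OF assms]) blast
  show ?thesis
  proof (rule integrable_const_bound[where B = "1 / c"])
    show "AE x in M. norm (1 / (1 - t * of_real x)) \<le> 1 / c"
      using support
    proof eventually_elim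
      case (elim x)
      then have "c \<le> norm (1 - t * of_real x)" using c(2) by (intro c(3)) auto
      then show ?case using c(1) by (simp add: norm_divide frac_le)
    qed
  qed measurable
qed

lemma moment_gf_has_derivative:
  assumes t0: "t0 \<in> slit_plane"
  shows "(moment_gf has_field_derivative (\<integral>x. of_real x / (1 - t0 * of_real x)\<^sup>2 \<partial>M)) (at t0)"
  unfolding has_field_derivative_iff tendsto_at_iff_sequentially
proof (intro allI impI)
  fix y :: "nat \<Rightarrow> complex"
  assume ne: "\<forall>i. y i \<in> UNIV - {t0}" and lim: "y \<longlonglongrightarrow> t0"
  obtain c \<delta> where c: "c > 0" "\<delta> > 0"
    and le: "\<And>s x. dist s t0 < \<delta> \<Longrightarrow> 0 \<le> x \<Longrightarrow> x \<le> R \<Longrightarrow> c \<le> norm (1 - s * of_real x)"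
    by (rule slit_plane_bound[OF t0]) blast
  have "eventually (\<lambda>n. dist (y n) t0 < \<delta> \<and> y n \<in> slit_plane) sequentially"
    using tendstoD[OF lim c(2)] topological_tendstoD[OF lim open_slit_plane t0]
    by eventually_elim simp
  then obtain n0 where n0: "\<And>n. n \<ge> n0 \<Longrightarrow> dist (y n) t0 < \<delta> \<and> y n \<in> slit_plane"
    by (auto simp: eventually_sequentially)
  \<comment> \<open>The difference quotient of \<open>1 / (1 - t * x)\<close> in closed form,
    bounded by \<open>R / (c * c)\<close> near \<open>t0\<close>.\<close>
  let ?f = "\<lambda>n x. of_real x / ((1 - y n * of_real x) * (1 - t0 * of_real x)) :: complex"
  have quot: "(moment_gf (y n) - moment_gf t0) / (y n - t0) = (\<integral>x. ?f n x \<partial>M)" if n: "n \<ge> n0" for n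
  proof -
    have "moment_gf (y n) - moment_gf t0 = (\<integral>x. 1 / (1 - y n * of_real x) - 1 / (1 - t0 * of_real x) \<partial>M)"
      unfolding moment_gf_def using n0[OF n] t0 by (simp add: moment_gf_integrable)
    also have "\<dots> = (\<integral>x. (y n - t0) * ?f n x \<partial>M)"
    proof (rule integral_cong_AE)
      show "AE x in M. 1 / (1 - y n * of_real x) - 1 / (1 - t0 * of_real x) = (y n - t0) * ?f n x"
        using support
      proof eventually_elim
        case (elim x)
        have "1 - y n * of_real x \<noteq> 0" "1 - t0 * of_real x \<noteq> 0"
          using le[of "y n" x] le[of t0 x] n0[OF n] elim c by auto
        then show ?case by (simp add: field_simps)
      qed
    qed measurable
    also have "\<dots> = (y n - t0) * (\<integral>x. ?f n x \<partial>M)" by (rule integral_mult_right_zero)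
    finally show ?thesis using ne by simp
  qed
  have "(\<lambda>n. \<integral>x. ?f (n + n0) x \<partial>M) \<longlonglongrightarrow> (\<integral>x. of_real x / (1 - t0 * of_real x)\<^sup>2 \<partial>M)"
  proof (rule integral_dominated_convergence[where w = "\<lambda>_. R / (c * c)"])
    show "AE x in M. (\<lambda>n. ?f (n + n0) x) \<longlonglongrightarrow> of_real x / (1 - t0 * of_real x)\<^sup>2"
      using support
    proof eventually_elim
      case (elim x)
      have nz: "1 - t0 * of_real x \<noteq> 0" using le[of t0 x] elim c by auto
      show ?case
        unfolding power2_eq_square
        by (intro tendsto_intros LIMSEQ_ignore_initial_segment[OF lim]) (use nz in auto)
    qed
    show "AE x in M. norm (?f (n + n0) x) \<le> R / (c * c)" for n
      using support
    proof eventually_elim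
      case (elim x)
      have "c \<le> norm (1 - y (n + n0) * of_real x)" "c \<le> norm (1 - t0 * of_real x)"
        using le[of "y (n + n0)" x] le[of t0 x] n0[of "n + n0"] elim c by auto
      then show ?case
        unfolding norm_divide norm_mult using elim c
        by (intro frac_le mult_mono) auto
    qed
  qed simp_all
  then have "(\<lambda>n. (moment_gf (y (n + n0)) - moment_gf t0) / (y (n + n0) - t0))
      \<longlonglongrightarrow> (\<integral>x. of_real x / (1 - t0 * of_real x)\<^sup>2 \<partial>M)"
    by (simp add: quot)
  then show "((\<lambda>y. (moment_gf y - moment_gf t0) / (y - t0)) \<circ> y)
      \<longlonglongrightarrow> (\<integral>x. of_real x / (1 - t0 * of_real x)\<^sup>2 \<partial>M)"
    unfolding comp_def by (rule LIMSEQ_offset)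
qed

lemma moment_gf_holomorphic: "moment_gf holomorphic_on slit_plane"
  unfolding holomorphic_on_open[OF open_slit_plane] using moment_gf_has_derivative by blast

text \<open>Ties the integral to the moments: for small real \<open>t\<close> the geometric series
  can be integrated term by term.\<close>

lemma moment_gf_real:
  assumes t: "0 \<le> t" "t * R < 1"
  shows "moment_gf (of_real t) = of_real (\<Sum>k. (\<integral>x. x ^ k \<partial>M) * t ^ k)"
proof -
  have int: "integrable M (\<lambda>x. x ^ k)" for k
  proof (rule integrable_const_bound[where B = "R ^ k"])
    show "AE x in M. norm (x ^ k) \<le> R ^ k"
      using support by eventually_elim (auto simp: power_abs intro: power_mono)
  qed simp
  have "(\<lambda>k. \<integral>x. x ^ k * t ^ k \<partial>M) sums (\<integral>x. (\<Sum>k. x ^ k * t ^ k) \<partial>M)"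
  proof (rule sums_integral)
    show "integrable M (\<lambda>x. x ^ k * t ^ k)" for k using int by simp
    show "AE x in M. summable (\<lambda>k. norm (x ^ k * t ^ k))"
      using support
    proof eventually_elim
      case (elim x)
      have "x * t \<le> R * t" using elim t by (intro mult_right_mono) auto
      then have "norm (x * t) < 1" using elim t by (simp add: mult.commute)
      then have "summable (\<lambda>k. norm (x * t) ^ k)" by (intro summable_geometric) simp
      then show ?case by (simp add: power_mult_distrib norm_power norm_mult power_abs abs_mult)
    qed
    show "summable (\<lambda>k. \<integral>x. norm (x ^ k * t ^ k) \<partial>M)"
    proof (rule summable_comparison_test')
      show "summable (\<lambda>k. (t * R) ^ k)" using t R_pos by (intro summable_geometric) simp
      fix k :: nat
      have "(\<integral>x. norm (x ^ k * t ^ k) \<partial>M) \<le> (\<integral>x. (t * R) ^ k \<partial>M)"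
      proof (rule integral_mono_AE)
        show "AE x in M. norm (x ^ k * t ^ k) \<le> (t * R) ^ k"
          using support
          by eventually_elim (use t in \<open>auto simp: power_mult_distrib[symmetric] norm_power mult.commute intro!: power_mono mult_left_mono mult_right_mono\<close>)
      qed (use int in auto)
      then show "norm (\<integral>x. norm (x ^ k * t ^ k) \<partial>M) \<le> (t * R) ^ k"
        by (simp add: prob_space[simplified])
    qed
  qed
  then have "(\<Sum>k. (\<integral>x. x ^ k \<partial>M) * t ^ k) = (\<integral>x. (\<Sum>k. x ^ k * t ^ k) \<partial>M)"
    by (simp add: sums_iff)
  also have "\<dots> = (\<integral>x. 1 / (1 - t * x) \<partial>M)"
  proof (rule integral_cong_AE)
    show "AE x in M. (\<Sum>k. x ^ k * t ^ k) = 1 / (1 - t * x)"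
      using support
    proof eventually_elim
      case (elim x)
      have "x * t \<le> R * t" using elim t by (intro mult_right_mono) auto
      then have "norm (x * t) < 1" using elim t by (simp add: mult.commute)
      from suminf_geometric[OF this] show ?case by (simp add: power_mult_distrib mult.commute)
    qed
  qed measurable
  finally have "of_real (\<Sum>k. (\<integral>x. x ^ k \<partial>M) * t ^ k) = (\<integral>x. complex_of_real (1 / (1 - t * x)) \<partial>M)"
    by (simp only: integral_complex_of_real)
  then show ?thesis by (simp add: moment_gf_def)
qed

text \<open>On a short real interval to the right of 0 the equation is the power series identity at
  \<open>y = sqrt t\<close>. Both sides are holomorphic on the connected slit plane and the interval
  accumulates at 0, so the identity theorem extends it.\<close>

lemma moment_gf_equation:
  assumes \<rho>: "\<bar>\<rho>\<bar> \<le> 1" and moments: "\<And>k. (\<integral>x. x ^ k \<partial>M) = fm0 \<rho> (2 * k)" and t: "t \<in> slit_plane"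
  shows "(moment_gf t)\<^sup>2 * ((of_real (\<rho>\<^sup>2 - 1) * (t * (moment_gf t)\<^sup>2) - 1)\<^sup>2 - 4 * (t * (moment_gf t)\<^sup>2)) - 1 = 0"
proof -
  define h where "h = (\<lambda>t. (moment_gf t)\<^sup>2 * ((of_real (\<rho>\<^sup>2 - 1) * (t * (moment_gf t)\<^sup>2) - 1)\<^sup>2 - 4 * (t * (moment_gf t)\<^sup>2)) - 1)"
  \<comment> \<open>Since \<open>s = y\<^sup>2\<close>, the radius 1/8 for \<open>y\<close> becomes
    1/64 for \<open>s\<close>; the bound \<open>1 / R\<close> is the radius for the series of
    \<open>moment_gf\<close>.\<close>
  define r where "r = min (1 / R) (1 / 64)"
  have r: "r > 0" "r \<le> 1 / R" "r \<le> 1 / 64" using R_pos by (simp_all add: r_def)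
  have "h holomorphic_on slit_plane"
    unfolding h_def by (intro holomorphic_intros moment_gf_holomorphic)
  moreover have "of_real ` {0<..<r} \<subseteq> slit_plane"
    using r by (auto simp: slit_plane_def)
  moreover have "(0 :: complex) islimpt of_real ` {0<..<r}"
  proof (rule islimpt_approachable[THEN iffD2], intro allI impI)
    fix e :: real assume "e > 0"
    then show "\<exists>x'\<in>complex_of_real ` {0<..<r}. x' \<noteq> 0 \<and> dist x' 0 < e"
      using r(1) by (intro bexI[of _ "of_real (min e r / 2)"] conjI imageI) auto
  qed
  moreover have "h (of_real s) = 0" if s: "0 < s" "s < r" for s
  proof -
    define y where "y = sqrt s"
    have y: "y\<^sup>2 = s" "\<bar>y\<bar> < 1 / 8"
    proof -
      show "y\<^sup>2 = s" using s by (simp add: y_def)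
      have "s < (1 / 8)\<^sup>2" using s r(3) by (simp add: power2_eq_square)
      then have "y < 1 / 8" unfolding y_def by (metis real_sqrt_less_mono real_sqrt_unique zero_le_divide_1_iff zero_le_numeral)
      then show "\<bar>y\<bar> < 1 / 8" using s by (simp add: y_def)
    qed
    define m where "m = eval_fps (moment_fps \<rho>) y"
    have "m = (\<Sum>n. fps_nth (moment_fps \<rho>) n * y ^ n)"
      by (simp add: m_def eval_fps_def)
    also have "\<dots> = (\<Sum>k. fm0 \<rho> (2 * k) * s ^ k)"
    proof -
      have "strict_mono (\<lambda>k::nat. 2 * k)" by (simp add: strict_mono_def)
      moreover have "fps_nth (moment_fps \<rho>) n * y ^ n = 0" if "n \<notin> range (\<lambda>k. 2 * k)" for n
        using that by (auto simp: moment_fps_def even_part_def elim!: evenE)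
      ultimately have "(\<Sum>k. fps_nth (moment_fps \<rho>) (2 * k) * y ^ (2 * k)) = (\<Sum>n. fps_nth (moment_fps \<rho>) n * y ^ n)"
        by (rule suminf_mono_reindex)
      then show ?thesis by (simp add: moment_fps_def even_part_def power_mult y(1))
    qed
    finally have m: "m = (\<Sum>k. fm0 \<rho> (2 * k) * s ^ k)" .
    have "s < 1 / R" using s(2) r(2) by simp
    then have "s * R < 1" using R_pos by (simp add: field_simps)
    then have gm: "moment_gf (of_real s) = of_real m"
      using moment_gf_real[of s] s by (simp only: moments m less_imp_le)
    have "m\<^sup>2 * (((\<rho>\<^sup>2 - 1) * (y * m)\<^sup>2 - 1)\<^sup>2 - 4 * (y * m)\<^sup>2) = 1"
      unfolding m_def by (rule eval_moment_fps_equation[OF \<rho> y(2)])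
    then have "m\<^sup>2 * (((\<rho>\<^sup>2 - 1) * (s * m\<^sup>2) - 1)\<^sup>2 - 4 * (s * m\<^sup>2)) - 1 = 0"
      by (simp add: power_mult_distrib y(1))
    then have "complex_of_real (m\<^sup>2 * (((\<rho>\<^sup>2 - 1) * (s * m\<^sup>2) - 1)\<^sup>2 - 4 * (s * m\<^sup>2)) - 1) = 0"
      by (simp only: of_real_0)
    then show ?thesis by (simp add: h_def gm)
  qed
  ultimately have "h t = 0"
    by (intro analytic_continuation[of h slit_plane "of_real ` {0<..<r}" 0, OF _ open_slit_plane connected_slit_plane
          _ zero_in_slit_plane _ _ t]) auto
  then show ?thesis by (simp add: h_def)
qed

text \<open>With \<open>g = moment_gf t\<close>, \<open>w = t * g\<^sup>2\<close> and
  \<open>c = 1 - \<rho>\<^sup>2 > 0\<close>, the equation reads \<open>g\<^sup>2 * (c\<^sup>2 *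
  w\<^sup>2 - (4 - 2 * c) * w + 1) = 1\<close>. The lower-order terms are at most
  \<open>4 * norm w + 1\<close>, so a leading term of at least \<open>6 * norm w\<close> leaves at
  least \<open>norm w\<close>; this is the origin of the constant 6.\<close>

lemma moment_gf_growth:
  assumes \<rho>: "\<bar>\<rho>\<bar> < 1" and moments: "\<And>k. (\<integral>x. x ^ k \<partial>M) = fm0 \<rho> (2 * k)" and t: "t \<in> slit_plane"
    and large: "norm t * (norm (moment_gf t))\<^sup>2 \<ge> 6 / (1 - \<rho>\<^sup>2)\<^sup>2"
  shows "(norm (moment_gf t))\<^sup>2 * (norm t * (norm (moment_gf t))\<^sup>2) \<le> 1"
proof -
  define c where "c = 1 - \<rho>\<^sup>2"
  have "\<rho>\<^sup>2 < 1" using \<rho> by (simp add: abs_square_less_1)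
  then have c: "0 < c" "c \<le> 1" by (simp_all add: c_def)
  define w where "w = t * (moment_gf t)\<^sup>2"
  have nw: "norm w = norm t * (norm (moment_gf t))\<^sup>2" by (simp add: w_def norm_mult norm_power)
  have w6: "6 \<le> c\<^sup>2 * norm w"
    using large c unfolding c_def[symmetric] nw[symmetric] by (simp add: field_simps)
  have "c\<^sup>2 \<le> 1" using c by (simp add: power_le_one)
  then have "c\<^sup>2 * norm w \<le> 1 * norm w" by (intro mult_right_mono) auto
  with w6 have w1: "6 \<le> norm w" by simp
  have eq: "(moment_gf t)\<^sup>2 * ((of_real (\<rho>\<^sup>2 - 1) * w - 1)\<^sup>2 - 4 * w) = 1"
    using moment_gf_equation[OF _ moments t] \<rho> by (simp add: w_def)
  have "(of_real (\<rho>\<^sup>2 - 1) * w - 1)\<^sup>2 - 4 * w = of_real (c\<^sup>2) * w\<^sup>2 - (of_real (4 - 2 * c) * w - 1)"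
    by (simp add: c_def power2_eq_square algebra_simps)
  also have "norm \<dots> \<ge> norm (of_real (c\<^sup>2) * w\<^sup>2) - norm (of_real (4 - 2 * c) * w - 1)"
    by (rule norm_triangle_ineq2)
  finally have lower: "c\<^sup>2 * (norm w)\<^sup>2 - norm (of_real (4 - 2 * c) * w - 1) \<le> norm ((of_real (\<rho>\<^sup>2 - 1) * w - 1)\<^sup>2 - 4 * w)"
    by (simp add: norm_mult norm_power)
  have "norm (of_real (4 - 2 * c) * w - 1) \<le> norm (of_real (4 - 2 * c) * w) + norm (1 :: complex)"
    by (rule norm_triangle_ineq4)
  also have "norm (of_real (4 - 2 * c) * w) = \<bar>4 - 2 * c\<bar> * norm w"
    by (simp only: norm_mult norm_of_real)
  also have "\<bar>4 - 2 * c\<bar> * norm w \<le> 4 * norm w"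
    using c by (intro mult_right_mono) auto
  finally have "norm (of_real (4 - 2 * c) * w - 1) \<le> 4 * norm w + 1" by simp
  moreover have "6 * norm w \<le> c\<^sup>2 * (norm w)\<^sup>2"
    using mult_right_mono[OF w6, of "norm w"] by (simp add: power2_eq_square mult.assoc)
  ultimately have "norm w \<le> norm ((of_real (\<rho>\<^sup>2 - 1) * w - 1)\<^sup>2 - 4 * w)"
    using lower w1 by linarith
  then have "(norm (moment_gf t))\<^sup>2 * norm w \<le> (norm (moment_gf t))\<^sup>2 * norm ((of_real (\<rho>\<^sup>2 - 1) * w - 1)\<^sup>2 - 4 * w)"
    by (intro mult_left_mono) auto
  also have "\<dots> = norm ((moment_gf t)\<^sup>2 * ((of_real (\<rho>\<^sup>2 - 1) * w - 1)\<^sup>2 - 4 * w))"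
    by (simp only: norm_mult norm_power)
  also have "\<dots> = 1" by (simp only: eq norm_one)
  finally show ?thesis by (simp only: nw)
qed

text \<open>Along the negative axis, \<open>1 / (1 + s * x)\<close> dominates the indicator of 0, so
  the generating function stays above the mass \<open>p\<close> while \<open>t\<close> tends to
  infinity. This violates \<open>moment_gf_growth\<close>.\<close>

lemma no_atom_zero:
  assumes \<rho>: "\<bar>\<rho>\<bar> < 1" and moments: "\<And>k. (\<integral>x. x ^ k \<partial>M) = fm0 \<rho> (2 * k)"
  shows "measure M {0} = 0"
proof (rule ccontr)
  assume "measure M {0} \<noteq> 0"
  define p where "p = measure M {0}"
  have p: "p > 0" using \<open>measure M {0} \<noteq> 0\<close> by (simp add: p_def zero_less_measure_iff)
  define K where "K = 6 / (1 - \<rho>\<^sup>2)\<^sup>2"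
  \<comment> \<open>The maximum serves two purposes: \<open>s * p\<^sup>2 \<ge> K\<close> puts
    \<open>t = - s\<close> into the range of \<open>moment_gf_growth\<close>, and
    \<open>p\<^sup>2 * (s * p\<^sup>2) \<ge> 2\<close> contradicts its conclusion.\<close>
  define s where "s = max K (2 / p\<^sup>2) / p\<^sup>2"
  have s: "s > 0" "s * p\<^sup>2 \<ge> K" "s * p\<^sup>2 \<ge> 2 / p\<^sup>2"
    using p by (auto simp: s_def less_max_iff_disj)
  have t: "- of_real s \<in> slit_plane" using s R_pos by (simp add: slit_plane_def not_le order.strict_trans1[of "- s" 0])
  have "p \<le> norm (moment_gf (- of_real s))"
  proof -
    have AEeq: "moment_gf (- of_real s) = of_real (\<integral>x. 1 / (1 + s * x) \<partial>M)"
    proof -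
      have "moment_gf (- of_real s) = (\<integral>x. complex_of_real (1 / (1 + s * x)) \<partial>M)"
        by (simp add: moment_gf_def)
      then show ?thesis by (simp only: integral_complex_of_real)
    qed
    have "p = (\<integral>x. indicator {0} x \<partial>M)" by (simp add: p_def)
    also have "\<dots> \<le> (\<integral>x. 1 / (1 + s * x) \<partial>M)"
    proof (rule integral_mono_AE)
      show "integrable M (\<lambda>x. 1 / (1 + s * x))"
      proof (rule integrable_const_bound[where B = 1])
        show "AE x in M. norm (1 / (1 + s * x)) \<le> 1"
          using support
        proof eventually_elim
          case (elim x)
          then have "0 \<le> s * x" using s by simp
          then show ?case by simp
        qed
      qed measurable
      show "AE x in M. indicator {0} x \<le> 1 / (1 + s * x)"
        using support
      proof eventually_elim
        case (elim x)
        then have "0 \<le> s * x" using s by simp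
        then show ?case by (auto simp: indicator_def)
      qed
      show "integrable M (indicator {0} :: real \<Rightarrow> real)"
        by (rule integrable_const_bound[where B = 1]) (auto simp: indicator_def intro!: AE_I2)
    qed
    finally show ?thesis unfolding AEeq by simp
  qed
  then have g2: "p\<^sup>2 \<le> (norm (moment_gf (- of_real s)))\<^sup>2"
    using p by (intro power_mono) auto
  have g: "s * p\<^sup>2 \<le> norm (- of_real s :: complex) * (norm (moment_gf (- of_real s)))\<^sup>2"
    using s(1) g2 by (simp add: mult_left_mono)
  then have "6 / (1 - \<rho>\<^sup>2)\<^sup>2 \<le> norm (- of_real s :: complex) * (norm (moment_gf (- of_real s)))\<^sup>2"
    using s(2) unfolding K_def by linarith
  from moment_gf_growth[OF \<rho> moments t this]
  have "(norm (moment_gf (- of_real s)))\<^sup>2 * (norm (- of_real s :: complex) * (norm (moment_gf (- of_real s)))\<^sup>2) \<le> 1" .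
  moreover have "p\<^sup>2 * (s * p\<^sup>2) \<le> (norm (moment_gf (- of_real s)))\<^sup>2 * (norm (- of_real s :: complex) * (norm (moment_gf (- of_real s)))\<^sup>2)"
    using g g2 s(1) by (intro mult_mono) auto
  moreover have "2 \<le> p\<^sup>2 * (s * p\<^sup>2)"
    using mult_left_mono[OF s(3), of "p\<^sup>2"] p by simp
  ultimately show False by linarith
qed

text \<open>An atom of mass \<open>p\<close> at \<open>a\<close> makes the imaginary part of the
  Cauchy transform at \<open>a + \<i> * e\<close> at least \<open>p / e\<close> in modulus. So the
  generating function blows up as \<open>t = 1 / z\<close> approaches \<open>1 / a\<close>, where
  \<open>norm t\<close> stays away from 0.\<close>

lemma no_atom_pos:
  assumes \<rho>: "\<bar>\<rho>\<bar> < 1" and moments: "\<And>k. (\<integral>x. x ^ k \<partial>M) = fm0 \<rho> (2 * k)" and a: "a > 0"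
  shows "measure M {a} = 0"
proof (rule ccontr)
  assume "measure M {a} \<noteq> 0"
  define p where "p = measure M {a}"
  have p: "p > 0" using \<open>measure M {a} \<noteq> 0\<close> by (simp add: p_def zero_less_measure_iff)
  define K where "K = max 1 (6 / (1 - \<rho>\<^sup>2)\<^sup>2)"
  \<comment> \<open>\<open>e \<le> a\<close> keeps \<open>norm z\<close> below \<open>2 * a\<close>,
    and \<open>e \<le> a * p / B\<close> makes the generating function at least \<open>B\<close> in
    modulus. Then \<open>norm t\<close> times its square is at least
    \<open>B / a \<ge> 2 * K\<close>, and the final product is at least
    \<open>(2 * B) * (2 * K) \<ge> 8\<close>.\<close>
  define B where "B = max 2 (2 * a * K)"
  define e where "e = min a (a * p / B)"
  have B: "B \<ge> 2" "B \<ge> 2 * a * K" by (simp_all add: B_def)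
  have e: "e > 0" "e \<le> a" "e \<le> a * p / B" using a p B by (auto simp: e_def)
  define z where "z = Complex a e"
  define t where "t = 1 / z"
  have z0: "z \<noteq> 0" using a by (auto simp: z_def complex_eq_iff)
  have "Im t \<noteq> 0"
    using e a by (simp add: t_def z_def Im_divide power2_eq_square sum_squares_eq_zero_iff)
  then have t: "t \<in> slit_plane" by (simp add: slit_plane_def)
  have norm_z: "a \<le> norm z" "norm z \<le> 2 * a"
  proof -
    show "a \<le> norm z" using abs_Re_le_cmod[of z] by (simp add: z_def)
    show "norm z \<le> 2 * a" using cmod_le[of z] a e by (simp add: z_def)
  qed
  have gf: "moment_gf t = z * (\<integral>x. 1 / (z - of_real x) \<partial>M)"
  proof -
    have "1 / (1 - t * of_real x) = z * (1 / (z - of_real x))" for x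
    proof -
      have "z - of_real x \<noteq> 0" using e by (auto simp: z_def complex_eq_iff)
      then show ?thesis using z0 by (simp add: t_def field_simps)
    qed
    then show ?thesis unfolding moment_gf_def by (simp only: integral_mult_right_zero)
  qed
  have int: "integrable M (\<lambda>x. 1 / (z - of_real x))"
  proof (rule integrable_const_bound[where B = "1 / e"])
    have "norm (1 / (z - of_real x)) \<le> 1 / e" for x
      using abs_Im_le_cmod[of "z - of_real x"] e by (simp add: norm_divide z_def frac_le)
    then show "AE x in M. norm (1 / (z - of_real x)) \<le> 1 / e" by simp
  qed measurable
  have im: "- Im (1 / (z - of_real x)) = e / ((a - x)\<^sup>2 + e\<^sup>2)" for x
    by (simp add: z_def Im_divide)
  have "p / e \<le> norm (\<integral>x. 1 / (z - of_real x) \<partial>M)"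
  proof -
    have "p / e = (\<integral>x. indicator {a} x / e \<partial>M)" by (simp add: p_def)
    also have "\<dots> \<le> (\<integral>x. - Im (1 / (z - of_real x)) \<partial>M)"
    proof (rule integral_mono)
      show "integrable M (\<lambda>x. - Im (1 / (z - of_real x)))"
        using integrable_Im[OF int] by simp
      show "indicator {a} x / e \<le> - Im (1 / (z - of_real x))" for x
        unfolding im using e by (auto simp: indicator_def power2_eq_square)
      show "integrable M (\<lambda>x. indicator {a} x / e)"
        by (rule integrable_const_bound[where B = "1 / e"])
           (use e in \<open>auto simp: indicator_def intro!: AE_I2\<close>)
    qed
    also have "\<dots> = - Im (\<integral>x. 1 / (z - of_real x) \<partial>M)"
      using integral_Im[OF int] by simp
    also have "\<dots> \<le> norm (\<integral>x. 1 / (z - of_real x) \<partial>M)"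
      using abs_Im_le_cmod[of "\<integral>x. 1 / (z - of_real x) \<partial>M"] by linarith
    finally show ?thesis .
  qed
  then have "a * (p / e) \<le> norm z * norm (\<integral>x. 1 / (z - of_real x) \<partial>M)"
    using norm_z(1) a p e by (intro mult_mono) auto
  then have g1: "a * (p / e) \<le> norm (moment_gf t)" by (simp add: gf norm_mult)
  have "B \<le> a * (p / e)" using e(1,3) B by (simp add: field_simps)
  with g1 have gB: "B \<le> norm (moment_gf t)" by linarith
  have "B * B \<le> (norm (moment_gf t))\<^sup>2"
    unfolding power2_eq_square using gB B by (intro mult_mono) auto
  moreover have "2 * B \<le> B * B" using B by (intro mult_right_mono) auto
  ultimately have g2: "2 * B \<le> (norm (moment_gf t))\<^sup>2" by linarith
  have nt: "1 / (2 * a) \<le> norm t"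
    using norm_z z0 a by (simp add: t_def norm_divide frac_le)
  have "1 / (2 * a) * (2 * B) \<le> norm t * (norm (moment_gf t))\<^sup>2"
    using nt g2 a B by (intro mult_mono) auto
  moreover have "2 * K \<le> 1 / (2 * a) * (2 * B)"
    using B(2) a by (simp add: field_simps)
  ultimately have g: "2 * K \<le> norm t * (norm (moment_gf t))\<^sup>2" by linarith
  have K: "K \<ge> 1" "K \<ge> 6 / (1 - \<rho>\<^sup>2)\<^sup>2" by (simp_all add: K_def)
  then have "6 / (1 - \<rho>\<^sup>2)\<^sup>2 \<le> norm t * (norm (moment_gf t))\<^sup>2" using g by linarith
  from moment_gf_growth[OF \<rho> moments t this]
  have "(norm (moment_gf t))\<^sup>2 * (norm t * (norm (moment_gf t))\<^sup>2) \<le> 1" .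
  moreover have "(2 * B) * (2 * K) \<le> (norm (moment_gf t))\<^sup>2 * (norm t * (norm (moment_gf t))\<^sup>2)"
    by (rule mult_mono[OF g2 g]) (use K in auto)
  moreover have "4 * 2 \<le> (2 * B) * (2 * K)" using B K by (intro mult_mono) auto
  ultimately show False by linarith
qed

lemma no_atoms:
  assumes "\<bar>\<rho>\<bar> < 1" and "\<And>k. (\<integral>x. x ^ k \<partial>M) = fm0 \<rho> (2 * k)"
  shows "measure M {a} = 0"
proof -
  consider "a = 0" | "a > 0" | "a < 0" by linarith
  then show ?thesis
  proof cases
    case 3
    have "AE x in M. x \<noteq> a" using support by eventually_elim (use 3 in auto)
    then have "emeasure M {a} = 0" by (subst (asm) AE_iff_measurable[where N = "{a}"]) auto
    then show ?thesis by (simp add: measure_def)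
  qed (use no_atom_zero[OF assms] no_atom_pos[OF assms] in auto)
qed

end

section \<open>The limit distribution\<close>

text \<open>Turns the expected spectral distribution function into the distribution function of a
  probability measure, to which the method of moments applies.\<close>

lemma mean_spectral_distribution:
  fixes M :: "'a measure"
  assumes elliptic: "elliptic_matrix M \<rho> N X" and N: "N \<ge> 1"
  obtains \<mu> where "real_distribution \<mu>" "AE x in \<mu>. 0 \<le> x"
    "\<And>x. cdf \<mu> x = expected_spectral_df M N X x" "\<And>k. integrable \<mu> (\<lambda>x. x ^ k)"
    "\<And>k. (\<integral>x. x ^ k \<partial>\<mu>)
      = (\<integral>\<omega>. (\<Sum>i<N. (square_covariance N (X \<omega>) ^\<^sub>m k) $$ (i, i)) \<partial>M) / real N"
proof -
  interpret prob_space M using elliptic by (simp add: elliptic_matrix_def)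
  \<comment> \<open>The default 0 for \<open>i \<ge> N\<close> makes \<open>ev i\<close> measurable
    and nonnegative for all \<open>i\<close>.\<close>
  define ev where "ev i \<omega> = (if i < N then gram_eigenvalues N (X \<omega>) ! i else 0)" for i \<omega>
  have A: "X \<omega> \<in> carrier_mat N N" if "\<omega> \<in> space M" for \<omega>
    using elliptic that by (simp add: elliptic_matrix_def)
  note int = expected_spectral_moment(1)[OF elliptic]
  have trace: "(\<Sum>i<N. (square_covariance N (X \<omega>) ^\<^sub>m k) $$ (i, i)) = (\<Sum>i<N. ev i \<omega> ^ k)"
    if "\<omega> \<in> space M" for \<omega> k
    unfolding gram_eigenvalues(4)[OF A[OF that]] by (intro sum.cong) (simp_all add: ev_def)
  have count: "spectral_df N (square_covariance N (X \<omega>)) x = (1 / real N) * real (card {i. i < N \<and> ev i \<omega> \<le> x})"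
    if "\<omega> \<in> space M" for \<omega> x
  proof -
    have "{i. i < N \<and> gram_eigenvalues N (X \<omega>) ! i \<le> x} = {i. i < N \<and> ev i \<omega> \<le> x}"
      by (auto simp: ev_def)
    then show ?thesis unfolding gram_eigenvalues(5)[OF A[OF that]] by simp
  qed
  have intp: "integrable M (\<lambda>\<omega>. \<Sum>i<N. ev i \<omega> ^ k)" for k
    using int[of k] by (subst (asm) Bochner_Integration.integrable_cong[OF refl trace])
  then have count_meas: "(\<lambda>\<omega>. real (card {i. i < N \<and> ev i \<omega> \<le> x})) \<in> borel_measurable M" for x
    by (intro borel_measurable_count_le borel_measurable_integrable)
  have ev_le: "ev i \<omega> \<le> x \<longleftrightarrow> real i < real (card {i. i < N \<and> ev i \<omega> \<le> x})"
    if "\<omega> \<in> space M" "i < N" for i \<omega> x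
  proof -
    note g = gram_eigenvalues(1,2)[OF A[OF that(1)]]
    have "{j. j < N \<and> gram_eigenvalues N (X \<omega>) ! j \<le> x} = {i. i < N \<and> ev i \<omega> \<le> x}"
      by (auto simp: ev_def)
    then show ?thesis
      using sorted_nth_le_iff[OF g(2), of i x] that(2) by (simp add: g(1) ev_def)
  qed
  have meas: "ev i \<in> borel_measurable M" for i
  proof (cases "i < N")
    case True
    have "{\<omega> \<in> space M. ev i \<omega> \<le> x} \<in> sets M" for x
    proof -
      have "{\<omega> \<in> space M. ev i \<omega> \<le> x} = {\<omega> \<in> space M. real i < real (card {i. i < N \<and> ev i \<omega> \<le> x})}"
        using ev_le[OF _ True] by blast
      also have "\<dots> \<in> sets M"
        by (rule borel_measurable_less[OF borel_measurable_const count_meas])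
      finally show ?thesis .
    qed
    then show ?thesis by (simp add: borel_measurable_iff_le)
  next
    case False
    then have "ev i = (\<lambda>_. 0)" by (simp add: ev_def fun_eq_iff)
    then show ?thesis by simp
  qed
  have ev0: "0 \<le> ev i \<omega>" if "\<omega> \<in> space M" for i \<omega>
    using gram_eigenvalues(1,3)[OF A[OF that]] by (simp add: ev_def)
  obtain \<mu> where rd: "real_distribution \<mu>"
    and nn: "\<And>g. g \<in> borel_measurable borel \<Longrightarrow> (\<integral>\<^sup>+x. g x \<partial>\<mu>) = (\<Sum>i<N. \<integral>\<^sup>+\<omega>. g (ev i \<omega>) \<partial>M) / N"
    by (rule mixture_distribution[where ev = ev, OF meas N]) blast
  interpret \<mu>: real_distribution \<mu> by (rule rd)
  \<comment> \<open>Eigenvalues are nonnegative, so \<open>g\<close> and \<open>h\<close> have to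
    agree only there. This allows powers, whose values on the negative axis may be negative, and the
    indicator of the negative axis with \<open>h = 0\<close>.\<close>
  have nn': "(\<integral>\<^sup>+x. g x \<partial>\<mu>) = ennreal ((\<integral>\<omega>. (\<Sum>i<N. h (ev i \<omega>)) \<partial>M) / real N)"
    if g [measurable]: "g \<in> borel_measurable borel" and gh: "\<And>x. 0 \<le> x \<Longrightarrow> g x = ennreal (h x)"
      "\<And>x. 0 \<le> x \<Longrightarrow> 0 \<le> h x"
      and int: "integrable M (\<lambda>\<omega>. \<Sum>i<N. h (ev i \<omega>))" for g :: "real \<Rightarrow> ennreal" and h
  proof -
    note [measurable] = meas
    have nonneg: "0 \<le> (\<Sum>i<N. h (ev i \<omega>))" if "\<omega> \<in> space M" for \<omega>
      by (intro sum_nonneg gh(2) ev0 that)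
    have "(\<Sum>i<N. \<integral>\<^sup>+\<omega>. g (ev i \<omega>) \<partial>M) = (\<integral>\<^sup>+\<omega>. (\<Sum>i<N. g (ev i \<omega>)) \<partial>M)"
      by (rule nn_integral_sum[symmetric]) measurable
    also have "\<dots> = (\<integral>\<^sup>+\<omega>. ennreal (\<Sum>i<N. h (ev i \<omega>)) \<partial>M)"
    proof (rule nn_integral_cong)
      fix \<omega> assume \<omega>: "\<omega> \<in> space M"
      have "(\<Sum>i<N. g (ev i \<omega>)) = (\<Sum>i<N. ennreal (h (ev i \<omega>)))"
        by (intro sum.cong refl gh(1) ev0 \<omega>)
      also have "\<dots> = ennreal (\<Sum>i<N. h (ev i \<omega>))"
        by (intro sum_ennreal gh(2) ev0 \<omega>)
      finally show "(\<Sum>i<N. g (ev i \<omega>)) = ennreal (\<Sum>i<N. h (ev i \<omega>))" .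
    qed
    also have "\<dots> = ennreal (\<integral>\<omega>. (\<Sum>i<N. h (ev i \<omega>)) \<partial>M)"
      by (rule nn_integral_eq_integral[OF int AE_I2[OF nonneg]])
    finally have "(\<integral>\<^sup>+x. g x \<partial>\<mu>) = ennreal (\<integral>\<omega>. (\<Sum>i<N. h (ev i \<omega>)) \<partial>M) / ennreal (real N)"
      by (simp add: nn[OF g] ennreal_of_nat_eq_real_of_nat)
    also have "\<dots> = ennreal ((\<integral>\<omega>. (\<Sum>i<N. h (ev i \<omega>)) \<partial>M) / real N)"
      using N by (intro divide_ennreal integral_nonneg_AE AE_I2 nonneg) auto
    finally show ?thesis .
  qed
  have pos: "AE x in \<mu>. 0 \<le> x"
  proof -
    have "emeasure \<mu> {..<0} = (\<integral>\<^sup>+x. indicator {..<0} x \<partial>\<mu>)" by simp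
    also have "\<dots> = ennreal ((\<integral>\<omega>. (\<Sum>i<N. (\<lambda>_. 0) (ev i \<omega>)) \<partial>M) / real N)"
      by (rule nn') simp_all
    finally have "emeasure \<mu> {..<0} = 0" by simp
    then show ?thesis
      by (intro AE_iff_measurable[THEN iffD2, of "{..<0}"]) auto
  qed
  have int\<mu>: "integrable \<mu> (\<lambda>x. x ^ k) \<and> (\<integral>x. x ^ k \<partial>\<mu>) = (\<integral>\<omega>. (\<Sum>i<N. ev i \<omega> ^ k) \<partial>M) / real N" for k
  proof (rule nn_integral_eq_integrable[THEN iffD1])
    show "(\<integral>\<^sup>+x. ennreal (x ^ k) \<partial>\<mu>) = ennreal ((\<integral>\<omega>. (\<Sum>i<N. ev i \<omega> ^ k) \<partial>M) / real N)"
      by (rule nn') (simp_all add: intp)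
    show "AE x in \<mu>. 0 \<le> x ^ k" using pos by eventually_elim simp
    show "0 \<le> (\<integral>\<omega>. (\<Sum>i<N. ev i \<omega> ^ k) \<partial>M) / real N"
      by (intro divide_nonneg_nonneg integral_nonneg_AE AE_I2 sum_nonneg zero_le_power ev0) simp_all
  qed simp
  show ?thesis
  proof (rule that[OF rd pos])
    fix k show "integrable \<mu> (\<lambda>x. x ^ k)" using int\<mu> by blast
    have "(\<integral>\<omega>. (\<Sum>i<N. (square_covariance N (X \<omega>) ^\<^sub>m k) $$ (i, i)) \<partial>M) = (\<integral>\<omega>. (\<Sum>i<N. ev i \<omega> ^ k) \<partial>M)"
      by (rule Bochner_Integration.integral_cong[OF refl trace])
    then show "(\<integral>x. x ^ k \<partial>\<mu>)
      = (\<integral>\<omega>. (\<Sum>i<N. (square_covariance N (X \<omega>) ^\<^sub>m k) $$ (i, i)) \<partial>M) / real N"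
      using int\<mu>[of k] by simp
  next
    fix x :: real
    let ?h = "\<lambda>y. if y \<le> x then 1 else 0 :: real"
    have card: "(\<Sum>i<N. ?h (ev i \<omega>)) = real (card {i. i < N \<and> ev i \<omega> \<le> x})" for \<omega>
      by (simp add: sum.If_cases Collect_conj_eq lessThan_def)
    have "integrable M (\<lambda>\<omega>. \<Sum>i<N. ?h (ev i \<omega>))"
      unfolding card
    proof (rule integrable_const_bound[where B = N])
      show "AE \<omega> in M. norm (real (card {i. i < N \<and> ev i \<omega> \<le> x})) \<le> real N"
      proof (rule AE_I2)
        fix \<omega>
        have "card {i. i < N \<and> ev i \<omega> \<le> x} \<le> card {..<N}" by (rule card_mono) auto
        then show "norm (real (card {i. i < N \<and> ev i \<omega> \<le> x})) \<le> real N" by simp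
      qed
    qed (rule count_meas)
    then have "(\<integral>\<^sup>+y. indicator {..x} y \<partial>\<mu>) = ennreal ((\<integral>\<omega>. (\<Sum>i<N. ?h (ev i \<omega>)) \<partial>M) / real N)"
      by (intro nn') (simp_all add: indicator_def)
    then have "emeasure \<mu> {..x} = ennreal ((\<integral>\<omega>. real (card {i. i < N \<and> ev i \<omega> \<le> x}) \<partial>M) / real N)"
      unfolding card by simp
    then have "cdf \<mu> x = (\<integral>\<omega>. real (card {i. i < N \<and> ev i \<omega> \<le> x}) \<partial>M) / real N"
      unfolding cdf_def measure_def by (simp add: divide_nonneg_nonneg integral_nonneg_AE)
    also have "\<dots> = (\<integral>\<omega>. 1 / real N * real (card {i. i < N \<and> ev i \<omega> \<le> x}) \<partial>M)"
      by (simp only: integral_mult_right_zero) simp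
    also have "\<dots> = expected_spectral_df M N X x"
      unfolding expected_spectral_df_def
      by (rule Bochner_Integration.integral_cong[OF refl count[symmetric]])
    finally show "cdf \<mu> x = expected_spectral_df M N X x" .
  qed
qed

text \<open>The bounded continuous function \<open>?f\<close> is nonnegative and vanishes exactly on
  \<open>[0, \<infinity>)\<close>, so its integral detects mass on the negative axis and passes to
  the limit.\<close>

lemma AE_nonneg_weak_limit:
  assumes rd: "\<And>n. real_distribution (\<mu> n)" "real_distribution \<nu>" and w: "weak_conv_m \<mu> \<nu>"
    and pos: "\<And>n. AE x in \<mu> n. 0 \<le> x"
  shows "AE x in \<nu>. 0 \<le> (x :: real)"
proof -
  interpret \<nu>: real_distribution \<nu> by (rule rd(2))
  let ?f = "\<lambda>x :: real. min 1 (max 0 (- x))"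
  have "(\<lambda>n. \<integral>x. ?f x \<partial>\<mu> n) \<longlonglongrightarrow> (\<integral>x. ?f x \<partial>\<nu>)"
    by (rule weak_conv_imp_integral_bdd_continuous_conv[OF rd w, where B = 1]) (auto intro!: continuous_intros)
  moreover have "(\<integral>x. ?f x \<partial>\<mu> n) = 0" for n
  proof -
    interpret real_distribution "\<mu> n" by (rule rd(1))
    have "AE x in \<mu> n. ?f x = 0" using pos by eventually_elim simp
    then have "(\<integral>x. ?f x \<partial>\<mu> n) = (\<integral>x. 0 \<partial>\<mu> n)" by (intro integral_cong_AE) simp_all
    then show ?thesis by simp
  qed
  ultimately have 0: "(\<integral>x. ?f x \<partial>\<nu>) = 0"
    by (simp add: LIMSEQ_const_iff)
  have "integrable \<nu> ?f" by (rule \<nu>.integrable_const_bound[where B = 1]) simp_all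
  then have "AE x in \<nu>. ?f x = 0"
    using 0 by (subst (asm) integral_nonneg_eq_0_iff_AE) simp_all
  then show ?thesis by eventually_elim (simp add: min_def max_def split: if_splits)
qed

text \<open>The support bound 16 is the square of the base 4 in \<open>fm_bound\<close>, since the
  moment of order \<open>k\<close> is \<open>fm0 \<rho> (2 * k)\<close>. The measures are indexed by
  \<open>Suc n\<close> because the matrices are elliptic from size 1 on.\<close>

lemma limit_spectral_distribution:
  fixes M :: "nat \<Rightarrow> 'a measure"
  assumes \<rho>: "\<bar>\<rho>\<bar> < 1" and elliptic: "\<And>N. N \<ge> 1 \<Longrightarrow> elliptic_matrix (M N) \<rho> N (X N)"
  obtains \<nu> where "real_distribution \<nu>" "AE x in \<nu>. 0 \<le> x \<and> x \<le> 16" "\<And>a. measure \<nu> {a} = 0"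
    "\<And>x. (\<lambda>N. expected_spectral_df (M N) N (X N) x) \<longlonglongrightarrow> cdf \<nu> x"
    "\<And>k. moment \<nu> k = fm0 \<rho> (2 * k)"
proof -
  have \<rho>': "\<bar>\<rho>\<bar> \<le> 1" using \<rho> by simp
  have "\<forall>n. \<exists>\<mu>. real_distribution \<mu> \<and> (AE x in \<mu>. 0 \<le> x)
    \<and> (\<forall>x. cdf \<mu> x = expected_spectral_df (M (Suc n)) (Suc n) (X (Suc n)) x)
    \<and> (\<forall>k. integrable \<mu> (\<lambda>x. x ^ k)) \<and> (\<forall>k. (\<integral>x. x ^ k \<partial>\<mu>)
      = (\<integral>\<omega>. (\<Sum>i<Suc n. (square_covariance (Suc n) (X (Suc n) \<omega>) ^\<^sub>m k) $$ (i, i)) \<partial>M (Suc n)) / real (Suc n))"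
    (is "\<forall>n. \<exists>\<mu>. ?P n \<mu>")
  proof
    fix n
    have N: "1 \<le> Suc n" by simp
    show "\<exists>\<mu>. ?P n \<mu>"
      by (rule mean_spectral_distribution[OF elliptic[OF N] N], intro exI conjI allI) assumption+
  qed
  from choice[OF this] obtain \<mu> where \<mu>: "\<forall>n. ?P n (\<mu> n)" ..
  note rd = spec[OF \<mu>, THEN conjunct1]
  note pos = spec[OF \<mu>, THEN conjunct2, THEN conjunct1]
  note cdf = spec[OF \<mu>, THEN conjunct2, THEN conjunct2, THEN conjunct1, THEN spec]
  note int = spec[OF \<mu>, THEN conjunct2, THEN conjunct2, THEN conjunct2, THEN conjunct1, THEN spec]
  note mom = spec[OF \<mu>, THEN conjunct2, THEN conjunct2, THEN conjunct2, THEN conjunct2, THEN spec]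
  have lim: "(\<lambda>n. \<integral>x. x ^ k \<partial>\<mu> n) \<longlonglongrightarrow> fm0 \<rho> (2 * k)" for k
    unfolding mom by (rule LIMSEQ_Suc[OF expected_spectral_moment_tendsto[OF elliptic \<rho>']])
  have bound: "fm0 \<rho> (2 * k) \<le> 2 * 16 ^ k" for k
    using fm_bound[OF \<rho>', of "2 * k"] by (simp add: power_mult)
  obtain \<nu> where \<nu>: "real_distribution \<nu>" "weak_conv_m \<mu> \<nu>" "\<And>k. (\<integral>x. x ^ k \<partial>\<nu>) = fm0 \<rho> (2 * k)"
    "AE x in \<nu>. \<bar>x\<bar> \<le> 16"
    by (rule method_of_moments[OF rd int lim bound]) (simp, blast)
  have nonneg: "AE x in \<nu>. 0 \<le> x"
    by (rule AE_nonneg_weak_limit[OF rd \<nu>(1,2) pos])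
  have support: "AE x in \<nu>. 0 \<le> x \<and> x \<le> 16"
    using nonneg \<nu>(4) by eventually_elim simp
  interpret bounded_distribution \<nu> 16
    by (intro bounded_distribution.intro bounded_distribution_axioms.intro \<nu>(1) support) simp
  have no_atoms: "measure \<nu> {a} = 0" for a by (rule no_atoms[OF \<rho> \<nu>(3)])
  have conv: "(\<lambda>N. expected_spectral_df (M N) N (X N) x) \<longlonglongrightarrow> cdf \<nu> x" for x
  proof (rule LIMSEQ_imp_Suc)
    \<comment> \<open>Without atoms every \<open>x\<close> is a continuity point, which upgrades
      weak convergence to the pointwise limit that \<open>limiting_spectral_df\<close> takes at
      every argument.\<close>
    have "isCont (cdf \<nu>) x" by (simp add: isCont_cdf no_atoms)
    then have "(\<lambda>n. cdf (\<mu> n) x) \<longlonglongrightarrow> cdf \<nu> x"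
      using \<nu>(2) by (simp only: weak_conv_m_def weak_conv_def)
    then show "(\<lambda>n. expected_spectral_df (M (Suc n)) (Suc n) (X (Suc n)) x) \<longlonglongrightarrow> cdf \<nu> x"
      by (simp only: cdf)
  qed
  show ?thesis
    by (rule that[OF \<nu>(1) support no_atoms conv]) (simp only: moment_def \<nu>(3))
qed

theorem theorem1p2:
  fixes \<rho> :: real
    and M :: "nat \<Rightarrow> 'a measure"
    and X :: "nat \<Rightarrow> 'a \<Rightarrow> real mat"
  assumes "-1 < \<rho>" and "\<rho> < 1"
    and "\<And>N. N \<ge> 1 \<Longrightarrow> elliptic_matrix (M N) \<rho> N (X N)"
  shows "let F = limiting_spectral_df M X;
             \<mu> = interval_measure F;
             G = symmetrization \<mu>
         in
           (\<forall>x. (\<lambda>N. expected_spectral_df (M N) N (X N) x) \<longlonglongrightarrow> F x) \<and>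
           compactly_supported \<mu> \<and> (AE x in \<mu>. 0 \<le> x) \<and> cdf \<mu> = F \<and>
           compactly_supported G \<and> (\<forall>x. cdf G x = 1 / 2 * (1 + sgn x * F (x\<^sup>2))) \<and>
           (\<forall>\<nu>. compactly_supported \<nu> \<and> (\<forall>n\<ge>1. free_cumulant \<nu> n = free_cumulant G n)
                 \<longrightarrow> \<nu> = G) \<and>
           (\<forall>n. odd n \<longrightarrow> free_cumulant G n = 0) \<and>
           (\<forall>n\<ge>1. free_cumulant G (2 * n) = (\<Sum>k=0..n. (real (n choose k))\<^sup>2 * \<rho> ^ (2 * k))) \<and>
           R_transform G =
             (1 / fps_radical root 2
                    ((fps_const (\<rho>\<^sup>2 - 1) * fps_X\<^sup>2 - 1)\<^sup>2 - 4 * fps_X\<^sup>2) - 1) / fps_X"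
proof -
  have "\<bar>\<rho>\<bar> < 1" using assms(1,2) by simp
  then obtain \<nu> where rd: "real_distribution \<nu>" and supp: "AE x in \<nu>. 0 \<le> x \<and> x \<le> 16"
    and no_atoms: "\<And>a. measure \<nu> {a} = 0"
    and conv: "\<And>x. (\<lambda>N. expected_spectral_df (M N) N (X N) x) \<longlonglongrightarrow> cdf \<nu> x"
    and mom: "\<And>k. moment \<nu> k = fm0 \<rho> (2 * k)"
    using limit_spectral_distribution[OF _ assms(3)] by blast
  have F: "limiting_spectral_df M X = cdf \<nu>"
    by (rule ext) (simp only: limiting_spectral_df_def limI[OF conv])
  have \<mu>: "interval_measure (cdf \<nu>) = \<nu>" by (rule interval_measure_cdf[OF rd])
  define G where "G = symmetrization \<nu>"
  have nonneg: "AE x in \<nu>. 0 \<le> x" using supp by eventually_elim simp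
  have rdG: "real_distribution G"
    unfolding G_def by (rule real_distribution_symmetrization[OF rd])
  have bounded: "compactly_supported m" if "real_distribution m" "AE x in m. x \<in> {-a..a}" for m and a :: real
    unfolding compactly_supported_def using that compact_Icc by blast
  have cs: "compactly_supported \<nu>"
    by (rule bounded[OF rd, of 16]) (use supp in eventually_elim, simp)
  have "AE y in G. \<bar>y\<bar> \<le> sqrt 16"
    unfolding G_def by (rule moment_symmetrization(1)[OF rd _ supp]) simp
  then have "AE y in G. y \<in> {-sqrt 16..sqrt 16}" by eventually_elim (simp add: abs_le_iff)
  then have csG: "compactly_supported G" by (rule bounded[OF rdG])
  have "moment G n = (if even n then fm0 \<rho> n else 0)" for n
    unfolding G_def by (subst moment_symmetrization(2)[OF rd _ supp]) (simp_all add: mom)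
  then have R: "R_transform G = R_series \<rho>"
    by (rule R_transform_eq[OF rdG])
  have odd: "free_cumulant G n = 0" if "odd n" for n
    using that by (cases n) (simp_all add: free_cumulant_def R R_series_nth)
  have even: "free_cumulant G (2 * n) = (\<Sum>k=0..n. (real (n choose k))\<^sup>2 * \<rho> ^ (2 * k))" if "n \<ge> 1" for n
  proof -
    have n: "odd (2 * n - 1)" "Suc (2 * n - 1) div 2 = n" using that by simp_all
    have "free_cumulant G (2 * n) = narayana_B (\<rho>\<^sup>2) n"
      by (simp only: free_cumulant_def R R_series_nth n not_False_eq_True if_True)
    then show ?thesis by (simp only: narayana_B_def power_mult)
  qed
  have unique: "\<forall>\<nu>'. compactly_supported \<nu>' \<and> (\<forall>n\<ge>1. free_cumulant \<nu>' n = free_cumulant G n) \<longrightarrow> \<nu>' = G"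
    using distribution_eq_of_free_cumulants[OF _ csG] by blast
  have cdfG: "\<forall>x. cdf G x = 1 / 2 * (1 + sgn x * cdf \<nu> (x\<^sup>2))"
    unfolding G_def using cdf_symmetrization[OF rd nonneg no_atoms] by blast
  have "\<forall>x. (\<lambda>N. expected_spectral_df (M N) N (X N) x) \<longlonglongrightarrow> cdf \<nu> x"
    and "\<forall>n. odd n \<longrightarrow> free_cumulant G n = 0"
    and "\<forall>n\<ge>1. free_cumulant G (2 * n) = (\<Sum>k=0..n. (real (n choose k))\<^sup>2 * \<rho> ^ (2 * k))"
    by (intro allI impI conv odd even; assumption)+
  with cs nonneg csG cdfG unique R[unfolded R_series_def disc_def] show ?thesis
    unfolding Let_def F \<mu> G_def[symmetric] by (intro conjI refl)
qed

end
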